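(* Let $\mu=\mu_d$ be a (sequence of) probability measure(s) on $\mathbb{R}^d$ supported on $\{\boldsymbol{x}\in\mathbb{R}^d:\|\boldsymbol{x}\|_2\le 1\}$ such that $\liminf_{d\to\infty}\int\|\boldsymbol{x}\|\,\mu(\mathrm{d}\boldsymbol{x})=\alpha>0$. Assume that there exist $t_{\mathrm{alg}}=t_{\mathrm{alg}}(d)>0$, a polynomial-time computable drift $\hat{\boldsymbol m}_0:\mathbb{R}^d\times\mathbb{R}_{\ge 0}\to\mathbb{R}^d$, and functions $\eta_1(d),\delta(d),\eta_2(d)=o_d(1)$ such that: (i) $\sup_{\boldsymbol y,t}\|\hat{\boldsymbol m}_0(\boldsymbol y,t)\|\le 1$. (ii) (Small norm below threshold, rate $\eta_1$.) With $\boldsymbol y_t=t\boldsymbol x+\boldsymbol W_t$, for any fixed $\varepsilon,\gamma>0$, $$\int_0^{(1-\gamma)t_{\mathrm{alg}}}\mathbb{P}\big(\|\hat{\boldsymbol m}_0(\boldsymbol y_t,t)\|\ge\varepsilon\big)\,\mathrm{d}t=O(\eta_1(d)).$$ (iii) (Hypothesis testing succeeds above threshold, rates $\delta,\eta_2$.) For a fixed $c\in(0,1)$ let $\mathcal{A}_d(c)=\{\boldsymbol a\in\mathbb{R}^d:\|\boldsymbol a\|\le c\,t_{\mathrm{alg}}\}$. There is a polynomial-time computable test $\phi:\mathbb{R}^d\times\mathbb{R}_{\ge0}\to\{0,1\}$ such that $$\int_{t_{\mathrm{alg}}(1+\delta)}^{\infty}\mathbb{P}(\phi(\boldsymbol y_t,t)=0)\,\mathrm{d}t=O(\eta_2(d)),$$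 $$\mathbb{P}\Big(\exists\, t\ge t_{\mathrm{alg}}(1+\delta)\text{ such that }\sup_{\boldsymbol a\in\mathcal{A}_d(c)}\phi(\boldsymbol a+\boldsymbol W_t,t)=1\Big)=o(1).$$ Then there exists a modified drift $\hat{\boldsymbol m}:\mathbb{R}^d\times\mathbb{R}_{\ge0}\to\mathbb{R}^d$ such that: M1. $\hat{\boldsymbol m}$ can be evaluated in polynomial time. M2. With $\boldsymbol y_t=t\boldsymbol x+\boldsymbol W_t$ the true diffusion, $\displaystyle\int_0^\infty\mathbb{E}\big[\|\hat{\boldsymbol m}(\boldsymbol y_t,t)-\hat{\boldsymbol m}_0(\boldsymbol y_t,t)\|^2\big]\,\mathrm{d}t=O(\eta_1(d)\vee\eta_2(d))$. M3. For any step size $\Delta=\Delta_d>0$, letting $(\hat{\boldsymbol y}_t)_{t\in\mathbb{N}\cdot\Delta}$ be the discretized diffusion driven by $\hat{\boldsymbol m}$, $$\inf_{t\in\mathbb{N}\cdot\Delta,\;t\ge(1+\delta)t_{\mathrm{alg}}}W_1(\hat{\boldsymbol m}(\hat{\boldsymbol y}_t,t),\boldsymbol x)\ge\alpha-o_d(1).$$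
   Context: All objects are sequences indexed by the dimension $d$; asymptotic notation is as $d\to\infty$; "polynomial time" means time polynomial in $d$. $(\boldsymbol x,(\boldsymbol W_t)_{t\ge0})$ has law $\mu\otimes\mathrm{BM}$: $\boldsymbol x\sim\mu$ and $\boldsymbol W$ is an independent standard $d$-dimensional Brownian motion. Given a drift $\hat{\boldsymbol m}$ and step size $\Delta>0$, the discretized diffusion is $\hat{\boldsymbol y}_0=\boldsymbol 0$, $\hat{\boldsymbol y}_{t+\Delta}=\hat{\boldsymbol y}_t+\hat{\boldsymbol m}(\hat{\boldsymbol y}_t,t)\Delta+\sqrt{\Delta}\,\hat{\boldsymbol z}_t$ for $t\in\mathbb{N}\cdot\Delta$, with $(\hat{\boldsymbol z}_t)$ i.i.d. $\mathsf N(\boldsymbol0,\boldsymbol I_d)$. $W_1$ is the Wasserstein-1 distance w.r.t. the Euclidean norm; $W_1(\boldsymbol X_1,\boldsymbol X_2)$ for random vectors means the distance between their laws. *)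

theory Defs
  imports "HOL-Probability.Probability"
begin

section \<open>Euclidean space of varying dimension\<close>

text \<open>The statement concerns sequences indexed by the dimension, so the dimension cannot be a
  type. A vector is an extensional function on the index set \<open>{..<d}\<close>; the product sigma-algebra
  is the Borel sigma-algebra of d-dimensional Euclidean space.\<close>

definition euc :: "nat \<Rightarrow> (nat \<Rightarrow> real) measure" where
  "euc d = (\<Pi>\<^sub>M i\<in>{..<d}. (borel :: real measure))"

definition vzero :: "nat \<Rightarrow> nat \<Rightarrow> real" where
  "vzero d = (\<lambda>i\<in>{..<d}. 0)"

definition vadd :: "nat \<Rightarrow> (nat \<Rightarrow> real) \<Rightarrow> (nat \<Rightarrow> real) \<Rightarrow> nat \<Rightarrow> real" where
  "vadd d x y = (\<lambda>i\<in>{..<d}. x i + y i)"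

definition vdiff :: "nat \<Rightarrow> (nat \<Rightarrow> real) \<Rightarrow> (nat \<Rightarrow> real) \<Rightarrow> nat \<Rightarrow> real" where
  "vdiff d x y = (\<lambda>i\<in>{..<d}. x i - y i)"

definition vscale :: "nat \<Rightarrow> real \<Rightarrow> (nat \<Rightarrow> real) \<Rightarrow> nat \<Rightarrow> real" where
  "vscale d r x = (\<lambda>i\<in>{..<d}. r * x i)"

definition vnorm :: "nat \<Rightarrow> (nat \<Rightarrow> real) \<Rightarrow> real" where
  "vnorm d x = L2_set x {..<d}"


section \<open>Gaussian vectors, Brownian motion, diffusions\<close>

text \<open>The law N(0, v I) for v > 0; \<^const>\<open>normal_density\<close> takes the standard deviation.\<close>

definition gauss :: "nat \<Rightarrow> real \<Rightarrow> (nat \<Rightarrow> real) measure" where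
  "gauss d v = (\<Pi>\<^sub>M i\<in>{..<d}. density lborel (\<lambda>u. ennreal (normal_density 0 (sqrt v) u)))"

definition brownian_motion ::
  "nat \<Rightarrow> 'w measure \<Rightarrow> (real \<Rightarrow> 'w \<Rightarrow> nat \<Rightarrow> real) \<Rightarrow> bool" where
  "brownian_motion d M W \<longleftrightarrow>
     prob_space M \<and>
     (\<forall>t\<ge>0. W t \<in> measurable M (euc d)) \<and>
     (AE \<omega> in M. W 0 \<omega> = vzero d \<and> (\<forall>i<d. continuous_on {0..} (\<lambda>t. W t \<omega> i))) \<and>
     (\<forall>(\<tau>::nat \<Rightarrow> real) n. 0 \<le> \<tau> 0 \<and> mono \<tau> \<longrightarrow>
        prob_space.indep_vars M (\<lambda>_. euc d)
          (\<lambda>k \<omega>. vdiff d (W (\<tau> (Suc k)) \<omega>) (W (\<tau> k) \<omega>)) {..<n}) \<and>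
     (\<forall>s t. 0 \<le> s \<and> s < t \<longrightarrow>
        distr M (euc d) (\<lambda>\<omega>. vdiff d (W t \<omega>) (W s \<omega>)) = gauss d (t - s))"

text \<open>The pair (x, W) has law \<open>\<mu> \<otimes> BM\<close>. The sigma-algebra on paths is the one
  generated by the evaluations at the times t \<open>\<ge>\<close> 0.\<close>

definition signal_and_bm ::
  "nat \<Rightarrow> (nat \<Rightarrow> real) measure \<Rightarrow> 'w measure \<Rightarrow> ('w \<Rightarrow> nat \<Rightarrow> real) \<Rightarrow>
     (real \<Rightarrow> 'w \<Rightarrow> nat \<Rightarrow> real) \<Rightarrow> bool" where
  "signal_and_bm d \<mu> M X W \<longleftrightarrow>
     brownian_motion d M W \<and>
     X \<in> measurable M (euc d) \<and>
     distr M (euc d) X = \<mu> \<and>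
     distr M (euc d \<Otimes>\<^sub>M (\<Pi>\<^sub>M t\<in>{0..}. euc d)) (\<lambda>\<omega>. (X \<omega>, \<lambda>t\<in>{0..}. W t \<omega>)) =
       \<mu> \<Otimes>\<^sub>M distr M (\<Pi>\<^sub>M t\<in>{0..}. euc d) (\<lambda>\<omega>. \<lambda>t\<in>{0..}. W t \<omega>)"

definition observation ::
  "nat \<Rightarrow> ('w \<Rightarrow> nat \<Rightarrow> real) \<Rightarrow> (real \<Rightarrow> 'w \<Rightarrow> nat \<Rightarrow> real) \<Rightarrow> real \<Rightarrow> 'w \<Rightarrow> nat \<Rightarrow> real" where
  "observation d X W t \<omega> = vadd d (vscale d t (X \<omega>)) (W t \<omega>)"

text \<open>Functions of (y, t) with t \<open>\<ge>\<close> 0; values at negative t are never constrained.\<close>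

type_synonym drift = "(nat \<Rightarrow> real) \<Rightarrow> real \<Rightarrow> nat \<Rightarrow> real"

definition is_drift :: "nat \<Rightarrow> drift \<Rightarrow> bool" where
  "is_drift d m \<longleftrightarrow>
     (\<lambda>(y, t). m y t) \<in> measurable (euc d \<Otimes>\<^sub>M restrict_space borel {0..}) (euc d)"

definition is_test :: "nat \<Rightarrow> ((nat \<Rightarrow> real) \<Rightarrow> real \<Rightarrow> real) \<Rightarrow> bool" where
  "is_test d \<phi> \<longleftrightarrow>
     (\<lambda>(y, t). \<phi> y t) \<in> borel_measurable (euc d \<Otimes>\<^sub>M restrict_space borel {0..}) \<and>
     (\<forall>y\<in>space (euc d). \<forall>t\<ge>0. \<phi> y t \<in> {0, 1})"

text \<open>The discretized diffusion after k steps (at time \<open>k * \<Delta>\<close>), driven by the noise sequence z.\<close>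

primrec discretized ::
  "nat \<Rightarrow> drift \<Rightarrow> real \<Rightarrow> (nat \<Rightarrow> nat \<Rightarrow> real) \<Rightarrow> nat \<Rightarrow> nat \<Rightarrow> real" where
  "discretized d m \<Delta> z 0 = vzero d"
| "discretized d m \<Delta> z (Suc k) =
     vadd d (vadd d (discretized d m \<Delta> z k)
                    (vscale d \<Delta> (m (discretized d m \<Delta> z k) (real k * \<Delta>))))
            (vscale d (sqrt \<Delta>) (z k))"

text \<open>The law of \<open>m(y, t)\<close> for y the discretized diffusion at time \<open>t = k * \<Delta>\<close>, realized on the
  canonical space of an i.i.d. standard Gaussian sequence.\<close>

definition discretized_drift_law :: "nat \<Rightarrow> drift \<Rightarrow> real \<Rightarrow> nat \<Rightarrow> (nat \<Rightarrow> real) measure" where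
  "discretized_drift_law d m \<Delta> k =
     distr (\<Pi>\<^sub>M j\<in>(UNIV::nat set). gauss d 1) (euc d)
       (\<lambda>z. m (discretized d m \<Delta> z k) (real k * \<Delta>))"

definition wasserstein1 ::
  "nat \<Rightarrow> (nat \<Rightarrow> real) measure \<Rightarrow> (nat \<Rightarrow> real) measure \<Rightarrow> ennreal" where
  "wasserstein1 d P Q =
     (INF \<pi>\<in>{\<pi>. sets \<pi> = sets (euc d \<Otimes>\<^sub>M euc d) \<and>
                  distr \<pi> (euc d) fst = P \<and> distr \<pi> (euc d) snd = Q}.
        \<integral>\<^sup>+p. ennreal (vnorm d (vdiff d (fst p) (snd p))) \<partial>\<pi>)"

text \<open>\<open>f(d) = O(g(d))\<close> as \<open>d \<rightarrow> \<infinity>\<close>, for f with values in the extended nonnegative reals, so that an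
  infinite integral is not O of anything.\<close>

definition bigO_ennreal :: "(nat \<Rightarrow> ennreal) \<Rightarrow> (nat \<Rightarrow> real) \<Rightarrow> bool" where
  "bigO_ennreal f g \<longleftrightarrow> (\<exists>C\<ge>0. \<forall>\<^sub>F d in sequentially. f d \<le> ennreal (C * \<bar>g d\<bar>))"


section \<open>Polynomial-time computability\<close>

text \<open>The model is the real RAM with unit-cost exact arithmetic and comparison, polynomially
  equivalent to Blum-Shub-Smale machines over the reals. A state has integer registers, used only
  for addressing and loop control, and real arrays. Integer registers can only be reset,
  incremented and copied, so that unit cost gives no extra power; in particular there is no way
  to round a real to an integer in one step. Constants in a program are arbitrary reals and
  do not depend on d.\<close>

datatype arith_op = Plus | Minus | Times | Divide

fun arith :: "arith_op \<Rightarrow> real \<Rightarrow> real \<Rightarrow> real" where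
  "arith Plus a b = a + b"
| "arith Minus a b = a - b"
| "arith Times a b = a * b"
| "arith Divide a b = a / b"

type_synonym loc = "nat \<times> nat"  \<comment> \<open>(array, integer register holding the index)\<close>

datatype prog =
    Skip
  | IZero nat
  | ISuc nat
  | ICopy nat nat
  | RConst loc real
  | ROp loc arith_op loc loc
  | Seq prog prog
  | IfLe loc loc prog prog
  | WhileLess nat nat prog

type_synonym state = "(nat \<Rightarrow> nat) \<times> (nat \<Rightarrow> nat \<Rightarrow> real)"

definition rd :: "state \<Rightarrow> loc \<Rightarrow> real" where
  "rd s l = snd s (fst l) (fst s (snd l))"

definition wr_reg :: "state \<Rightarrow> nat \<Rightarrow> nat \<Rightarrow> state" where
  "wr_reg s r n = ((fst s)(r := n), snd s)"

definition wr :: "state \<Rightarrow> loc \<Rightarrow> real \<Rightarrow> state" where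
  "wr s l v = (fst s, (snd s)(fst l := (snd s (fst l))(fst s (snd l) := v)))"

text \<open>\<open>exec p s n s'\<close>: started in s, the program p halts in s' after n steps.\<close>

inductive exec :: "prog \<Rightarrow> state \<Rightarrow> nat \<Rightarrow> state \<Rightarrow> bool" where
  "exec Skip s 1 s"
| "exec (IZero r) s 1 (wr_reg s r 0)"
| "exec (ISuc r) s 1 (wr_reg s r (Suc (fst s r)))"
| "exec (ICopy r q) s 1 (wr_reg s r (fst s q))"
| "exec (RConst l c) s 1 (wr s l c)"
| "exec (ROp l f a b) s 1 (wr s l (arith f (rd s a) (rd s b)))"
| "exec p s n s' \<Longrightarrow> exec q s' k s'' \<Longrightarrow> exec (Seq p q) s (n + k) s''"
| "rd s a \<le> rd s b \<Longrightarrow> exec p s n s' \<Longrightarrow> exec (IfLe a b p q) s (Suc n) s'"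
| "\<not> rd s a \<le> rd s b \<Longrightarrow> exec q s n s' \<Longrightarrow> exec (IfLe a b p q) s (Suc n) s'"
| "\<not> fst s r < fst s q \<Longrightarrow> exec (WhileLess r q p) s 1 s"
| "fst s r < fst s q \<Longrightarrow> exec p s n s' \<Longrightarrow> exec (WhileLess r q p) s' k s'' \<Longrightarrow>
     exec (WhileLess r q p) s (Suc (n + k)) s''"

text \<open>Input convention: integer register 0 holds d; arrays 0, 1, 2 hold y, t and the list of
  scalar parameters; everything else is 0. The output is read off array 0.\<close>

definition init_state :: "nat \<Rightarrow> real list \<Rightarrow> (nat \<Rightarrow> real) \<Rightarrow> real \<Rightarrow> state" where
  "init_state d ps y t =
     (\<lambda>r. if r = 0 then d else 0,
      \<lambda>a i. if a = 0 \<and> i < d then y i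
            else if a = 1 \<and> i = 0 then t
            else if a = 2 \<and> i < length ps then ps ! i
            else 0)"

text \<open>A sequence of maps \<open>f d\<close> from (y, t) to vectors of length \<open>out d\<close> is computed by one program
  for all d, in time polynomial in d uniformly over the inputs. The sequence \<open>\<theta>\<close> is the
  list of scalar parameters of the problem that the algorithm is given besides d, y and t.\<close>

definition polytime_computable ::
  "(nat \<Rightarrow> real list) \<Rightarrow> (nat \<Rightarrow> nat) \<Rightarrow> (nat \<Rightarrow> (nat \<Rightarrow> real) \<Rightarrow> real \<Rightarrow> nat \<Rightarrow> real) \<Rightarrow> bool" where
  "polytime_computable \<theta> out f \<longleftrightarrow>
     (\<exists>p K. \<forall>d. \<forall>y\<in>space (euc d). \<forall>t\<ge>0. \<exists>n s.
        exec p (init_state d (\<theta> d) y t) n s \<and> n \<le> K * d ^ K + K \<and>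
        (\<forall>i<out d. snd s 0 i = f d y t i))"

definition polytime_drift :: "(nat \<Rightarrow> real list) \<Rightarrow> (nat \<Rightarrow> drift) \<Rightarrow> bool" where
  "polytime_drift \<theta> m \<longleftrightarrow> polytime_computable \<theta> (\<lambda>d. d) m"

definition polytime_test :: "(nat \<Rightarrow> real list) \<Rightarrow> (nat \<Rightarrow> (nat \<Rightarrow> real) \<Rightarrow> real \<Rightarrow> real) \<Rightarrow> bool" where
  "polytime_test \<theta> \<phi> \<longleftrightarrow> polytime_computable \<theta> (\<lambda>d. 1) (\<lambda>d y t i. \<phi> d y t)"

end

theory Submission
  imports Defs
begin

text \<open>
  The modified drift keeps \<open>m0\<close> on the window \<open>[(1 - \<gamma>) t\<^sub>a\<^sub>l\<^sub>g, (1 + \<delta>) t\<^sub>a\<^sub>l\<^sub>g)\<close>, truncates it to norm less than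
  \<open>\<epsilon>\<close> before, and multiplies it by the test \<open>\<phi>\<close> afterwards. For a small step size the discretized diffusion
  is then \<open>a + W\<^sub>t\<close> with \<open>\<parallel>a\<parallel> \<le> c t\<^sub>a\<^sub>l\<^sub>g\<close> when it reaches \<open>(1 + \<delta>) t\<^sub>a\<^sub>l\<^sub>g\<close>, so with high probability the test is
  silent, the drift vanishes, and the distance to \<open>x\<close> is at least \<open>E \<parallel>x\<parallel>\<close>.

  If the step size is comparable with \<open>t\<^sub>a\<^sub>l\<^sub>g\<close> this breaks down: a single step inside the window can move the process
  by more than \<open>c t\<^sub>a\<^sub>l\<^sub>g\<close>. The time 0 is however a null set for the error integral, so the drift may be a kick
  \<open>N e\<^sub>0\<close> there. A kick of length \<open>N \<Delta>\<close> is harmless when \<open>\<Delta> < \<kappa> t\<^sub>a\<^sub>l\<^sub>g\<close>, and otherwise brings the process into the region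
  \<open>y\<^sub>0 \<ge> L t, t \<ge> \<kappa> t\<^sub>a\<^sub>l\<^sub>g\<close>. There the drift is again \<open>N e\<^sub>0\<close>, so the process never leaves this region and its drift stays far
  from the unit ball. The expected time that the true diffusion spends in the region is \<open>O(exp (- 2 t\<^sub>a\<^sub>l\<^sub>g))\<close>. This is
  \<open>O(\<eta>2)\<close>: since the test is silent on pure noise, Cameron-Martin shows that it fails on the signal with probability
  at least \<open>exp (- t) / 4\<close> at every time \<open>t\<close> beyond the threshold.
\<close>

section \<open>Programs\<close>

text \<open>The drift sees only \<open>y\<close> and \<open>t\<close>, never the step size, yet it
  must serve every step size. The memory of a long step is therefore carried by the process itself,
  in its first coordinate. A drift value certifies distance from \<open>x\<close> if it is zero or
  has norm at least 2, because \<open>x\<close> lies in the unit ball; both outcomes of the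
  construction are of this kind. The constants are N = 64/c, L = 48/c = 3N/4 and \<kappa> = c^2/256.
  A kick that has to be harmless displaces by at most N \<kappa> t_alg = c t_alg / 4. The slope 3N/4
  separates the two regimes: a process steered by N e_0 at all times has slope N, while one kicked
  only once has slope at most N/2 from its second step on, plus at most 2 from the ordinary drift,
  and the noise contributes less than N/4 - 2 in either direction. That noise bound is a maximal
  inequality over all grid times at once, uniform in the step size. Finally (L - 1)^2 \<kappa> / 2
  \<ge> 2 makes the escape cost O(exp(- 2 t_alg)), and 2 t_alg eventually bounds (1 + \<delta>)
  t_alg, where the failure probability of the test starts to count.\<close>

declare split_paired_Ex [simp del] split_paired_All [simp del]

section \<open>Relocation of programs in memory\<close>

fun map_prog :: "(nat \<Rightarrow> nat) \<Rightarrow> (nat \<Rightarrow> nat) \<Rightarrow> prog \<Rightarrow> prog" where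
  "map_prog f g Skip = Skip"
| "map_prog f g (IZero r) = IZero (g r)"
| "map_prog f g (ISuc r) = ISuc (g r)"
| "map_prog f g (ICopy r q) = ICopy (g r) (g q)"
| "map_prog f g (RConst l v) = RConst (map_prod f g l) v"
| "map_prog f g (ROp l h a b) = ROp (map_prod f g l) h (map_prod f g a) (map_prod f g b)"
| "map_prog f g (Seq p q) = Seq (map_prog f g p) (map_prog f g q)"
| "map_prog f g (IfLe a b p q) = IfLe (map_prod f g a) (map_prod f g b) (map_prog f g p) (map_prog f g q)"
| "map_prog f g (WhileLess r q p) = WhileLess (g r) (g q) (map_prog f g p)"

text \<open>A simulation relation, where \<open>f\<close> renames arrays and \<open>g\<close>
  integer registers. It leaves the rest of \<open>u\<close> free; that is the business of the frame
  condition \<open>agree_outside\<close>, so that several relocated programs can share one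
  state.\<close>

definition embeds :: "(nat \<Rightarrow> nat) \<Rightarrow> (nat \<Rightarrow> nat) \<Rightarrow> state \<Rightarrow> state \<Rightarrow> bool" where
  "embeds f g s u \<longleftrightarrow> (\<forall>r. fst u (g r) = fst s r) \<and> (\<forall>a. snd u (f a) = snd s a)"

definition agree_outside :: "nat set \<Rightarrow> nat set \<Rightarrow> state \<Rightarrow> state \<Rightarrow> bool" where
  "agree_outside F G u v \<longleftrightarrow> (\<forall>r. r \<notin> G \<longrightarrow> fst v r = fst u r) \<and> (\<forall>a. a \<notin> F \<longrightarrow> snd v a = snd u a)"

lemma rd_embeds: "embeds f g s u \<Longrightarrow> rd u (map_prod f g l) = rd s l"
  by (cases l) (simp add: embeds_def rd_def)

lemma embeds_reg: "embeds f g s u \<Longrightarrow> fst u (g r) = fst s r"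
  by (simp add: embeds_def)

lemma embeds_wr_reg:
  assumes "inj g" "embeds f g s u"
  shows "embeds f g (wr_reg s r n) (wr_reg u (g r) n)"
  using assms by (auto simp: embeds_def wr_reg_def dest: injD)

lemma embeds_wr:
  assumes "inj f" "embeds f g s u"
  shows "embeds f g (wr s l v) (wr u (map_prod f g l) v)"
  using assms by (cases l) (auto simp: embeds_def wr_def dest: injD)

lemma agree_outside_refl: "agree_outside F G u u"
  by (simp add: agree_outside_def)

lemma agree_outside_trans: "agree_outside F G u v \<Longrightarrow> agree_outside F G v w \<Longrightarrow> agree_outside F G u w"
  by (simp add: agree_outside_def)

lemma agree_outside_wr_reg: "r \<in> G \<Longrightarrow> agree_outside F G u (wr_reg u r n)"
  by (auto simp: agree_outside_def wr_reg_def)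

lemma agree_outside_wr: "fst l \<in> F \<Longrightarrow> agree_outside F G u (wr u l v)"
  by (auto simp: agree_outside_def wr_def)

text \<open>Each instruction only touches named cells, so renaming commutes with it; injectivity
  keeps a write from hitting the image of another cell. The step count is preserved exactly, hence
  so are polynomial bounds, and the frame condition later protects the two subroutines from each
  other.\<close>

lemma exec_map_prog:
  assumes "exec p s n s'" "inj f" "inj g" "embeds f g s u"
  shows "\<exists>u'. exec (map_prog f g p) u n u' \<and> embeds f g s' u' \<and> agree_outside (range f) (range g) u u'"
  using assms
proof (induction arbitrary: u rule: exec.induct)
  case (1 s)
  have "exec (map_prog f g Skip) u 1 u" unfolding map_prog.simps by (rule exec.intros)
  with 1 agree_outside_refl show ?case by blast
next
  case (2 r s)
  have "exec (map_prog f g (IZero r)) u 1 (wr_reg u (g r) 0)"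
    unfolding map_prog.simps by (rule exec.intros)
  moreover have "embeds f g (wr_reg s r 0) (wr_reg u (g r) 0)"
    using 2 by (intro embeds_wr_reg)
  ultimately show ?case using agree_outside_wr_reg by blast
next
  case (3 r s)
  have "exec (map_prog f g (ISuc r)) u 1 (wr_reg u (g r) (Suc (fst u (g r))))"
    unfolding map_prog.simps by (rule exec.intros)
  moreover have "embeds f g (wr_reg s r (Suc (fst s r))) (wr_reg u (g r) (Suc (fst u (g r))))"
    using embeds_wr_reg[OF 3(2,3)] embeds_reg[OF 3(3)] by simp
  ultimately show ?case using agree_outside_wr_reg by blast
next
  case (4 r q s)
  have "exec (map_prog f g (ICopy r q)) u 1 (wr_reg u (g r) (fst u (g q)))"
    unfolding map_prog.simps by (rule exec.intros)
  moreover have "embeds f g (wr_reg s r (fst s q)) (wr_reg u (g r) (fst u (g q)))"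
    using embeds_wr_reg[OF 4(2,3)] embeds_reg[OF 4(3)] by simp
  ultimately show ?case using agree_outside_wr_reg by blast
next
  case (5 l v s)
  have "exec (map_prog f g (RConst l v)) u 1 (wr u (map_prod f g l) v)"
    unfolding map_prog.simps by (rule exec.intros)
  moreover have "embeds f g (wr s l v) (wr u (map_prod f g l) v)"
    using 5 by (intro embeds_wr)
  moreover have "agree_outside (range f) (range g) u (wr u (map_prod f g l) v)"
    by (intro agree_outside_wr) simp
  ultimately show ?case by blast
next
  case (6 l h a b s)
  let ?v = "arith h (rd s a) (rd s b)"
  have "exec (map_prog f g (ROp l h a b)) u 1
      (wr u (map_prod f g l) (arith h (rd u (map_prod f g a)) (rd u (map_prod f g b))))"
    unfolding map_prog.simps by (rule exec.intros)
  then have "exec (map_prog f g (ROp l h a b)) u 1 (wr u (map_prod f g l) ?v)"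
    using 6 by (simp only: rd_embeds)
  moreover have "embeds f g (wr s l ?v) (wr u (map_prod f g l) ?v)"
    using 6 by (intro embeds_wr)
  moreover have "agree_outside (range f) (range g) u (wr u (map_prod f g l) ?v)"
    by (intro agree_outside_wr) simp
  ultimately show ?case by blast
next
  case (7 p s n s' q k s'')
  then obtain u' where u': "exec (map_prog f g p) u n u'" "embeds f g s' u'"
      "agree_outside (range f) (range g) u u'" by blast
  with 7 obtain u'' where u'': "exec (map_prog f g q) u' k u''" "embeds f g s'' u''"
      "agree_outside (range f) (range g) u' u''" by blast
  have "exec (map_prog f g (Seq p q)) u (n + k) u''"
    unfolding map_prog.simps using u'(1) u''(1) by (rule exec.intros)
  with u'(3) u''(2,3) show ?case by (blast intro: agree_outside_trans)
next
  case (8 s a b p n s' q)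
  then obtain u' where u': "exec (map_prog f g p) u n u'" "embeds f g s' u'"
      "agree_outside (range f) (range g) u u'" by blast
  have "exec (map_prog f g (IfLe a b p q)) u (Suc n) u'"
    unfolding map_prog.simps using 8(1) u'(1) by (intro exec.intros(8)) (simp_all add: rd_embeds[OF 8(6)])
  with u' show ?case by blast
next
  case (9 s a b q n s' p)
  then obtain u' where u': "exec (map_prog f g q) u n u'" "embeds f g s' u'"
      "agree_outside (range f) (range g) u u'" by blast
  have "exec (map_prog f g (IfLe a b p q)) u (Suc n) u'"
    unfolding map_prog.simps using 9(1) u'(1) by (intro exec.intros(9)) (simp_all add: rd_embeds[OF 9(6)])
  with u' show ?case by blast
next
  case (10 s r q p)
  have "exec (map_prog f g (WhileLess r q p)) u 1 u"
    unfolding map_prog.simps using 10 by (intro exec.intros(10)) (simp add: embeds_def)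
  with 10 agree_outside_refl show ?case by blast
next
  case (11 s r q p n s' k s'')
  then obtain u' where u': "exec (map_prog f g p) u n u'" "embeds f g s' u'"
      "agree_outside (range f) (range g) u u'" by blast
  with 11 obtain u'' where u'': "exec (map_prog f g (WhileLess r q p)) u' k u''" "embeds f g s'' u''"
      "agree_outside (range f) (range g) u' u''" by blast
  have "fst u (g r) < fst u (g q)" using 11 by (simp add: embeds_def)
  then have "exec (map_prog f g (WhileLess r q p)) u (Suc (n + k)) u''"
    using u'(1) u''(1) unfolding map_prog.simps by (rule exec.intros)
  with u'(3) u''(2,3) show ?case by (blast intro: agree_outside_trans)
qed

section \<open>Total correctness with a time bound\<close>

definition runs :: "prog \<Rightarrow> state \<Rightarrow> nat \<Rightarrow> (state \<Rightarrow> bool) \<Rightarrow> bool" where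
  "runs p s B Q \<longleftrightarrow> (\<exists>n s'. exec p s n s' \<and> n \<le> B \<and> Q s')"

lemma runsI: "exec p s n s' \<Longrightarrow> n \<le> B \<Longrightarrow> Q s' \<Longrightarrow> runs p s B Q"
  unfolding runs_def by blast

lemma runsE:
  assumes "runs p s B Q"
  obtains n s' where "exec p s n s'" "n \<le> B" "Q s'"
  using assms unfolding runs_def by blast

lemma runs_mono:
  assumes "runs p s B Q" "B \<le> B'" "\<And>s'. Q s' \<Longrightarrow> Q' s'"
  shows "runs p s B' Q'"
  using assms(1) by (rule runsE) (blast intro: runsI le_trans assms)

lemma runs_Seq:
  assumes "runs p s B Q" "\<And>s'. Q s' \<Longrightarrow> runs q s' B' R"
  shows "runs (Seq p q) s (B + B') R"
proof -
  obtain n s' where p: "exec p s n s'" "n \<le> B" "Q s'" using assms(1) by (rule runsE)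
  obtain k s'' where q: "exec q s' k s''" "k \<le> B'" "R s''" using assms(2)[OF p(3)] by (rule runsE)
  show ?thesis
    using exec.intros(7)[OF p(1) q(1)] by (rule runsI) (use p q in auto)
qed

lemma runs_IfLe:
  assumes "rd s a \<le> rd s b \<Longrightarrow> runs p s B Q" "\<not> rd s a \<le> rd s b \<Longrightarrow> runs q s B Q"
  shows "runs (IfLe a b p q) s (Suc B) Q"
proof (cases "rd s a \<le> rd s b")
  case True
  obtain n s' where "exec p s n s'" "n \<le> B" "Q s'" using assms(1)[OF True] by (rule runsE)
  with True show ?thesis by (intro runsI[OF exec.intros(8)]) auto
next
  case False
  obtain n s' where "exec q s n s'" "n \<le> B" "Q s'" using assms(2)[OF False] by (rule runsE)
  with False show ?thesis by (intro runsI[OF exec.intros(9)]) auto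
qed

fun loop_free :: "prog \<Rightarrow> bool" where
  "loop_free (Seq p q) \<longleftrightarrow> loop_free p \<and> loop_free q"
| "loop_free (IfLe a b p q) \<longleftrightarrow> loop_free p \<and> loop_free q"
| "loop_free (WhileLess r q p) \<longleftrightarrow> False"
| "loop_free p \<longleftrightarrow> True"

fun cost :: "prog \<Rightarrow> nat" where
  "cost (Seq p q) = cost p + cost q"
| "cost (IfLe a b p q) = Suc (max (cost p) (cost q))"
| "cost p = 1"

text \<open>Without loops, execution is a total function of the state. In this form the effect of a
  concrete block is computed by the simplifier.\<close>

fun sem :: "prog \<Rightarrow> state \<Rightarrow> state" where
  "sem Skip s = s"
| "sem (IZero r) s = wr_reg s r 0"
| "sem (ISuc r) s = wr_reg s r (Suc (fst s r))"
| "sem (ICopy r q) s = wr_reg s r (fst s q)"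
| "sem (RConst l v) s = wr s l v"
| "sem (ROp l h a b) s = wr s l (arith h (rd s a) (rd s b))"
| "sem (Seq p q) s = sem q (sem p s)"
| "sem (IfLe a b p q) s = (if rd s a \<le> rd s b then sem p s else sem q s)"
| "sem (WhileLess r q p) s = s"

lemma runs_loop_free:
  assumes "loop_free p" "Q (sem p s)"
  shows "runs p s (cost p) Q"
  using assms
proof (induction p arbitrary: s Q)
  case (Seq p q)
  have "runs p s (cost p) (\<lambda>s'. s' = sem p s)" using Seq.IH(1) Seq.prems by simp
  moreover have "runs q s' (cost q) Q" if "s' = sem p s" for s'
    using Seq.IH(2) Seq.prems that by simp
  ultimately show ?case by (simp add: runs_Seq)
next
  case (IfLe a b p q)
  have "runs p s (max (cost p) (cost q)) Q" if "rd s a \<le> rd s b"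
    using IfLe.prems that by (intro runs_mono[OF IfLe.IH(1)]) auto
  moreover have "runs q s (max (cost p) (cost q)) Q" if "\<not> rd s a \<le> rd s b"
    using IfLe.prems that by (intro runs_mono[OF IfLe.IH(2)]) auto
  ultimately show ?case by (simp add: runs_IfLe)
next
  case Skip
  then show ?case by (intro runsI[OF exec.intros(1)]) auto
next
  case (IZero r)
  then show ?case by (intro runsI[OF exec.intros(2)]) auto
next
  case (ISuc r)
  then show ?case by (intro runsI[OF exec.intros(3)]) auto
next
  case (ICopy r q)
  then show ?case by (intro runsI[OF exec.intros(4)]) auto
next
  case (RConst l v)
  then show ?case by (intro runsI[OF exec.intros(5)]) auto
next
  case (ROp l h a b)
  then show ?case by (intro runsI[OF exec.intros(6)]) auto
qed simp

lemma runs_loop_freeI: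
  assumes "loop_free p" "cost p \<le> B" "Q (sem p s)"
  shows "runs p s B Q"
  using runs_mono[OF runs_loop_free[where Q = Q, OF assms(1,3)] assms(2)] by blast

text \<open>The invariant is indexed by the loop counter, and the body must preserve the limit
  register. Each pass costs one test plus at most \<open>B\<close> steps, and the failing last test
  costs one more.\<close>

lemma runs_for:
  assumes "fst s r \<le> fst s q" "I (fst s r) s"
    and step: "\<And>s' i. I i s' \<Longrightarrow> fst s' r = i \<Longrightarrow> fst s' q = fst s q \<Longrightarrow> i < fst s q \<Longrightarrow>
      runs p s' B (\<lambda>s''. I (Suc i) s'' \<and> fst s'' r = Suc i \<and> fst s'' q = fst s q)"
  shows "runs (WhileLess r q p) s (Suc ((fst s q - fst s r) * Suc B))
    (\<lambda>s'. I (fst s q) s' \<and> fst s' r = fst s q \<and> fst s' q = fst s q)"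
proof -
  let ?e = "fst s q"
  have main: "runs (WhileLess r q p) s' (Suc (m * Suc B)) (\<lambda>s'. I ?e s' \<and> fst s' r = ?e \<and> fst s' q = ?e)"
    if "I i s'" "fst s' r = i" "fst s' q = ?e" "i \<le> ?e" "m = ?e - i" for m i s'
    using that
  proof (induction m arbitrary: i s')
    case 0
    then have "exec (WhileLess r q p) s' 1 s'" by (intro exec.intros) auto
    with 0 show ?case by (auto simp: runs_def)
  next
    case (Suc m)
    then have lt: "i < ?e" by simp
    obtain n u where u: "exec p s' n u" "n \<le> B" "I (Suc i) u" "fst u r = Suc i" "fst u q = ?e"
      using step[OF Suc.prems(1-3) lt] unfolding runs_def by blast
    have "runs (WhileLess r q p) u (Suc (m * Suc B)) (\<lambda>s'. I ?e s' \<and> fst s' r = ?e \<and> fst s' q = ?e)"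
      using Suc.prems lt by (intro Suc.IH[OF u(3-5)]) auto
    then obtain k v where v: "exec (WhileLess r q p) u k v" "k \<le> Suc (m * Suc B)"
      "I ?e v" "fst v r = ?e" "fst v q = ?e"
      unfolding runs_def by blast
    have "exec (WhileLess r q p) s' (Suc (n + k)) v"
      using Suc.prems(2,3) lt by (intro exec.intros(11)[OF _ u(1) v(1)]) simp
    moreover have "Suc (n + k) \<le> Suc (Suc m * Suc B)" using u(2) v(2) by simp
    ultimately show ?case using v(3-5) unfolding runs_def by blast
  qed
  show ?thesis by (rule main[OF assms(2) refl refl assms(1) refl])
qed

lemma runs_map_prog:
  assumes "exec p s n s'" "inj f" "inj g" "embeds f g s u" "n \<le> B"
    and "\<And>u'. embeds f g s' u' \<Longrightarrow> agree_outside (range f) (range g) u u' \<Longrightarrow> Q u'"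
  shows "runs (map_prog f g p) u B Q"
proof -
  obtain u' where "exec (map_prog f g p) u n u'" "embeds f g s' u'"
    "agree_outside (range f) (range g) u u'"
    using exec_map_prog[OF assms(1-4)] by blast
  with assms(5,6) show ?thesis by (intro runsI)
qed

section \<open>The modified drift and a program for it\<close>

definition escapes :: "real \<Rightarrow> real \<Rightarrow> real \<Rightarrow> (nat \<Rightarrow> real) \<Rightarrow> real \<Rightarrow> bool" where
  "escapes \<kappa> L ta y t \<longleftrightarrow> t \<le> 0 \<or> (\<kappa> * ta \<le> t \<and> L * t \<le> y 0)"

text \<open>The form follows the instruction set: the only comparison of reals is \<le> and there is
  no square root, so norms are compared through their squares and strict inequalities appear as
  negations.\<close>

definition keeps ::
  "nat \<Rightarrow> real \<Rightarrow> real \<Rightarrow> real \<Rightarrow> real \<Rightarrow> (nat \<Rightarrow> real) \<Rightarrow> real \<Rightarrow> real \<Rightarrow> bool" where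
  "keeps d \<gamma> \<epsilon> ta \<delta> v b t \<longleftrightarrow>
     (if (1 - \<gamma>) * ta \<le> t then ta * (1 + \<delta>) \<le> t \<longrightarrow> 1 \<le> b else \<not> \<epsilon>\<^sup>2 \<le> (\<Sum>i<d. (v i)\<^sup>2))"

text \<open>For \<open>d = 0\<close> the value \<open>y 0\<close> in the escape condition is meaningless, but then there are no coordinates to output.\<close>

definition modified_drift ::
  "real \<Rightarrow> real \<Rightarrow> real \<Rightarrow> real \<Rightarrow> real \<Rightarrow> real \<Rightarrow> real \<Rightarrow> drift \<Rightarrow>
     ((nat \<Rightarrow> real) \<Rightarrow> real \<Rightarrow> real) \<Rightarrow> nat \<Rightarrow> drift" where
  "modified_drift N L \<kappa> \<gamma> \<epsilon> ta \<delta> m0 \<phi> d y t =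
     (\<lambda>i\<in>{..<d}. if escapes \<kappa> L ta y t then (if i = 0 then N else 0)
        else if keeps d \<gamma> \<epsilon> ta \<delta> (m0 y t) (\<phi> y t) t then m0 y t i else 0)"

text \<open>Arrays 0 to 2 hold the input, 3 a zero, 4 the squared norm of \<open>m0\<close>, 6 the factor of \<open>m0\<close> and 7 the multiple of
  \<open>e\<^sub>0\<close> in the output; 5 and 8 are scratch. The subroutines for \<open>m0\<close> and \<open>\<phi>\<close> are moved to the even and odd arrays from 20
  on, and to the even and odd registers from 4 on. Register 1 is the loop counter; registers 2 and 3 hold the constant
  indices 0 and 1.\<close>

definition copy_body :: prog where
  "copy_body = Seq (ROp (20, 1) Plus (0, 1) (3, 2)) (Seq (ROp (21, 1) Plus (0, 1) (3, 2)) (ISuc 1))"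

definition copy_scalars :: prog where
  "copy_scalars = Seq (ROp (22, 2) Plus (1, 2) (3, 2)) (Seq (ROp (23, 2) Plus (1, 2) (3, 2))
    (Seq (ROp (24, 2) Plus (2, 2) (3, 2)) (Seq (ROp (24, 3) Plus (2, 3) (3, 2))
    (Seq (ROp (25, 2) Plus (2, 2) (3, 2)) (Seq (ROp (25, 3) Plus (2, 3) (3, 2))
    (Seq (ICopy 4 0) (ICopy 5 0)))))))"

definition norm_body :: prog where
  "norm_body = Seq (ROp (5, 2) Times (20, 1) (20, 1)) (Seq (ROp (4, 2) Plus (4, 2) (5, 2)) (ISuc 1))"

definition decide_keep :: "real \<Rightarrow> real \<Rightarrow> prog" where
  "decide_keep \<gamma> \<epsilon> = Seq (RConst (5, 2) (1 - \<gamma>)) (Seq (ROp (5, 2) Times (5, 2) (2, 2))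
    (IfLe (5, 2) (1, 2)
      (Seq (RConst (8, 2) 1) (Seq (ROp (5, 2) Plus (8, 2) (2, 3)) (Seq (ROp (5, 2) Times (2, 2) (5, 2))
        (IfLe (5, 2) (1, 2) (IfLe (8, 2) (21, 2) (RConst (6, 2) 1) Skip) (RConst (6, 2) 1)))))
      (Seq (RConst (5, 2) (\<epsilon>\<^sup>2)) (IfLe (5, 2) (4, 2) Skip (RConst (6, 2) 1)))))"

definition decide_init :: prog where
  "decide_init = Seq (RConst (6, 2) 0) (Seq (RConst (7, 2) 0) (IZero 1))"

definition decide_thresholds :: "real \<Rightarrow> real \<Rightarrow> prog" where
  "decide_thresholds \<kappa> L = Seq (RConst (5, 2) \<kappa>) (Seq (ROp (5, 2) Times (5, 2) (2, 2))
      (Seq (RConst (8, 2) L) (ROp (8, 2) Times (8, 2) (1, 2))))"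

definition decide :: "real \<Rightarrow> real \<Rightarrow> real \<Rightarrow> real \<Rightarrow> real \<Rightarrow> prog" where
  "decide N L \<kappa> \<gamma> \<epsilon> = Seq decide_init
    (IfLe (1, 2) (3, 2) (RConst (7, 2) N)
      (Seq (decide_thresholds \<kappa> L)
        (IfLe (5, 2) (1, 2)
          (IfLe (8, 2) (0, 2) (RConst (7, 2) N) (decide_keep \<gamma> \<epsilon>))
          (decide_keep \<gamma> \<epsilon>))))"

definition out_body :: prog where
  "out_body = Seq (ROp (0, 1) Times (6, 2) (20, 1)) (ISuc 1)"

text \<open>What the later phases read from the low cells. Register 1 is left out because it is
  overwritten as loop counter. The subroutines preserve these facts, since their cells start at
  register 4 and array 20.\<close>

definition input :: "nat \<Rightarrow> real \<Rightarrow> real \<Rightarrow> (nat \<Rightarrow> real) \<Rightarrow> real \<Rightarrow> state \<Rightarrow> bool" where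
  "input d ta \<delta> y t u \<longleftrightarrow> fst u 0 = d \<and> fst u 2 = 0 \<and> fst u 3 = 1 \<and> (\<forall>i<d. snd u 0 i = y i) \<and>
     snd u 1 0 = t \<and> snd u 2 0 = ta \<and> snd u 2 1 = \<delta> \<and> snd u 3 0 = 0"

text \<open>Arrays 20 and 21 are the images of the output array 0 under the two relocations.\<close>

definition evaluated :: "nat \<Rightarrow> (nat \<Rightarrow> real) \<Rightarrow> real \<Rightarrow> state \<Rightarrow> bool" where
  "evaluated d v b u \<longleftrightarrow> (\<forall>i<d. snd u 20 i = v i) \<and> snd u 21 0 = b"

text \<open>Reals are copied by adding the zero held in array 3, as there is no move instruction for
  them. The whole final state is recorded, because a subroutine started on the copy relies on zeros
  in every cell that holds no input.\<close>

lemma runs_copy: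
  fixes d y t ps
  assumes "ps = [ta, \<delta>]"
  defines "s \<equiv> wr_reg (init_state d ps y t) 3 1"
  shows "runs (WhileLess 1 0 copy_body) s (Suc (d * Suc 3))
    (\<lambda>u. fst u = (fst s)(1 := d) \<and>
       snd u = (snd s)(20 := (\<lambda>j. if j < d then y j else 0), 21 := (\<lambda>j. if j < d then y j else 0)))"
proof -
  let ?I = "\<lambda>i u. fst u = (fst s)(1 := i) \<and>
       snd u = (snd s)(20 := (\<lambda>j. if j < i then y j else 0), 21 := (\<lambda>j. if j < i then y j else 0))"
  have s0: "fst s 0 = d" "fst s 1 = 0" "fst s (Suc 0) = 0" by (simp_all add: s_def wr_reg_def init_state_def)
  have "runs (WhileLess 1 0 copy_body) s (Suc ((fst s 0 - fst s 1) * Suc 3))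
    (\<lambda>u. ?I (fst s 0) u \<and> fst u 1 = fst s 0 \<and> fst u 0 = fst s 0)"
  proof (rule runs_for)
    show "fst s 1 \<le> fst s 0" by (simp add: s0)
    show "?I (fst s 1) s" by (auto simp: s_def wr_reg_def init_state_def fun_eq_iff)
  next
    fix u i
    assume *: "?I i u" "fst u 1 = i" "fst u 0 = fst s 0" "i < fst s 0"
    have "loop_free copy_body" "cost copy_body \<le> 3" by (simp_all add: copy_body_def)
    moreover have "?I (Suc i) (sem copy_body u) \<and> fst (sem copy_body u) 1 = Suc i \<and> fst (sem copy_body u) 0 = fst s 0"
      using * by (auto simp: copy_body_def s_def wr_reg_def wr_def rd_def init_state_def fun_eq_iff)
    ultimately show "runs copy_body u 3 (\<lambda>u. ?I (Suc i) u \<and> fst u 1 = Suc i \<and> fst u 0 = fst s 0)"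
      by (rule runs_loop_freeI)
  qed
  then show ?thesis
    by (rule runs_mono) (auto simp: s0)
qed

text \<open>Register 3 becomes 1 so that the second parameter \<delta> can be addressed. What
  remains to be filled are the images of arrays 1 and 2 (arrays 22, 24 and 23, 25) and of register 0
  (registers 4 and 5); then both relocated memories look like a fresh
  \<open>init_state\<close>.\<close>

lemma runs_setup:
  fixes d y t ps
  assumes ps: "ps = [ta, \<delta>]"
  defines "s0 \<equiv> init_state d ps y t"
  shows "runs (Seq (ISuc 3) (Seq (WhileLess 1 0 copy_body) copy_scalars)) s0 (4 * d + 10)
    (\<lambda>u. input d ta \<delta> y t u \<and> embeds (\<lambda>a. 2 * a + 20) (\<lambda>r. 2 * r + 4) s0 u \<and>
       embeds (\<lambda>a. 2 * a + 21) (\<lambda>r. 2 * r + 5) s0 u)"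
    (is "runs _ _ _ ?Q")
proof -
  let ?s = "wr_reg s0 3 1"
  have init: "runs (ISuc 3) s0 1 (\<lambda>s. s = ?s)"
    by (rule runs_loop_freeI) (simp_all add: s0_def init_state_def)
  have copy: "runs (Seq (WhileLess 1 0 copy_body) copy_scalars) ?s (Suc (d * Suc 3) + 8) ?Q"
  proof (rule runs_Seq)
    show "runs (WhileLess 1 0 copy_body) ?s (Suc (d * Suc 3))
      (\<lambda>u. fst u = (fst ?s)(1 := d) \<and>
       snd u = (snd ?s)(20 := (\<lambda>j. if j < d then y j else 0), 21 := (\<lambda>j. if j < d then y j else 0)))"
      using runs_copy[OF ps] by (simp add: s0_def)
  next
    fix u
    assume u: "fst u = (fst ?s)(1 := d) \<and>
       snd u = (snd ?s)(20 := (\<lambda>j. if j < d then y j else 0), 21 := (\<lambda>j. if j < d then y j else 0))"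
    have "loop_free copy_scalars" "cost copy_scalars \<le> 8" by (simp_all add: copy_scalars_def)
    moreover have "?Q (sem copy_scalars u)"
      using u by (auto simp: copy_scalars_def s0_def wr_reg_def wr_def rd_def init_state_def ps fun_eq_iff
          input_def embeds_def less_Suc_eq)
    ultimately show "runs copy_scalars u 8 ?Q"
      by (rule runs_loop_freeI)
  qed
  have "runs (Seq (ISuc 3) (Seq (WhileLess 1 0 copy_body) copy_scalars)) s0 (1 + (Suc (d * Suc 3) + 8)) ?Q"
  proof (rule runs_Seq[OF init])
    fix s assume "s = ?s"
    with copy show "runs (Seq (WhileLess 1 0 copy_body) copy_scalars) s (Suc (d * Suc 3) + 8) ?Q"
      by (simp only:)
  qed
  then show ?thesis by (rule runs_mono) auto
qed

lemma runs_norm: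
  assumes "input d ta \<delta> y t u" "evaluated d v b u"
  shows "runs (Seq (Seq (IZero 1) (RConst (4, 2) 0)) (WhileLess 1 0 norm_body)) u (4 * d + 3)
    (\<lambda>s. input d ta \<delta> y t s \<and> evaluated d v b s \<and> snd s 4 0 = (\<Sum>i<d. (v i)\<^sup>2))"
proof -
  let ?I = "\<lambda>i s. input d ta \<delta> y t s \<and> evaluated d v b s \<and> snd s 4 0 = (\<Sum>i<i. (v i)\<^sup>2)"
  have "runs (Seq (Seq (IZero 1) (RConst (4, 2) 0)) (WhileLess 1 0 norm_body)) u (2 + Suc (d * Suc 3)) (?I d)"
  proof (rule runs_Seq)
    let ?p = "Seq (IZero 1) (RConst (4, 2) 0)"
    have "?I 0 (sem ?p u) \<and> fst (sem ?p u) 1 = 0"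
      using assms by (auto simp: input_def evaluated_def wr_reg_def wr_def)
    then show "runs ?p u 2 (\<lambda>s. ?I 0 s \<and> fst s 1 = 0)"
      by (intro runs_loop_freeI) simp_all
  next
    fix s
    assume s: "?I 0 s \<and> fst s 1 = 0"
    then have d: "fst s 0 = d" by (simp add: input_def)
    have "runs (WhileLess 1 0 norm_body) s (Suc ((fst s 0 - fst s 1) * Suc 3))
      (\<lambda>u. ?I (fst s 0) u \<and> fst u 1 = fst s 0 \<and> fst u 0 = fst s 0)"
    proof (rule runs_for)
      show "fst s 1 \<le> fst s 0" "?I (fst s 1) s" using s by simp_all
    next
      fix u i
      assume *: "?I i u" "fst u 1 = i" "fst u 0 = fst s 0" "i < fst s 0"
      have "loop_free norm_body" "cost norm_body \<le> 3" by (simp_all add: norm_body_def)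
      moreover have "?I (Suc i) (sem norm_body u) \<and> fst (sem norm_body u) 1 = Suc i \<and> fst (sem norm_body u) 0 = fst s 0"
        using * d by (auto simp: norm_body_def input_def evaluated_def wr_reg_def wr_def rd_def power2_eq_square)
      ultimately show "runs norm_body u 3 (\<lambda>u. ?I (Suc i) u \<and> fst u 1 = Suc i \<and> fst u 0 = fst s 0)"
        by (rule runs_loop_freeI)
    qed
    then show "runs (WhileLess 1 0 norm_body) s (Suc (d * Suc 3)) (?I d)"
      by (rule runs_mono) (use s d in auto)
  qed
  then show ?thesis by (rule runs_mono) auto
qed

lemma sem_decide_keep:
  assumes "input d ta \<delta> y t u" "evaluated d v b u" "snd u 4 0 = (\<Sum>i<d. (v i)\<^sup>2)" "snd u 6 0 = 0"
  shows "fst (sem (decide_keep \<gamma> \<epsilon>) u) = fst u \<and> evaluated d v b (sem (decide_keep \<gamma> \<epsilon>) u) \<and>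
       snd (sem (decide_keep \<gamma> \<epsilon>) u) 7 = snd u 7 \<and>
       snd (sem (decide_keep \<gamma> \<epsilon>) u) 6 0 = (if keeps d \<gamma> \<epsilon> ta \<delta> v b t then 1 else 0)"
proof (cases "(1 - \<gamma>) * ta \<le> t")
  case True
  then show ?thesis
    using assms
    by (cases "ta * (1 + \<delta>) \<le> t")
      (simp_all add: decide_keep_def input_def evaluated_def keeps_def wr_def rd_def)
next
  case False
  then show ?thesis
    using assms
    by (simp add: decide_keep_def input_def evaluated_def keeps_def wr_def rd_def)
qed

text \<open>Escape is tested on the cell \<open>snd u 0 0\<close>, which is known to hold
  \<open>y 0\<close> only for \<open>d > 0\<close>; the identification with \<open>y\<close> is
  postponed until a coordinate is actually output. At most one of the cells in arrays 6 and 7 ends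
  up nonzero.\<close>

lemma runs_decide:
  assumes "input d ta \<delta> y t u" "evaluated d v b u" "snd u 4 0 = (\<Sum>i<d. (v i)\<^sup>2)"
  shows "runs (decide N L \<kappa> \<gamma> \<epsilon>) u 20
    (\<lambda>s. fst s 0 = d \<and> fst s 1 = 0 \<and> fst s 2 = 0 \<and> evaluated d v b s \<and>
       snd s 7 0 = (if escapes \<kappa> L ta (snd u 0) t then N else 0) \<and>
       snd s 6 0 = (if \<not> escapes \<kappa> L ta (snd u 0) t \<and> keeps d \<gamma> \<epsilon> ta \<delta> v b t then 1 else 0))"
    (is "runs _ _ _ ?Q")
proof -
  define u' where "u' = sem decide_init u"
  define w where "w = sem (decide_thresholds \<kappa> L) u'"
  let ?p = "decide N L \<kappa> \<gamma> \<epsilon>"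
  have u': "input d ta \<delta> y t u'" "evaluated d v b u'" "snd u' 6 0 = 0" "snd u' 7 0 = 0"
    "fst u' 1 = 0" "snd u' 4 0 = (\<Sum>i<d. (v i)\<^sup>2)" "snd u' 0 0 = snd u 0 0"
    using assms by (simp_all add: u'_def decide_init_def input_def evaluated_def wr_reg_def wr_def)
  have w: "input d ta \<delta> y t w" "evaluated d v b w" "snd w 4 0 = (\<Sum>i<d. (v i)\<^sup>2)"
    "snd w 6 0 = 0" "snd w 7 0 = 0" "snd w 5 0 = \<kappa> * ta" "snd w 8 0 = L * t" "fst w 1 = 0"
    "snd w 0 0 = snd u 0 0"
    using u' by (simp_all add: w_def decide_thresholds_def input_def evaluated_def wr_def rd_def)
  have "rd u' (1, 2) = t" "rd u' (3, 2) = 0" "rd w (5, 2) = \<kappa> * ta" "rd w (1, 2) = t"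
      "rd w (8, 2) = L * t" "rd w (0, 2) = snd u 0 0"
    using u'(1) w(1,6,7,9) by (simp_all add: input_def rd_def)
  then have *: "sem ?p u = (if t \<le> 0 then wr u' (7, 2) N else
      if \<kappa> * ta \<le> t \<and> L * t \<le> snd u 0 0 then wr w (7, 2) N else sem (decide_keep \<gamma> \<epsilon>) w)"
    by (simp add: decide_def flip: u'_def w_def)
  have "?Q (sem ?p u)"
  proof (cases "escapes \<kappa> L ta (snd u 0) t")
    case True
    then have "sem ?p u = wr u' (7, 2) N \<or> sem ?p u = wr w (7, 2) N"
      unfolding * escapes_def by auto
    moreover have "?Q (wr s (7, 2) N)" if "input d ta \<delta> y t s" "evaluated d v b s" "snd s 6 0 = 0" "fst s 1 = 0" for s
      using that True by (simp add: wr_def input_def evaluated_def)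
    ultimately show ?thesis using u'(1,2,3,5) w(1,2,4,8) by (elim disjE) (simp_all only:)
  next
    case False
    then have "sem ?p u = sem (decide_keep \<gamma> \<epsilon>) w"
      unfolding * escapes_def by auto
    moreover have "?Q (sem (decide_keep \<gamma> \<epsilon>) w)"
      using sem_decide_keep[OF w(1-4), of \<gamma> \<epsilon>] False w(1,5,8) by (simp add: input_def)
    ultimately show ?thesis by (simp only:)
  qed
  moreover have "loop_free ?p" "cost ?p \<le> 20"
    by (simp_all add: decide_def decide_init_def decide_thresholds_def decide_keep_def)
  ultimately show ?thesis
    by (intro runs_loop_freeI)
qed

text \<open>In the application at most one of \<open>p\<close> and \<open>q\<close> is nonzero, so
  the case distinction in the drift becomes the single expression q v + p e_0. The final addition
  writes index 0 even for \<open>d = 0\<close>, where no output is read.\<close>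

lemma runs_out:
  assumes "fst u 0 = d \<and> fst u 1 = 0 \<and> fst u 2 = 0 \<and> evaluated d v b u \<and> snd u 7 0 = p \<and> snd u 6 0 = q"
  shows "runs (Seq (WhileLess 1 0 out_body) (ROp (0, 2) Plus (0, 2) (7, 2))) u (3 * d + 2)
    (\<lambda>s. \<forall>i<d. snd s 0 i = (if i = 0 then q * v i + p else q * v i))" (is "runs _ _ _ ?Q")
proof -
  let ?I = "\<lambda>i (s :: state). fst s 2 = 0 \<and> (\<forall>j<d. snd s 20 j = v j) \<and> snd s 7 0 = p \<and> snd s 6 0 = q \<and>
      (\<forall>j<i. snd s 0 j = q * v j)"
  have "runs (Seq (WhileLess 1 0 out_body) (ROp (0, 2) Plus (0, 2) (7, 2))) u (Suc (d * Suc 2) + 1) ?Q"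
  proof (rule runs_Seq)
    have "runs (WhileLess 1 0 out_body) u (Suc ((fst u 0 - fst u 1) * Suc 2))
      (\<lambda>s. ?I (fst u 0) s \<and> fst s 1 = fst u 0 \<and> fst s 0 = fst u 0)"
    proof (rule runs_for)
      show "fst u 1 \<le> fst u 0" "?I (fst u 1) u" using assms by (simp_all add: evaluated_def)
    next
      fix s i
      assume *: "?I i s" "fst s 1 = i" "fst s 0 = fst u 0" "i < fst u 0"
      have "loop_free out_body" "cost out_body \<le> 2" by (simp_all add: out_body_def)
      moreover have "?I (Suc i) (sem out_body s) \<and> fst (sem out_body s) 1 = Suc i \<and> fst (sem out_body s) 0 = fst u 0"
        using * assms by (auto simp: out_body_def wr_reg_def wr_def rd_def less_Suc_eq)
      ultimately show "runs out_body s 2 (\<lambda>s. ?I (Suc i) s \<and> fst s 1 = Suc i \<and> fst s 0 = fst u 0)"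
        by (rule runs_loop_freeI)
    qed
    then show "runs (WhileLess 1 0 out_body) u (Suc (d * Suc 2)) (?I d)"
      by (rule runs_mono) (use assms in auto)
  next
    fix s
    assume s: "?I d s"
    show "runs (ROp (0, 2) Plus (0, 2) (7, 2)) s 1 ?Q"
      using s by (intro runs_loop_freeI) (auto simp: wr_def rd_def)
  qed
  then show ?thesis by (rule runs_mono) auto
qed

text \<open>The numbers N, L, \<kappa>, \<gamma>, \<epsilon> can be program constants because they
  do not depend on the dimension; \<open>ta d\<close> and \<open>\<delta> d\<close> do, and are read
  from the parameter list.\<close>

lemma polytime_modified_drift:
  assumes m0: "polytime_drift (\<lambda>d. [ta d, \<delta> d]) m0"
    and \<phi>: "polytime_test (\<lambda>d. [ta d, \<delta> d]) \<phi>"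
  shows "polytime_drift (\<lambda>d. [ta d, \<delta> d])
    (\<lambda>d. modified_drift N L \<kappa> \<gamma> \<epsilon> (ta d) (\<delta> d) (m0 d) (\<phi> d) d)"
proof -
  let ?s = "\<lambda>d. init_state d [ta d, \<delta> d]"
  let ?f0 = "\<lambda>a::nat. 2 * a + 20" and ?g0 = "\<lambda>r::nat. 2 * r + 4"
  let ?f1 = "\<lambda>a::nat. 2 * a + 21" and ?g1 = "\<lambda>r::nat. 2 * r + 5"
  obtain p0 K0 where p0: "\<And>d y t. y \<in> space (euc d) \<Longrightarrow> 0 \<le> t \<Longrightarrow>
      \<exists>n s. exec p0 (?s d y t) n s \<and> n \<le> K0 * d ^ K0 + K0 \<and> (\<forall>i<d. snd s 0 i = m0 d y t i)"
    using m0 unfolding polytime_drift_def polytime_computable_def by blast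
  obtain p1 K1 where p1: "\<And>d y t. y \<in> space (euc d) \<Longrightarrow> 0 \<le> t \<Longrightarrow>
      \<exists>n s. exec p1 (?s d y t) n s \<and> n \<le> K1 * d ^ K1 + K1 \<and> snd s 0 0 = \<phi> d y t"
    using \<phi> unfolding polytime_test_def polytime_computable_def by fastforce
  \<comment> \<open>Exponent and coefficient at once: it dominates both given exponents, the sum of
    the coefficients and the cost 11 d + 35 of the remaining phases.\<close>
  define K where "K = 2 * K0 + 2 * K1 + 50"
  let ?p = "Seq (Seq (ISuc 3) (Seq (WhileLess 1 0 copy_body) copy_scalars))
    (Seq (map_prog ?f0 ?g0 p0) (Seq (map_prog ?f1 ?g1 p1)
    (Seq (Seq (Seq (IZero 1) (RConst (4, 2) 0)) (WhileLess 1 0 norm_body))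
    (Seq (decide N L \<kappa> \<gamma> \<epsilon>) (Seq (WhileLess 1 0 out_body) (ROp (0, 2) Plus (0, 2) (7, 2)))))))"
  have "\<exists>n s. exec ?p (?s d y t) n s \<and> n \<le> K * d ^ K + K \<and>
      (\<forall>i<d. snd s 0 i = modified_drift N L \<kappa> \<gamma> \<epsilon> (ta d) (\<delta> d) (m0 d) (\<phi> d) d y t i)"
    if y: "y \<in> space (euc d)" and t: "0 \<le> t" for d y t
  proof -
    let ?in = "input d (ta d) (\<delta> d) y t" and ?ev = "evaluated d (m0 d y t) (\<phi> d y t)"
    obtain n0 s0 where s0: "exec p0 (?s d y t) n0 s0" "n0 \<le> K0 * d ^ K0 + K0"
      "\<forall>i<d. snd s0 0 i = m0 d y t i" using p0[OF y t] by blast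
    obtain n1 s1 where s1: "exec p1 (?s d y t) n1 s1" "n1 \<le> K1 * d ^ K1 + K1"
      "snd s1 0 0 = \<phi> d y t" using p1[OF y t] by blast
    have inj: "inj ?f0" "inj ?g0" "inj ?f1" "inj ?g1" by (auto intro!: injI)
    \<comment> \<open>Parity separates the memories of the two subroutines.\<close>
    have range0: "2 * a + 21 \<notin> range ?f0" "2 * r + 5 \<notin> range ?g0" for a r :: nat
      by (auto, presburger+)
    have range1: "2 * a + 20 \<notin> range ?f1" "2 * r + 4 \<notin> range ?g1" for a r :: nat
      by (auto, presburger+)
    have small: "i < 4 \<Longrightarrow> i \<notin> range ?f0 \<and> i \<notin> range ?g0 \<and> i \<notin> range ?f1 \<and> i \<notin> range ?g1" for i by auto
    \<comment> \<open>The first subroutine leaves the odd arrays and registers alone, so the copy of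
      the input that awaits the second one is intact. In \<open>step1\<close> the same argument,
      with parities exchanged, saves the result of the first.\<close>
    have step0: "runs (map_prog ?f0 ?g0 p0) u (K0 * d ^ K0 + K0)
        (\<lambda>u. ?in u \<and> embeds ?f0 ?g0 s0 u \<and> embeds ?f1 ?g1 (?s d y t) u)"
      if u: "?in u \<and> embeds ?f0 ?g0 (?s d y t) u \<and> embeds ?f1 ?g1 (?s d y t) u" for u
    proof (rule runs_map_prog[OF s0(1) inj(1,2) _ s0(2)])
      fix v assume v: "embeds ?f0 ?g0 s0 v" "agree_outside (range ?f0) (range ?g0) u v"
      have "?in v" using u v(2) small unfolding input_def agree_outside_def by simp
      moreover have "embeds ?f1 ?g1 (?s d y t) v"
        using u v(2) range0 unfolding embeds_def agree_outside_def by simp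
      ultimately show "?in v \<and> embeds ?f0 ?g0 s0 v \<and> embeds ?f1 ?g1 (?s d y t) v" using v by simp
    qed (use u in simp)
    have step1: "runs (map_prog ?f1 ?g1 p1) u (K1 * d ^ K1 + K1) (\<lambda>u. ?in u \<and> ?ev u)"
      if u: "?in u \<and> embeds ?f0 ?g0 s0 u \<and> embeds ?f1 ?g1 (?s d y t) u" for u
    proof (rule runs_map_prog[OF s1(1) inj(3,4) _ s1(2)])
      fix v assume v: "embeds ?f1 ?g1 s1 v" "agree_outside (range ?f1) (range ?g1) u v"
      have "?in v" using u v(2) small unfolding input_def agree_outside_def by simp
      moreover have "snd v (2 * 0 + 20) = snd u (2 * 0 + 20)"
        using v(2) range1(1)[of 0] unfolding agree_outside_def by blast
      then have "snd v 20 = snd s0 0" using u unfolding embeds_def by (metis add_0 mult_0_right)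
      moreover have "snd v 21 = snd s1 0" using v(1) unfolding embeds_def by (metis add_0 mult_0_right)
      ultimately show "?in v \<and> ?ev v" using s0(3) s1(3) by (simp add: evaluated_def)
    qed (use u in simp)
    let ?E = "\<lambda>u. escapes \<kappa> L (ta d) (snd u 0) t" and ?k = "keeps d \<gamma> \<epsilon> (ta d) (\<delta> d) (m0 d y t) (\<phi> d y t) t"
    have step2: "runs (Seq (decide N L \<kappa> \<gamma> \<epsilon>) (Seq (WhileLess 1 0 out_body) (ROp (0, 2) Plus (0, 2) (7, 2)))) u
        (20 + (3 * d + 2))
        (\<lambda>s. \<forall>i<d. snd s 0 i = modified_drift N L \<kappa> \<gamma> \<epsilon> (ta d) (\<delta> d) (m0 d) (\<phi> d) d y t i)"
      if u: "?in u \<and> ?ev u \<and> snd u 4 0 = (\<Sum>i<d. (m0 d y t i)\<^sup>2)" for u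
    proof (rule runs_Seq[OF runs_decide])
      show "?in u" "?ev u" "snd u 4 0 = (\<Sum>i<d. (m0 d y t i)\<^sup>2)" using u by auto
    next
      have E: "?E u \<longleftrightarrow> escapes \<kappa> L (ta d) y t" if "0 < d"
        using u that by (simp add: escapes_def input_def)
      fix s
      assume "fst s 0 = d \<and> fst s 1 = 0 \<and> fst s 2 = 0 \<and> ?ev s \<and>
        snd s 7 0 = (if ?E u then N else 0) \<and> snd s 6 0 = (if \<not> ?E u \<and> ?k then 1 else 0)"
      then have "runs (Seq (WhileLess 1 0 out_body) (ROp (0, 2) Plus (0, 2) (7, 2))) s (3 * d + 2)
        (\<lambda>s. \<forall>i<d. snd s 0 i = (if i = 0 then (if \<not> ?E u \<and> ?k then 1 else 0) * m0 d y t i + (if ?E u then N else 0)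
           else (if \<not> ?E u \<and> ?k then 1 else 0) * m0 d y t i))"
        by (rule runs_out)
      then show "runs (Seq (WhileLess 1 0 out_body) (ROp (0, 2) Plus (0, 2) (7, 2))) s (3 * d + 2)
        (\<lambda>s. \<forall>i<d. snd s 0 i = modified_drift N L \<kappa> \<gamma> \<epsilon> (ta d) (\<delta> d) (m0 d) (\<phi> d) d y t i)"
        by (rule runs_mono) (auto simp: modified_drift_def E)
    qed
    have "runs ?p (?s d y t) ((4 * d + 10) + ((K0 * d ^ K0 + K0) + ((K1 * d ^ K1 + K1) + ((4 * d + 3) + (20 + (3 * d + 2))))))
        (\<lambda>s. \<forall>i<d. snd s 0 i = modified_drift N L \<kappa> \<gamma> \<epsilon> (ta d) (\<delta> d) (m0 d) (\<phi> d) d y t i)"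
    proof (rule runs_Seq[OF runs_setup[OF refl]], rule runs_Seq[OF step0], assumption,
        rule runs_Seq[OF step1], assumption, rule runs_Seq)
      fix u assume "?in u \<and> ?ev u"
      then show "runs (Seq (Seq (IZero 1) (RConst (4, 2) 0)) (WhileLess 1 0 norm_body)) u (4 * d + 3)
        (\<lambda>s. ?in s \<and> ?ev s \<and> snd s 4 0 = (\<Sum>i<d. (m0 d y t i)\<^sup>2))"
        using runs_norm by blast
    qed (rule step2)
    moreover have "(4 * d + 10) + ((K0 * d ^ K0 + K0) + ((K1 * d ^ K1 + K1) + ((4 * d + 3) + (20 + (3 * d + 2)))))
        \<le> K * d ^ K + K"
    proof -
      \<comment> \<open>The summand 1 covers \<open>d = 0\<close>, \<open>k = 0\<close>, where
        \<open>0 ^ 0 = 1\<close>.\<close>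
      have *: "d ^ k \<le> d ^ K + 1" if "k \<le> K" for k
        using that power_increasing[of k K d] by (cases "d = 0") (auto simp: power_0_left)
      have "d \<le> d ^ K" by (cases "d = 0") (auto simp: K_def intro: self_le_power)
      moreover have "K0 * d ^ K0 \<le> K0 * (d ^ K + 1)" "K1 * d ^ K1 \<le> K1 * (d ^ K + 1)"
        by (intro mult_le_mono2 * ; simp add: K_def)+
      ultimately have "(4 * d + 10) + ((K0 * d ^ K0 + K0) + ((K1 * d ^ K1 + K1) + ((4 * d + 3) + (20 + (3 * d + 2)))))
        \<le> K0 * (d ^ K + 1) + K0 + K1 * (d ^ K + 1) + K1 + 11 * d ^ K + 35" by linarith
      also have "\<dots> \<le> K * d ^ K + K" by (simp add: K_def algebra_simps)
      finally show ?thesis .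
    qed
    ultimately show ?thesis unfolding runs_def by (meson le_trans)
  qed
  then show ?thesis unfolding polytime_drift_def polytime_computable_def by blast
qed

section \<open>Gaussian vectors\<close>

lemma space_euc: "space (euc d) = {..<d} \<rightarrow>\<^sub>E UNIV"
  by (simp add: euc_def space_PiM)

lemma vzero_space [simp]: "vzero d \<in> space (euc d)"
  and vadd_space [simp]: "vadd d x y \<in> space (euc d)"
  and vdiff_space [simp]: "vdiff d x y \<in> space (euc d)"
  and vscale_space [simp]: "vscale d r x \<in> space (euc d)"
  by (auto simp: space_euc vzero_def vadd_def vdiff_def vscale_def)

lemma measurable_euc_component [measurable]: "i < d \<Longrightarrow> (\<lambda>x. x i) \<in> borel_measurable (euc d)"
  unfolding euc_def by (rule measurable_component_singleton) simp

lemma measurable_into_euc: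
  assumes "\<And>i. i < d \<Longrightarrow> (\<lambda>x. f x i) \<in> borel_measurable M"
  shows "(\<lambda>x. \<lambda>i\<in>{..<d}. f x i) \<in> measurable M (euc d)"
  unfolding euc_def using assms by (intro measurable_restrict) auto

lemma measurable_vadd [measurable (raw)]:
  assumes [measurable]: "f \<in> measurable M (euc d)" "g \<in> measurable M (euc d)"
  shows "(\<lambda>x. vadd d (f x) (g x)) \<in> measurable M (euc d)"
  unfolding vadd_def by (intro measurable_into_euc) measurable

lemma measurable_vdiff [measurable (raw)]:
  assumes [measurable]: "f \<in> measurable M (euc d)" "g \<in> measurable M (euc d)"
  shows "(\<lambda>x. vdiff d (f x) (g x)) \<in> measurable M (euc d)"
  unfolding vdiff_def by (intro measurable_into_euc) measurable

lemma measurable_vscale [measurable (raw)]: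
  assumes [measurable]: "r \<in> borel_measurable M" "g \<in> measurable M (euc d)"
  shows "(\<lambda>x. vscale d (r x) (g x)) \<in> measurable M (euc d)"
  unfolding vscale_def by (intro measurable_into_euc) measurable

lemma measurable_vnorm [measurable]: "vnorm d \<in> borel_measurable (euc d)"
  unfolding vnorm_def L2_set_def by measurable

lemma vnorm_vadd_le: "vnorm d (vadd d x y) \<le> vnorm d x + vnorm d y"
proof -
  have "vnorm d (vadd d x y) = L2_set (\<lambda>i. x i + y i) {..<d}"
    unfolding vnorm_def vadd_def by (intro L2_set_cong) auto
  then show ?thesis unfolding vnorm_def using L2_set_triangle_ineq by metis
qed

lemma vnorm_vscale: "vnorm d (vscale d r x) = \<bar>r\<bar> * vnorm d x"
proof -
  have "vnorm d (vscale d r x) = sqrt (\<Sum>i<d. r\<^sup>2 * (x i)\<^sup>2)"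
    unfolding vnorm_def vscale_def L2_set_def by (simp add: power_mult_distrib)
  also have "\<dots> = \<bar>r\<bar> * vnorm d x"
    by (simp add: vnorm_def L2_set_def real_sqrt_mult flip: sum_distrib_left)
  finally show ?thesis .
qed

lemma vnorm_nonneg [simp]: "0 \<le> vnorm d x"
  by (simp add: vnorm_def)

lemma vnorm_cong: "(\<And>i. i < d \<Longrightarrow> x i = y i) \<Longrightarrow> vnorm d x = vnorm d y"
  unfolding vnorm_def by (intro L2_set_cong) auto

lemma vnorm_vzero [simp]: "vnorm d (vzero d) = 0"
  by (simp add: vnorm_def vzero_def L2_set_def)

lemma component_le_vnorm: "i < d \<Longrightarrow> \<bar>x i\<bar> \<le> vnorm d x"
  using member_le_L2_set[of "{..<d}" i "\<lambda>i. \<bar>x i\<bar>"] by (simp add: vnorm_def L2_set_def)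

lemma vnorm_vdiff_commute: "vnorm d (vdiff d x y) = vnorm d (vdiff d y x)"
  unfolding vnorm_def vdiff_def L2_set_def by (simp add: power2_commute)

lemma vnorm_le_vdiff: "vnorm d x \<le> vnorm d (vdiff d x y) + vnorm d y"
proof -
  have "vnorm d x = vnorm d (vadd d (vdiff d x y) y)"
    by (rule vnorm_cong) (simp add: vadd_def vdiff_def)
  then show ?thesis using vnorm_vadd_le by metis
qed

lemma vnorm_vdiff_le: "vnorm d (vdiff d x y) \<le> vnorm d x + vnorm d y"
proof -
  have "vnorm d (vdiff d x y) = vnorm d (vadd d x (vscale d (-1) y))"
    by (rule vnorm_cong) (simp add: vadd_def vdiff_def vscale_def)
  then show ?thesis using vnorm_vadd_le[of d x "vscale d (-1) y"] by (simp add: vnorm_vscale)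
qed

section \<open>Gaussian laws under scaling, tilting and shifting\<close>

abbreviation normal :: "real \<Rightarrow> real measure" where
  "normal v \<equiv> density lborel (\<lambda>u. ennreal (normal_density 0 (sqrt v) u))"

lemma prob_space_normal: "0 < v \<Longrightarrow> prob_space (normal v)"
  by (rule prob_space_normal_density) simp

lemma sets_gauss [measurable_cong, simp]: "sets (gauss d v) = sets (euc d)"
  unfolding gauss_def euc_def by (rule sets_PiM_cong) auto

lemma space_gauss [simp]: "space (gauss d v) = space (euc d)"
  by (rule sets_eq_imp_space_eq) simp

lemma prob_space_gauss: "0 < v \<Longrightarrow> prob_space (gauss d v)"
  unfolding gauss_def by (intro prob_space_PiM prob_space_normal)

text \<open>The affine rule for normal densities speaks of random variables, so
  \<open>normal 1\<close> itself serves as probability space and the identity as random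
  variable.\<close>

lemma distr_normal_scale:
  assumes "0 < v"
  shows "distr (normal 1) borel (\<lambda>u. sqrt v * u) = normal v"
proof -
  have "distributed (normal 1) lborel (\<lambda>u. u) (\<lambda>u. ennreal (normal_density 0 1 u))"
    unfolding distributed_def by (auto simp: distr_id2)
  then interpret prob_space "normal 1" by (intro prob_space_normal) simp
  have d: "distributed (normal 1) lborel (\<lambda>u. u) (\<lambda>u. ennreal (normal_density 0 1 u))"
    unfolding distributed_def by (auto simp: distr_id2)
  have "distributed (normal 1) lborel (\<lambda>u. 0 + sqrt v * u)
      (\<lambda>u. ennreal (normal_density (0 + sqrt v * 0) (\<bar>sqrt v\<bar> * 1) u))"
    using assms by (intro normal_density_affine[OF d]) auto
  then have "distr (normal 1) lborel (\<lambda>u. sqrt v * u) = normal v"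
    using assms by (simp add: distributed_def)
  then show ?thesis by (simp cong: distr_cong)
qed

lemma distr_gauss_scale:
  assumes "0 < v"
  shows "distr (gauss d 1) (euc d) (vscale d (sqrt v)) = gauss d v"
proof -
  have "distr (PiM {..<d} (\<lambda>_. normal 1)) (PiM {..<d} (\<lambda>_. normal v)) (compose {..<d} (\<lambda>u. sqrt v * u)) =
      PiM {..<d} (\<lambda>_. distr (normal 1) (normal v) (\<lambda>u. sqrt v * u))"
    using assms by (intro distr_PiM_finite_prob_space' prob_space_normal) auto
  also have "distr (normal 1) (normal v) (\<lambda>u. sqrt v * u) = normal v"
    using distr_normal_scale[OF assms] by (simp cong: distr_cong)
  finally have "distr (gauss d 1) (gauss d v) (compose {..<d} (\<lambda>u. sqrt v * u)) = gauss d v"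
    by (simp add: gauss_def)
  moreover have "compose {..<d} (\<lambda>u. sqrt v * u) = vscale d (sqrt v)"
    by (auto simp: fun_eq_iff compose_def vscale_def)
  ultimately show ?thesis by (simp cong: distr_cong)
qed

text \<open>Completing the square turns the tilted density into exp(s^2 / 2) times the normal
  density with mean \<open>s\<close>, which has mass 1.\<close>

lemma nn_integral_exp_normal:
  "(\<integral>\<^sup>+u. ennreal (exp (s * u)) \<partial>normal 1) = ennreal (exp (s\<^sup>2 / 2))"
proof -
  have eq: "normal_density 0 1 u * exp (s * u) = exp (s\<^sup>2 / 2) * normal_density s 1 u" for u
    by (simp add: normal_density_def exp_add[symmetric] power2_eq_square field_simps)
  have "(\<integral>\<^sup>+u. ennreal (exp (s * u)) \<partial>normal 1) = (\<integral>\<^sup>+u. ennreal (normal_density 0 1 u * exp (s * u)) \<partial>lborel)"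
    by (simp add: nn_integral_density ennreal_mult)
  also have "\<dots> = ennreal (exp (s\<^sup>2 / 2)) * (\<integral>\<^sup>+u. ennreal (normal_density s 1 u) \<partial>lborel)"
    unfolding eq by (simp add: nn_integral_cmult ennreal_mult)
  also have "(\<integral>\<^sup>+u. ennreal (normal_density s 1 u) \<partial>lborel) = 1"
    using prob_space.emeasure_space_1[OF prob_space_normal_density[of 1 s]]
    by (simp add: emeasure_density)
  finally show ?thesis by simp
qed

lemma distr_gauss_component: "i < d \<Longrightarrow> 0 < v \<Longrightarrow> distr (gauss d v) borel (\<lambda>z. z i) = normal v"
  using distr_PiM_component[of "{..<d}" "\<lambda>_. normal v" i] prob_space_normal[of v]
  by (simp add: gauss_def cong: distr_cong)

lemma nn_integral_exp_gauss:
  assumes "i < d"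
  shows "(\<integral>\<^sup>+z. ennreal (exp (s * z i)) \<partial>gauss d 1) = ennreal (exp (s\<^sup>2 / 2))"
proof -
  have "(\<integral>\<^sup>+z. ennreal (exp (s * z i)) \<partial>gauss d 1) =
      (\<integral>\<^sup>+u. ennreal (exp (s * u)) \<partial>distr (gauss d 1) borel (\<lambda>z. z i))"
    using assms by (intro nn_integral_distr[symmetric, where T = "\<lambda>z. z i"]) auto
  then show ?thesis
    unfolding distr_gauss_component[OF assms zero_less_one] nn_integral_exp_normal .
qed

text \<open>Chernoff's bound with the optimal tilt \<open>u\<close>: on the event, exp(u z_i - u^2)
  is at least 1.\<close>

lemma gauss_tail:
  assumes "i < d" "0 \<le> u"
  shows "emeasure (gauss d 1) {z \<in> space (euc d). u \<le> z i} \<le> ennreal (exp (- u\<^sup>2 / 2))"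
proof -
  have "emeasure (gauss d 1) {z \<in> space (euc d). u \<le> z i} =
      (\<integral>\<^sup>+z. indicator {z \<in> space (euc d). u \<le> z i} z \<partial>gauss d 1)"
    using assms by (intro nn_integral_indicator[symmetric]) measurable
  also have "\<dots> \<le> (\<integral>\<^sup>+z. ennreal (exp (- u\<^sup>2)) * ennreal (exp (u * z i)) \<partial>gauss d 1)"
  proof (rule nn_integral_mono)
    fix z
    have "1 \<le> ennreal (exp (- u\<^sup>2) * exp (u * z i))" if "u \<le> z i"
      using that assms by (simp add: power2_eq_square mult_left_mono flip: exp_add)
    then show "indicator {z \<in> space (euc d). u \<le> z i} z \<le> ennreal (exp (- u\<^sup>2)) * ennreal (exp (u * z i))"
      by (auto simp: indicator_def simp flip: ennreal_mult)
  qed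
  also have "\<dots> = ennreal (exp (- u\<^sup>2)) * ennreal (exp (u\<^sup>2 / 2))"
    using assms by (subst nn_integral_cmult) (auto simp: nn_integral_exp_gauss)
  also have "\<dots> = ennreal (exp (- u\<^sup>2 / 2))"
    by (simp flip: ennreal_mult exp_add)
  finally show ?thesis .
qed

lemma nn_integral_exp_sum_gauss:
  "(\<integral>\<^sup>+z. ennreal (exp (\<Sum>i<d. s i * z i)) \<partial>gauss d 1) = ennreal (exp ((\<Sum>i<d. (s i)\<^sup>2) / 2))"
proof -
  interpret product_sigma_finite "\<lambda>_::nat. normal 1"
    unfolding product_sigma_finite_def
    by (intro allI prob_space_imp_sigma_finite prob_space_normal) simp
  have "(\<integral>\<^sup>+z. ennreal (exp (\<Sum>i<d. s i * z i)) \<partial>gauss d 1) =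
      (\<integral>\<^sup>+z. (\<Prod>i<d. ennreal (exp (s i * z i))) \<partial>PiM {..<d} (\<lambda>_. normal 1))"
    by (simp add: gauss_def exp_sum prod_ennreal)
  also have "\<dots> = (\<Prod>i<d. \<integral>\<^sup>+u. ennreal (exp (s i * u)) \<partial>normal 1)"
    by (rule product_nn_integral_prod) auto
  also have "\<dots> = (\<Prod>i<d. ennreal (exp ((s i)\<^sup>2 / 2)))"
    by (simp only: nn_integral_exp_normal)
  also have "\<dots> = ennreal (exp ((\<Sum>i<d. (s i)\<^sup>2) / 2))"
    by (simp add: prod_ennreal exp_sum sum_divide_distrib)
  finally show ?thesis .
qed

lemma distr_normal_shift:
  "distr (normal 1) borel (\<lambda>u. b + u) = density (normal 1) (\<lambda>u. ennreal (exp (b * u - b\<^sup>2 / 2)))"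
proof -
  interpret prob_space "normal 1" by (intro prob_space_normal) simp
  have d: "distributed (normal 1) lborel (\<lambda>u. u) (\<lambda>u. ennreal (normal_density 0 1 u))"
    unfolding distributed_def by (auto simp: distr_id2)
  have "distributed (normal 1) lborel (\<lambda>u. b + 1 * u)
      (\<lambda>u. ennreal (normal_density (b + 1 * 0) (\<bar>1\<bar> * 1) u))"
    by (intro normal_density_affine[OF d]) auto
  then have "distr (normal 1) lborel (\<lambda>u. b + u) = density lborel (\<lambda>u. ennreal (normal_density b 1 u))"
    by (simp add: distributed_def)
  also have "\<dots> = density (normal 1) (\<lambda>u. ennreal (exp (b * u - b\<^sup>2 / 2)))"
  proof -
    have "normal_density b 1 u = normal_density 0 1 u * exp (b * u - b\<^sup>2 / 2)" for u
      by (simp add: normal_density_def exp_add[symmetric] power2_eq_square field_simps)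
    then show ?thesis by (simp add: density_density_eq ennreal_mult)
  qed
  finally show ?thesis by (simp cong: distr_cong)
qed

text \<open>The finite-dimensional Cameron-Martin formula. Both sides are identified with the
  product of the shifted one-dimensional laws by their values on boxes, where everything factorizes
  over the coordinates.\<close>

lemma distr_gauss_shift:
  "distr (gauss d 1) (euc d) (vadd d b) =
     density (gauss d 1) (\<lambda>z. ennreal (exp ((\<Sum>i<d. b i * z i) - (\<Sum>i<d. (b i)\<^sup>2) / 2)))"
proof -
  let ?N = "\<lambda>_::nat. normal 1" and ?g = "\<lambda>i u. ennreal (exp (b i * u - (b i)\<^sup>2 / 2))"
  interpret product_sigma_finite ?N
    unfolding product_sigma_finite_def
    by (intro allI prob_space_imp_sigma_finite prob_space_normal) simp
  let ?D = "\<lambda>i. distr (normal 1) borel (\<lambda>u. b i + u)"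
  have D: "prob_space (?D i)" for i
    by (intro prob_space.prob_space_distr prob_space_normal) auto
  interpret D: product_sigma_finite ?D
    unfolding product_sigma_finite_def
    by (intro allI prob_space_imp_sigma_finite D)
  have dens: "density (gauss d 1) (\<lambda>z. ennreal (exp ((\<Sum>i<d. b i * z i) - (\<Sum>i<d. (b i)\<^sup>2) / 2))) = PiM {..<d} ?D"
  proof (rule D.PiM_eqI)
    show "sets (density (gauss d 1) (\<lambda>z. ennreal (exp ((\<Sum>i<d. b i * z i) - (\<Sum>i<d. (b i)\<^sup>2) / 2)))) = sets (PiM {..<d} ?D)"
      by (simp add: euc_def cong: sets_PiM_cong)
  next
    fix A assume A: "\<And>i. i \<in> {..<d} \<Longrightarrow> A i \<in> sets (?D i)"
    then have [measurable]: "\<And>i. i \<in> {..<d} \<Longrightarrow> A i \<in> sets borel" by simp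
    have PA: "Pi\<^sub>E {..<d} A \<in> sets (gauss d 1)"
      using A unfolding sets_gauss euc_def by (intro sets_PiM_I_finite) auto
    have "emeasure (density (gauss d 1) (\<lambda>z. ennreal (exp ((\<Sum>i<d. b i * z i) - (\<Sum>i<d. (b i)\<^sup>2) / 2)))) (Pi\<^sub>E {..<d} A) =
       (\<integral>\<^sup>+z. ennreal (exp ((\<Sum>i<d. b i * z i) - (\<Sum>i<d. (b i)\<^sup>2) / 2)) * indicator (Pi\<^sub>E {..<d} A) z \<partial>gauss d 1)"
      using PA by (intro emeasure_density) auto
    also have "\<dots> = (\<integral>\<^sup>+z. (\<Prod>i<d. ?g i (z i) * indicator (A i) (z i)) \<partial>PiM {..<d} ?N)"
      unfolding gauss_def
    proof (rule nn_integral_cong)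
      fix z assume "z \<in> space (PiM {..<d} ?N)"
      then have "indicator (Pi\<^sub>E {..<d} A) z = (\<Prod>i<d. indicator (A i) (z i) :: ennreal)"
        by (auto simp: indicator_def space_PiM PiE_iff)
      then show "ennreal (exp ((\<Sum>i<d. b i * z i) - (\<Sum>i<d. (b i)\<^sup>2) / 2)) * indicator (Pi\<^sub>E {..<d} A) z =
          (\<Prod>i<d. ?g i (z i) * indicator (A i) (z i))"
        by (simp add: prod.distrib prod_ennreal sum_subtractf sum_divide_distrib flip: exp_sum)
    qed
    also have "\<dots> = (\<Prod>i<d. \<integral>\<^sup>+u. ?g i u * indicator (A i) u \<partial>normal 1)"
      by (rule product_nn_integral_prod) auto
    also have "\<dots> = (\<Prod>i<d. emeasure (?D i) (A i))"
      unfolding distr_normal_shift by (intro prod.cong refl emeasure_density[symmetric]) auto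
    finally show "emeasure (density (gauss d 1) (\<lambda>z. ennreal (exp ((\<Sum>i<d. b i * z i) - (\<Sum>i<d. (b i)\<^sup>2) / 2)))) (Pi\<^sub>E {..<d} A) =
       (\<Prod>i<d. emeasure (?D i) (A i))" .
  qed simp
  have shift: "distr (gauss d 1) (euc d) (vadd d b) = PiM {..<d} ?D"
  proof (rule D.PiM_eqI)
    show "sets (distr (gauss d 1) (euc d) (vadd d b)) = sets (PiM {..<d} ?D)"
      by (simp add: euc_def cong: sets_PiM_cong)
  next
    fix A assume A: "\<And>i. i \<in> {..<d} \<Longrightarrow> A i \<in> sets (?D i)"
    then have A': "\<And>i. i \<in> {..<d} \<Longrightarrow> A i \<in> sets borel" by simp
    have pre: "\<And>i. i \<in> {..<d} \<Longrightarrow> (\<lambda>u. b i + u) -` A i \<in> sets borel"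
      using measurable_sets[of "\<lambda>u. b _ + u" borel borel] A' by fastforce
    have "(\<lambda>z. vadd d b z) \<in> measurable (gauss d 1) (euc d)"
      unfolding vadd_def by (intro measurable_into_euc) auto
    then have "emeasure (distr (gauss d 1) (euc d) (vadd d b)) (Pi\<^sub>E {..<d} A) =
        emeasure (gauss d 1) (vadd d b -` Pi\<^sub>E {..<d} A \<inter> space (gauss d 1))"
      using A' unfolding euc_def by (intro emeasure_distr sets_PiM_I_finite) auto
    also have "vadd d b -` Pi\<^sub>E {..<d} A \<inter> space (gauss d 1) = Pi\<^sub>E {..<d} (\<lambda>i. (\<lambda>u. b i + u) -` A i)"
      by (auto simp: space_euc vadd_def PiE_iff extensional_def)
    also have "emeasure (gauss d 1) \<dots> = (\<Prod>i<d. emeasure (normal 1) ((\<lambda>u. b i + u) -` A i))"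
      unfolding gauss_def using pre by (intro emeasure_PiM) auto
    also have "\<dots> = (\<Prod>i<d. emeasure (?D i) (A i))"
      using A' by (intro prod.cong refl) (simp add: emeasure_distr)
    finally show "emeasure (distr (gauss d 1) (euc d) (vadd d b)) (Pi\<^sub>E {..<d} A) = (\<Prod>i<d. emeasure (?D i) (A i))" .
  qed simp
  show ?thesis unfolding dens shift ..
qed

text \<open>AM-GM: \<open>1 \<le> (\<lambda> e\<^sup>Z + e\<^sup>-\<^sup>Z / \<lambda>) / 2\<close> for the log-likelihood ratio \<open>Z\<close> of the shift, with \<open>\<lambda> = 2 E e\<^sup>-\<^sup>Z\<close>.\<close>

lemma gauss_shift_lower_bound:
  assumes B: "B \<in> sets (euc d)" and half: "ennreal (1 / 2) \<le> emeasure (gauss d 1) B"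
  shows "ennreal (exp (- (vnorm d b)\<^sup>2) / 4) \<le> emeasure (gauss d 1) {z \<in> space (euc d). vadd d b z \<in> B}"
proof -
  let ?Z = "\<lambda>z. (\<Sum>i<d. b i * z i) - (\<Sum>i<d. (b i)\<^sup>2) / 2"
  let ?R = "exp ((vnorm d b)\<^sup>2)"
  let ?Q = "emeasure (gauss d 1) {z \<in> space (euc d). vadd d b z \<in> B}"
  interpret prob_space "gauss d 1" by (rule prob_space_gauss) simp
  have n: "(vnorm d b)\<^sup>2 = (\<Sum>i<d. (b i)\<^sup>2)"
    by (simp add: vnorm_def L2_set_def sum_nonneg)
  have shift_meas: "vadd d b \<in> measurable (gauss d 1) (euc d)"
    unfolding vadd_def by (intro measurable_into_euc) auto
  have [measurable]: "?Z \<in> borel_measurable (gauss d 1)" by measurable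
  have Q: "?Q = (\<integral>\<^sup>+z. ennreal (exp (?Z z)) * indicator B z \<partial>gauss d 1)"
  proof -
    have "?Q = emeasure (distr (gauss d 1) (euc d) (vadd d b)) B"
      using B shift_meas by (subst emeasure_distr) (auto intro!: arg_cong[where f = "emeasure _"])
    also have "\<dots> = (\<integral>\<^sup>+z. ennreal (exp (?Z z)) * indicator B z \<partial>gauss d 1)"
      unfolding distr_gauss_shift using B by (intro emeasure_density) auto
    finally show ?thesis .
  qed
  have R: "(\<integral>\<^sup>+z. ennreal (exp (- ?Z z)) \<partial>gauss d 1) = ennreal ?R"
  proof -
    have "(\<integral>\<^sup>+z. ennreal (exp (- ?Z z)) \<partial>gauss d 1) =
        (\<integral>\<^sup>+z. ennreal (exp ((\<Sum>i<d. (b i)\<^sup>2) / 2)) * ennreal (exp (\<Sum>i<d. - b i * z i)) \<partial>gauss d 1)"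
      by (intro nn_integral_cong) (simp add: sum_negf flip: ennreal_mult exp_add)
    also have "\<dots> = ennreal (exp ((\<Sum>i<d. (b i)\<^sup>2) / 2)) * ennreal (exp ((\<Sum>i<d. (- b i)\<^sup>2) / 2))"
      by (subst nn_integral_cmult) (simp_all only: nn_integral_exp_sum_gauss, measurable)
    also have "\<dots> = ennreal ?R" by (simp add: n flip: ennreal_mult exp_add)
    finally show ?thesis .
  qed
  have "ennreal (1 / 2) \<le> (\<integral>\<^sup>+z. indicator B z \<partial>gauss d 1)" using half B by simp
  also have "\<dots> \<le> (\<integral>\<^sup>+z. ennreal ?R * (ennreal (exp (?Z z)) * indicator B z) + ennreal (1 / (4 * ?R)) * ennreal (exp (- ?Z z)) \<partial>gauss d 1)"
  proof (rule nn_integral_mono)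
    fix z
    \<comment> \<open>With a = R exp(Z) and R = E exp(- Z), the claim is a + 1 / (4 a) \<ge> 1, that
      is, (a - 1/2)^2 / a \<ge> 0.\<close>
    have "1 \<le> ?R * exp (?Z z) + 1 / (4 * ?R) * exp (- ?Z z)"
    proof -
      let ?a = "?R * exp (?Z z)"
      have a: "0 < ?a" by simp
      have "0 \<le> (?a - 1 / 2)\<^sup>2 / ?a" using a by (intro divide_nonneg_pos) auto
      also have "\<dots> = ?a - 1 + 1 / (4 * ?a)" using a by (simp add: power2_eq_square field_simps)
      also have "1 / (4 * ?a) = 1 / (4 * ?R) * exp (- ?Z z)" by (simp add: exp_minus field_simps)
      finally show ?thesis by simp
    qed
    then have "1 \<le> ennreal (?R * exp (?Z z) + 1 / (4 * ?R) * exp (- ?Z z))"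
      by (simp only: ennreal_1[symmetric] ennreal_leI)
    also have "\<dots> = ennreal ?R * ennreal (exp (?Z z)) + ennreal (1 / (4 * ?R)) * ennreal (exp (- ?Z z))"
      by (subst ennreal_plus, simp, simp, subst (1 2) ennreal_mult) auto
    finally show "indicator B z \<le> ennreal ?R * (ennreal (exp (?Z z)) * indicator B z) + ennreal (1 / (4 * ?R)) * ennreal (exp (- ?Z z))"
      by (auto simp: indicator_def)
  qed
  \<comment> \<open>The second summand carries no indicator of \<open>B\<close>; it accounts for
    exactly 1/4 of the available 1/2, and the other 1/4 has to come from the shifted
    probability.\<close>
  also have "\<dots> = ennreal ?R * ?Q + ennreal (1 / (4 * ?R)) * ennreal ?R"
    unfolding Q R[symmetric] using B by (simp add: nn_integral_add nn_integral_cmult)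
  also have "ennreal (1 / (4 * ?R)) * ennreal ?R = ennreal (1 / 4)"
    by (simp flip: ennreal_mult)
  finally have "ennreal (1 / 2) \<le> ennreal (?R * measure (gauss d 1) {z \<in> space (euc d). vadd d b z \<in> B} + 1 / 4)"
    by (simp add: emeasure_eq_measure ennreal_mult ennreal_plus del: ennreal_numeral)
  then have "1 / 4 \<le> ?R * measure (gauss d 1) {z \<in> space (euc d). vadd d b z \<in> B}"
    by (subst (asm) ennreal_le_iff) auto
  then show ?thesis
    by (simp add: emeasure_eq_measure exp_minus field_simps)
qed

text \<open>Ville's inequality, by induction on the horizon and conditioning on the first coordinate.\<close>

lemma (in sequence_space) maximal_inequality:
  fixes g :: "'a \<Rightarrow> real"
  assumes [measurable]: "g \<in> borel_measurable M"
    and le_1: "(\<integral>\<^sup>+x. ennreal (exp (g x)) \<partial>M) \<le> 1"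
  shows "emeasure S {z \<in> space S. \<exists>k. a \<le> (\<Sum>j<k. g (z j))} \<le> ennreal (exp (- a))"
proof -
  define U where "U = (\<lambda>n a. {z \<in> space S. \<exists>k\<le>n. a \<le> (\<Sum>j<k. g (z j))})"
  have U_sets [measurable]: "U n a \<in> sets S" for n a
    unfolding U_def by measurable
  have U_le: "emeasure S (U n a) \<le> ennreal (exp (- a))" for n a
  proof (induction n arbitrary: a)
    case 0
    show ?case
    proof (cases "a \<le> 0")
      case True
      then have "ennreal 1 \<le> ennreal (exp (- a))" by (intro ennreal_leI) simp
      then show ?thesis using order_trans[OF P.emeasure_le_1] by simp
    next
      case False
      then have "U 0 a = {}" by (auto simp: U_def)
      then show ?thesis by simp
    qed
  next
    case (Suc n)
    show ?case
    proof (cases "a \<le> 0")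
      case True
      then have "ennreal 1 \<le> ennreal (exp (- a))" by (intro ennreal_leI) simp
      then show ?thesis using order_trans[OF P.emeasure_le_1] by simp
    next
      case False
      \<comment> \<open>As \<open>a > 0\<close>, the empty sum cannot reach the barrier, so the
        crossing index is a successor. Dropping the first coordinate shortens the horizon by one and
        lowers the barrier by \<open>g s\<close>.\<close>
      have first_step: "case_nat s \<omega> \<in> U (Suc n) a \<longleftrightarrow> \<omega> \<in> U n (a - g s)"
        if s: "s \<in> space M" and \<omega>: "\<omega> \<in> space S" for s \<omega>
      proof -
        have sp: "case_nat s \<omega> \<in> space S"
          using s \<omega> by (auto simp: space_PiM PiE_iff split: nat.split)
        have "(\<exists>k\<le>Suc n. a \<le> (\<Sum>j<k. g (case_nat s \<omega> j))) \<longleftrightarrow> (\<exists>k\<le>n. a \<le> (\<Sum>j<Suc k. g (case_nat s \<omega> j)))"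
        proof
          assume "\<exists>k\<le>Suc n. a \<le> (\<Sum>j<k. g (case_nat s \<omega> j))"
          then obtain k where "k \<le> Suc n" "a \<le> (\<Sum>j<k. g (case_nat s \<omega> j))" by blast
          with False show "\<exists>k\<le>n. a \<le> (\<Sum>j<Suc k. g (case_nat s \<omega> j))"
            by (cases k) (simp, metis Suc_le_mono)
        qed (metis Suc_le_mono)
        also have "\<dots> \<longleftrightarrow> (\<exists>k\<le>n. a - g s \<le> (\<Sum>j<k. g (\<omega> j)))"
          unfolding sum.lessThan_Suc_shift by (simp add: algebra_simps)
        finally show ?thesis using sp \<omega> by (simp add: U_def)
      qed
      have "emeasure S (U (Suc n) a) =
          emeasure (distr (M \<Otimes>\<^sub>M S) S (\<lambda>(s, \<omega>). case_nat s \<omega>)) (U (Suc n) a)"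
        by (simp only: PiM_iter)
      also have "\<dots> = (\<integral>\<^sup>+p. indicator (U (Suc n) a) (case_nat (fst p) (snd p)) \<partial>(M \<Otimes>\<^sub>M S))"
        by (subst nn_integral_indicator[symmetric], simp, subst nn_integral_distr) (auto simp: case_prod_beta)
      also have "\<dots> = (\<integral>\<^sup>+s. \<integral>\<^sup>+\<omega>. indicator (U (Suc n) a) (case_nat s \<omega>) \<partial>S \<partial>M)"
        by (subst P.nn_integral_fst[symmetric]) auto
      also have "\<dots> = (\<integral>\<^sup>+s. \<integral>\<^sup>+\<omega>. indicator (U n (a - g s)) \<omega> \<partial>S \<partial>M)"
        by (intro nn_integral_cong) (simp add: indicator_def first_step)
      also have "\<dots> \<le> (\<integral>\<^sup>+s. ennreal (exp (- a)) * ennreal (exp (g s)) \<partial>M)"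
      proof (rule nn_integral_mono)
        fix s
        have "ennreal (exp (- (a - g s))) = ennreal (exp (- a)) * ennreal (exp (g s))"
          by (simp flip: ennreal_mult exp_add)
        then show "(\<integral>\<^sup>+\<omega>. indicator (U n (a - g s)) \<omega> \<partial>S) \<le> ennreal (exp (- a)) * ennreal (exp (g s))"
          using Suc.IH[of "a - g s"] by simp
      qed
      also have "\<dots> \<le> ennreal (exp (- a)) * 1"
        using mult_left_mono[OF le_1, of "ennreal (exp (- a))"] by (simp add: nn_integral_cmult)
      finally show ?thesis by simp
    qed
  qed
  have eq: "{z \<in> space S. \<exists>k. a \<le> (\<Sum>j<k. g (z j))} = (\<Union>n. U n a)"
    by (auto simp: U_def)
  have "incseq (\<lambda>n. U n a)"
    by (auto simp: incseq_def U_def intro: order_trans)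
  then have "(SUP n. emeasure S (U n a)) = emeasure S (\<Union>n. U n a)"
    by (intro SUP_emeasure_incseq) auto
  then show ?thesis unfolding eq by (rule subst) (intro SUP_least U_le)
qed

text \<open>For any coupling (v, x): if v = 0, then v is at distance exactly the norm of x; if v has
  norm at least 2, it is at distance at least 1, which is again at least the norm of x. The
  remaining values of v have probability at most \<open>p\<close>, and there the norm of x is
  bounded by 1. Integrating gives E |x| \<le> cost + p.\<close>

lemma wasserstein1_lower_bound:
  assumes \<mu>: "prob_space \<mu>" "sets \<mu> = sets (euc d)" "AE x in \<mu>. vnorm d x \<le> 1"
    and P: "emeasure P {v \<in> space (euc d). vnorm d v \<noteq> 0 \<and> vnorm d v < 2} \<le> ennreal p" "0 \<le> p"
  shows "ennreal ((\<integral>x. vnorm d x \<partial>\<mu>) - p) \<le> wasserstein1 d P \<mu>"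
  unfolding wasserstein1_def
proof (rule INF_greatest)
  fix \<pi>
  assume "\<pi> \<in> {\<pi>. sets \<pi> = sets (euc d \<Otimes>\<^sub>M euc d) \<and>
    distr \<pi> (euc d) fst = P \<and> distr \<pi> (euc d) snd = \<mu>}"
  then have sets_\<pi>: "sets \<pi> = sets (euc d \<Otimes>\<^sub>M euc d)"
    and P_eq: "P = distr \<pi> (euc d) fst" and \<mu>_eq: "distr \<pi> (euc d) snd = \<mu>" by auto
  note [measurable_cong] = sets_\<pi> \<mu>(2)
  have sp: "space \<pi> = space (euc d) \<times> space (euc d)"
    using sets_eq_imp_space_eq[OF sets_\<pi>] by (simp add: space_pair_measure)
  let ?V = "{v \<in> space (euc d). vnorm d v \<noteq> 0 \<and> vnorm d v < 2}"
  have V [measurable]: "?V \<in> sets (euc d)" by measurable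
  interpret \<mu>: prob_space \<mu> by fact
  have int: "integrable \<mu> (vnorm d)"
    using \<mu>(3) by (intro \<mu>.integrable_const_bound[where B = 1]) auto
  have "AE x in distr \<pi> (euc d) snd. vnorm d x \<le> 1" using \<mu>(3) unfolding \<mu>_eq .
  then have ae: "AE p in \<pi>. vnorm d (snd p) \<le> 1"
    by (subst (asm) AE_distr_iff) auto
  have "ennreal (\<integral>x. vnorm d x \<partial>\<mu>) = (\<integral>\<^sup>+x. ennreal (vnorm d x) \<partial>\<mu>)"
    using int by (intro nn_integral_eq_integral[symmetric]) auto
  also have "\<dots> = (\<integral>\<^sup>+q. ennreal (vnorm d (snd q)) \<partial>\<pi>)"
    unfolding \<mu>_eq[symmetric] by (subst nn_integral_distr) auto
  also have "\<dots> \<le> (\<integral>\<^sup>+q. ennreal (vnorm d (vdiff d (fst q) (snd q))) + indicator ?V (fst q) \<partial>\<pi>)"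
  proof (rule nn_integral_mono_AE)
    have *: "ennreal (vnorm d (snd q)) \<le> ennreal (vnorm d (vdiff d (fst q) (snd q))) + indicator ?V (fst q)"
      if q: "q \<in> space \<pi>" "vnorm d (snd q) \<le> 1" for q
    proof (cases "fst q \<in> ?V")
      case True
      then have "ennreal (vnorm d (snd q)) \<le> 1" using q by simp
      also have "\<dots> \<le> ennreal (vnorm d (vdiff d (fst q) (snd q))) + indicator ?V (fst q)" using True by simp
      finally show ?thesis .
    next
      case False
      moreover have "fst q \<in> space (euc d)" using q(1) by (simp add: sp mem_Times_iff)
      ultimately have "vnorm d (fst q) = 0 \<or> 2 \<le> vnorm d (fst q)" by (simp add: not_less)
      moreover have "vnorm d (snd q) \<le> vnorm d (vdiff d (fst q) (snd q)) + vnorm d (fst q)"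
        using vnorm_le_vdiff[of d "snd q" "fst q"] vnorm_vdiff_commute[of d "snd q" "fst q"] by simp
      moreover have "vnorm d (fst q) \<le> vnorm d (vdiff d (fst q) (snd q)) + vnorm d (snd q)"
        by (rule vnorm_le_vdiff)
      ultimately have "vnorm d (snd q) \<le> vnorm d (vdiff d (fst q) (snd q))" using q(2) by linarith
      then have "ennreal (vnorm d (snd q)) \<le> ennreal (vnorm d (vdiff d (fst q) (snd q)))"
        by (rule ennreal_leI)
      then show ?thesis by (rule add_increasing2[rotated]) simp
    qed
    show "AE q in \<pi>. ennreal (vnorm d (snd q)) \<le> ennreal (vnorm d (vdiff d (fst q) (snd q))) + indicator ?V (fst q)"
      using ae AE_space by eventually_elim (rule *)
  qed
  also have "\<dots> = (\<integral>\<^sup>+q. ennreal (vnorm d (vdiff d (fst q) (snd q))) \<partial>\<pi>) + (\<integral>\<^sup>+q. indicator ?V (fst q) \<partial>\<pi>)"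
    by (intro nn_integral_add) auto
  also have "(\<integral>\<^sup>+q. indicator ?V (fst q) \<partial>\<pi>) = emeasure P ?V"
    unfolding P_eq by (subst nn_integral_indicator[symmetric], simp, subst nn_integral_distr) auto
  also have "(\<integral>\<^sup>+q. ennreal (vnorm d (vdiff d (fst q) (snd q))) \<partial>\<pi>) + emeasure P ?V \<le>
      (\<integral>\<^sup>+q. ennreal (vnorm d (vdiff d (fst q) (snd q))) \<partial>\<pi>) + ennreal p"
    using P by (intro add_left_mono)
  finally show "ennreal ((\<integral>x. vnorm d x \<partial>\<mu>) - p) \<le> (\<integral>\<^sup>+q. ennreal (vnorm d (vdiff d (fst q) (snd q))) \<partial>\<pi>)"
    using P(2) by (simp add: ennreal_minus[symmetric] ennreal_minus_le_iff add.commute)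
qed

section \<open>The observation process\<close>

lemma (in prob_space) distr_pair_snd_eq:
  assumes "sigma_finite_measure (distr N T g)" and [measurable]: "g \<in> measurable N T"
  shows "distr (M \<Otimes>\<^sub>M N) (M \<Otimes>\<^sub>M T) (\<lambda>p. (fst p, g (snd p))) = M \<Otimes>\<^sub>M distr N T g"
  using pair_measure_distr[of "\<lambda>x. x" M M g N T] assms
  by (simp add: distr_id2 case_prod_unfold)

text \<open>For each fixed t > 0 this has the law of the observation at time t when \<open>p\<close>
  has law \<open>\<mu>\<close> times standard Gaussian. One Gaussian vector serves all times, so the
  joint law differs from that of the process, but the expression is jointly measurable in
  \<open>p\<close> and \<open>t\<close>; the error integrals see only one-time marginals.\<close>

definition noisy :: "nat \<Rightarrow> (nat \<Rightarrow> real) \<times> (nat \<Rightarrow> real) \<Rightarrow> real \<Rightarrow> nat \<Rightarrow> real" where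
  "noisy d p t = vadd d (vscale d t (fst p)) (vscale d (sqrt t) (snd p))"

locale observed_signal =
  fixes d :: nat and \<mu> :: "(nat \<Rightarrow> real) measure" and M :: "'w measure"
    and X :: "'w \<Rightarrow> nat \<Rightarrow> real" and W :: "real \<Rightarrow> 'w \<Rightarrow> nat \<Rightarrow> real"
  assumes process: "signal_and_bm d \<mu> M X W"
    and prob_\<mu>: "prob_space \<mu>" and sets_\<mu> [measurable_cong]: "sets \<mu> = sets (euc d)"
begin

sublocale prob_space M
  using process by (simp add: signal_and_bm_def brownian_motion_def)

lemma measurable_W [measurable]: "0 \<le> t \<Longrightarrow> W t \<in> measurable M (euc d)"
  using process by (simp add: signal_and_bm_def brownian_motion_def)

lemma measurable_X [measurable]: "X \<in> measurable M (euc d)"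
  using process by (simp add: signal_and_bm_def)

lemma AE_W_0: "AE \<omega> in M. W 0 \<omega> = vzero d"
  using process by (auto simp: signal_and_bm_def brownian_motion_def)

lemma law_increment: "0 \<le> s \<Longrightarrow> s < t \<Longrightarrow> distr M (euc d) (\<lambda>\<omega>. vdiff d (W t \<omega>) (W s \<omega>)) = gauss d (t - s)"
  using process by (auto simp: signal_and_bm_def brownian_motion_def)

lemma measurable_observation [measurable]: "0 \<le> t \<Longrightarrow> observation d X W t \<in> measurable M (euc d)"
  unfolding observation_def by measurable

lemma vdiff_vzero: "x \<in> space (euc d) \<Longrightarrow> vdiff d x (vzero d) = x"
  by (auto simp: vdiff_def vzero_def space_euc fun_eq_iff PiE_def extensional_def)

lemma law_W:
  assumes "0 < t"
  shows "distr M (euc d) (W t) = gauss d t"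
proof -
  have "distr M (euc d) (W t) = distr M (euc d) (\<lambda>\<omega>. vdiff d (W t \<omega>) (W 0 \<omega>))"
  proof (rule distr_cong_AE)
    show "AE \<omega> in M. W t \<omega> = vdiff d (W t \<omega>) (W 0 \<omega>)"
      using AE_W_0 AE_space
    proof eventually_elim
      case (elim \<omega>)
      then show ?case using measurable_space[OF measurable_W[of t], of \<omega>] assms by (simp add: vdiff_vzero)
    qed
  qed (use assms in auto)
  also have "\<dots> = gauss d t" using law_increment[of 0 t] assms by simp
  finally show ?thesis .
qed

text \<open>Independence is given on the path space; evaluation at \<open>t\<close> is a measurable
  map there, and pushing forward the second factor alone keeps the product.\<close>

lemma law_X_W:
  assumes t: "0 < t"
  shows "distr M (euc d \<Otimes>\<^sub>M euc d) (\<lambda>\<omega>. (X \<omega>, W t \<omega>)) = \<mu> \<Otimes>\<^sub>M gauss d t"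
proof -
  interpret \<mu>: prob_space \<mu> by (rule prob_\<mu>)
  let ?P = "\<Pi>\<^sub>M t\<in>{0::real..}. euc d" and ?w = "\<lambda>\<omega>. \<lambda>t\<in>{0..}. W t \<omega>"
  have [measurable]: "?w \<in> measurable M ?P" by (intro measurable_restrict) auto
  have [measurable]: "(\<lambda>w. w t) \<in> measurable ?P (euc d)" using t by (intro measurable_component_singleton) auto
  have W_t: "distr (distr M ?P ?w) (euc d) (\<lambda>w. w t) = gauss d t"
    using t by (subst distr_distr) (auto simp: comp_def law_W cong: distr_cong)
  have "distr M (euc d \<Otimes>\<^sub>M euc d) (\<lambda>\<omega>. (X \<omega>, W t \<omega>)) =
      distr (distr M (euc d \<Otimes>\<^sub>M ?P) (\<lambda>\<omega>. (X \<omega>, ?w \<omega>))) (euc d \<Otimes>\<^sub>M euc d) (\<lambda>p. (fst p, snd p t))"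
    using t by (subst distr_distr) (auto simp: comp_def)
  also have "\<dots> = distr (\<mu> \<Otimes>\<^sub>M distr M ?P ?w) (\<mu> \<Otimes>\<^sub>M euc d) (\<lambda>p. (fst p, snd p t))"
    using process unfolding signal_and_bm_def by (auto intro!: distr_cong sets_pair_measure_cong simp: sets_\<mu>)
  also have "\<dots> = \<mu> \<Otimes>\<^sub>M distr (distr M ?P ?w) (euc d) (\<lambda>w. w t)"
    using t by (intro \<mu>.distr_pair_snd_eq) (auto simp: W_t intro!: prob_space_imp_sigma_finite prob_space_gauss)
  finally show ?thesis unfolding W_t .
qed

lemma measurable_noisy [measurable (raw)]:
  assumes [measurable]: "f \<in> measurable N (euc d \<Otimes>\<^sub>M euc d)" "g \<in> borel_measurable N"
  shows "(\<lambda>x. noisy d (f x) (g x)) \<in> measurable N (euc d)"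
  unfolding noisy_def by measurable

lemma law_observation:
  assumes t: "0 < t"
  shows "distr M (euc d) (observation d X W t) = distr (\<mu> \<Otimes>\<^sub>M gauss d 1) (euc d) (\<lambda>p. noisy d p t)"
proof -
  interpret \<mu>: prob_space \<mu> by (rule prob_\<mu>)
  have [measurable]: "(\<lambda>z. vscale d (sqrt t) z) \<in> measurable (gauss d 1) (euc d)" by measurable
  have "distr M (euc d) (observation d X W t) =
      distr (distr M (euc d \<Otimes>\<^sub>M euc d) (\<lambda>\<omega>. (X \<omega>, W t \<omega>))) (euc d) (\<lambda>p. vadd d (vscale d t (fst p)) (snd p))"
    using t by (subst distr_distr) (auto simp: comp_def observation_def[abs_def])
  also have "\<dots> = distr (\<mu> \<Otimes>\<^sub>M gauss d t) (euc d) (\<lambda>p. vadd d (vscale d t (fst p)) (snd p))"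
    by (simp only: law_X_W[OF t])
  also have "\<mu> \<Otimes>\<^sub>M gauss d t = distr (\<mu> \<Otimes>\<^sub>M gauss d 1) (\<mu> \<Otimes>\<^sub>M euc d) (\<lambda>p. (fst p, vscale d (sqrt t) (snd p)))"
    using t by (subst \<mu>.distr_pair_snd_eq)
      (auto simp: distr_gauss_scale intro!: prob_space_imp_sigma_finite prob_space_gauss)
  also have "distr \<dots> (euc d) (\<lambda>p. vadd d (vscale d t (fst p)) (snd p)) =
      distr (\<mu> \<Otimes>\<^sub>M gauss d 1) (euc d) (\<lambda>p. noisy d p t)"
    by (subst distr_distr) (auto simp: comp_def noisy_def)
  finally show ?thesis .
qed

lemma prob_observation:
  assumes t: "0 < t" and [measurable]: "{y \<in> space (euc d). Q y} \<in> sets (euc d)"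
  shows "emeasure M {\<omega> \<in> space M. Q (observation d X W t \<omega>)} =
    emeasure (\<mu> \<Otimes>\<^sub>M gauss d 1) {p \<in> space (euc d \<Otimes>\<^sub>M euc d). Q (noisy d p t)}"
proof -
  let ?B = "{y \<in> space (euc d). Q y}"
  have sp: "space (\<mu> \<Otimes>\<^sub>M gauss d 1) = space (euc d \<Otimes>\<^sub>M euc d)"
    by (simp add: space_pair_measure sets_eq_imp_space_eq[OF sets_\<mu>])
  have "emeasure M {\<omega> \<in> space M. Q (observation d X W t \<omega>)} = emeasure (distr M (euc d) (observation d X W t)) ?B"
    using t by (subst emeasure_distr) (auto simp: observation_def intro!: arg_cong[where f = "emeasure M"])
  also have "\<dots> = emeasure (\<mu> \<Otimes>\<^sub>M gauss d 1) {p \<in> space (euc d \<Otimes>\<^sub>M euc d). Q (noisy d p t)}"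
    unfolding law_observation[OF t]
    by (subst emeasure_distr) (auto simp: sp noisy_def intro!: arg_cong[where f = "emeasure _"])
  finally show ?thesis .
qed

text \<open>Splitting an integral over \<open>t\<close> requires a measurable integrand, while the
  definition of Brownian motion only speaks of measurability in \<omega> for each fixed time. For t
  > 0 the probability depends on the marginal law alone, so it can be computed with
  \<open>noisy\<close>, where Fubini yields measurability in \<open>t\<close>.\<close>

lemma prob_observation_measurable:
  assumes S: "S \<in> sets (euc d \<Otimes>\<^sub>M restrict_space borel {0..})"
  obtains h :: "real \<Rightarrow> ennreal" where "h \<in> borel_measurable borel"
    "\<And>t. 0 < t \<Longrightarrow> emeasure M {\<omega> \<in> space M. (observation d X W t \<omega>, t) \<in> S} = h t"
proof
  interpret \<mu>: prob_space \<mu> by (rule prob_\<mu>)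
  interpret G: prob_space "gauss d 1" by (rule prob_space_gauss) simp
  interpret P: pair_prob_space \<mu> "gauss d 1" ..
  \<comment> \<open>The maximum keeps the time inside the domain {0..} of drifts and tests for every
    real argument.\<close>
  let ?f = "\<lambda>q. (noisy d (snd q) (fst q), max 0 (fst q) :: real)"
  let ?N = "\<mu> \<Otimes>\<^sub>M gauss d 1"
  define h where "h t = (\<integral>\<^sup>+p. indicator S (?f (t, p)) \<partial>?N)" for t
  have "(\<lambda>q::real \<times> _ \<times> _. max 0 (fst q)) \<in> measurable (borel \<Otimes>\<^sub>M ?N) (restrict_space borel {0..})"
    by (intro measurable_restrict_space2) auto
  then have [measurable]: "?f \<in> measurable (borel \<Otimes>\<^sub>M ?N) (euc d \<Otimes>\<^sub>M restrict_space borel {0..})"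
    by (intro measurable_Pair) auto
  have [measurable]: "indicator S \<in> borel_measurable (euc d \<Otimes>\<^sub>M restrict_space borel {0..})"
    using S by auto
  show "h \<in> borel_measurable borel"
    unfolding h_def by measurable
  show "emeasure M {\<omega> \<in> space M. (observation d X W t \<omega>, t) \<in> S} = h t" if t: "0 < t" for t
  proof -
    have sp: "space ?N = space (euc d \<Otimes>\<^sub>M euc d)"
      by (simp add: space_pair_measure sets_eq_imp_space_eq[OF sets_\<mu>])
    have "(\<lambda>y. (y, t)) \<in> measurable (euc d) (euc d \<Otimes>\<^sub>M restrict_space borel {0..})"
      using t by (intro measurable_Pair) (auto simp: space_restrict_space)
    then have B [measurable]: "{y \<in> space (euc d). (y, t) \<in> S} \<in> sets (euc d)"
      using measurable_sets[OF _ S] by (simp add: vimage_def Int_def conj_commute)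
    have "emeasure M {\<omega> \<in> space M. (observation d X W t \<omega>, t) \<in> S} = emeasure ?N {p \<in> space (euc d \<Otimes>\<^sub>M euc d). (noisy d p t, t) \<in> S}"
      by (rule prob_observation[OF t B])
    also have "\<dots> = (\<integral>\<^sup>+p. indicator {p \<in> space (euc d \<Otimes>\<^sub>M euc d). (noisy d p t, t) \<in> S} p \<partial>?N)"
    proof (rule nn_integral_indicator[symmetric])
      have "(\<lambda>p. noisy d p t) \<in> measurable ?N (euc d)" by measurable
      from measurable_sets[OF this B] show "{p \<in> space (euc d \<Otimes>\<^sub>M euc d). (noisy d p t, t) \<in> S} \<in> sets ?N"
        by (simp add: sp vimage_def Int_def conj_commute noisy_def)
    qed
    also have "\<dots> = h t"
      unfolding h_def using t by (intro nn_integral_cong) (simp add: indicator_def sp max_def)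
    finally show ?thesis .
  qed
qed

end

section \<open>The discretized diffusion\<close>

definition noise :: "nat \<Rightarrow> real \<Rightarrow> (nat \<Rightarrow> nat \<Rightarrow> real) \<Rightarrow> nat \<Rightarrow> nat \<Rightarrow> real" where
  "noise d \<Delta> z k = (\<lambda>i\<in>{..<d}. \<Sum>j<k. sqrt \<Delta> * z j i)"

lemma noise_space [simp]: "noise d \<Delta> z k \<in> space (euc d)"
  by (simp add: noise_def space_euc)

lemma vnorm_single:
  assumes "0 < d" "0 \<le> N"
  shows "vnorm d (\<lambda>i\<in>{..<d}. if i = 0 then N else 0) = N"
proof -
  have "(\<Sum>i<d. ((\<lambda>i\<in>{..<d}. if i = 0 then N else 0) i)\<^sup>2) = (\<Sum>i<d. if i = 0 then N\<^sup>2 else 0)"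
    by (intro sum.cong) auto
  also have "\<dots> = N\<^sup>2" using assms by simp
  finally show ?thesis using assms by (simp add: vnorm_def L2_set_def)
qed

lemma sum_square_ge_iff: "0 < e \<Longrightarrow> \<not> e\<^sup>2 \<le> (\<Sum>i<d. (v i)\<^sup>2) \<longleftrightarrow> vnorm d v < e"
  using real_less_rsqrt[of e] real_sqrt_less_iff[of "\<Sum>i<d. (v i)\<^sup>2" "e\<^sup>2"]
  by (simp add: vnorm_def L2_set_def not_le)

lemma vnorm_modified_drift:
  assumes "0 < d" "0 \<le> N"
  shows "vnorm d (modified_drift N L \<kappa> \<gamma> \<epsilon> ta \<delta> m0 \<phi> d y t) =
    (if escapes \<kappa> L ta y t then N else if keeps d \<gamma> \<epsilon> ta \<delta> (m0 y t) (\<phi> y t) t then vnorm d (m0 y t) else 0)"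
proof -
  have "vnorm d (\<lambda>i\<in>{..<d}. m0 y t i) = vnorm d (m0 y t)" "vnorm d (\<lambda>i\<in>{..<d}. 0) = 0"
    using vnorm_vzero[of d] by (auto intro: vnorm_cong simp: vzero_def)
  then show ?thesis
    using vnorm_single[OF assms] by (simp add: modified_drift_def)
qed

lemma discretized_space [simp]: "discretized d m \<Delta> z k \<in> space (euc d)"
  by (cases k) auto

text \<open>Purely deterministic: randomness enters only through the two hypotheses
  \<open>fluctuation\<close> and \<open>null\<close> on the given noise sequence. The difference D =
  y - S is the accumulated drift. If \<Delta> \<ge> \<kappa> t_alg the process stays in the escape
  region and the drift has norm N; otherwise D remains within c t_alg, which makes the test reject
  and the drift vanish.\<close>

lemma modified_drift_dynamics:
  fixes c ta \<delta> \<Delta> :: real and d :: nat and m0 :: drift and \<phi> :: "(nat \<Rightarrow> real) \<Rightarrow> real \<Rightarrow> real"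
    and z :: "nat \<Rightarrow> nat \<Rightarrow> real"
  defines "N \<equiv> 64 / c" and "\<kappa> \<equiv> c\<^sup>2 / 256"
  defines "m \<equiv> modified_drift N (48 / c) \<kappa> (c / 8) (c / 8) ta \<delta> m0 \<phi> d"
  defines "T \<equiv> ta * (1 + \<delta>)"
  defines "y \<equiv> discretized d m \<Delta> z" and "S \<equiv> noise d \<Delta> z"
  assumes c: "0 < c" "c < 1" and ta: "0 < ta" and \<delta>: "\<bar>\<delta>\<bar> \<le> c / 8" and \<Delta>: "0 < \<Delta>" and d: "0 < d"
    and m0: "\<And>y t. y \<in> space (euc d) \<Longrightarrow> 0 \<le> t \<Longrightarrow> vnorm d (m0 y t) \<le> 1"
    and \<phi>: "\<And>y t. y \<in> space (euc d) \<Longrightarrow> 0 \<le> t \<Longrightarrow> \<phi> y t \<in> {0, 1}"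
    and fluctuation: "\<And>k. \<kappa> * ta \<le> real k * \<Delta> \<Longrightarrow> \<bar>S k 0\<bar> < (16 / c - 2) * (real k * \<Delta>)"
    and null: "\<And>k. T \<le> real k * \<Delta> \<Longrightarrow> vnorm d (vdiff d (y k) (S k)) \<le> c * ta \<Longrightarrow> \<phi> (y k) (real k * \<Delta>) \<noteq> 1"
    and k: "T \<le> real k * \<Delta>"
  shows "vnorm d (m (y k) (real k * \<Delta>)) = 0 \<or> 2 \<le> vnorm d (m (y k) (real k * \<Delta>))"
proof -
  define D where "D k = vdiff d (y k) (S k)" for k
  have N: "64 < N" "N * c = 64" "48 / c = 3 * N / 4" "16 / c = N / 4" using c by (simp_all add: N_def field_simps)
  have \<kappa>: "\<kappa> * N = c / 4" "0 < \<kappa>" "\<kappa> \<le> c / 256"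
    using c by (simp_all add: \<kappa>_def N_def power2_eq_square field_simps mult_left_le)
  have esc: "escapes \<kappa> (48 / c) ta (y k) t \<Longrightarrow> m (y k) t = (\<lambda>i\<in>{..<d}. if i = 0 then N else 0)" for k t
    by (simp add: m_def modified_drift_def)
  have vnorm_m: "vnorm d (m (y k) t) = (if escapes \<kappa> (48 / c) ta (y k) t then N
      else if keeps d (c / 8) (c / 8) ta \<delta> (m0 (y k) t) (\<phi> (y k) t) t then vnorm d (m0 (y k) t) else 0)" for k t
    unfolding m_def using d N(1) by (intro vnorm_modified_drift) auto
  have y0: "y k 0 = D k 0 + S k 0" for k using d by (simp add: D_def vdiff_def)
  have D_0: "D 0 i = 0" if "i < d" for i
    using that by (simp add: D_def vdiff_def y_def S_def noise_def vzero_def)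
  have D_Suc: "D (Suc k) i = D k i + \<Delta> * m (y k) (real k * \<Delta>) i" if "i < d" for k i
    using that by (simp add: D_def vdiff_def y_def S_def noise_def vadd_def vscale_def)
  have D_le: "vnorm d (D (Suc k)) \<le> vnorm d (D k) + \<Delta> * vnorm d (m (y k) (real k * \<Delta>))" for k
  proof -
    have "vnorm d (D (Suc k)) = vnorm d (vadd d (D k) (vscale d \<Delta> (m (y k) (real k * \<Delta>))))"
      by (rule vnorm_cong) (simp add: D_Suc vadd_def vscale_def)
    then show ?thesis using vnorm_vadd_le[of d "D k"] \<Delta> by (metis vnorm_vscale abs_of_pos)
  qed
  show ?thesis
  proof (cases "\<kappa> * ta \<le> \<Delta>")
    case True
    \<comment> \<open>If D has first coordinate N t, then noise below (N/4 - 2) t leaves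
      \<open>y 0\<close> above (3N/4) t = L t. At k = 0 escape holds because the time is 0.\<close>
    have escape: "escapes \<kappa> (48 / c) ta (y k) (real k * \<Delta>)" if Dk: "D k 0 = N * (real k * \<Delta>)" for k
    proof (cases "k = 0")
      case False
      then have "\<Delta> \<le> real k * \<Delta>" using \<Delta> by (simp add: mult_le_cancel_right)
      with True have "\<kappa> * ta \<le> real k * \<Delta>" by simp
      moreover have "- S k 0 < (N / 4 - 2) * (real k * \<Delta>)"
        using fluctuation[OF \<open>\<kappa> * ta \<le> real k * \<Delta>\<close>] unfolding N(4) by linarith
      then have "48 / c * (real k * \<Delta>) \<le> y k 0"
        unfolding N(3) y0 Dk using \<open>\<Delta> \<le> real k * \<Delta>\<close> \<Delta> by (simp only: left_diff_distrib)
      ultimately show ?thesis by (simp add: escapes_def)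
    qed (simp add: escapes_def)
    have "D k 0 = N * (real k * \<Delta>)" for k
    proof (induction k)
      case (Suc k)
      then show ?case using D_Suc[OF d, of k] esc[OF escape] d by (simp add: algebra_simps)
    qed (use D_0[OF d] in simp)
    then have "vnorm d (m (y k) (real k * \<Delta>)) = N" using vnorm_m escape by simp
    then show ?thesis using N by simp
  next
    case False
    \<comment> \<open>A budget for the drift after the kick: rate c/8 from the truncation, plus rate
      1 once the window has begun. It is frozen at T + \<Delta> and not at T, because a step begun
      before T may end up to \<Delta> later.\<close>
    define B where "B s = c / 8 * min s (T + \<Delta>) + max 0 (min s (T + \<Delta>) - (1 - c / 8) * ta)" for s
    have T: "(1 - c / 8) * ta \<le> T" "T \<le> (1 + c / 8) * ta" "0 < (1 - c / 8) * ta"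
      using ta \<delta> c by (auto simp: T_def abs_le_iff intro!: mult_left_mono simp: mult.commute[of ta])
    have mono_B: "B s \<le> B s'" if "s \<le> s'" for s s'
      unfolding B_def using c that by (intro add_mono mult_left_mono) auto
    \<comment> \<open>The invariant starts at k = 1, since the state at time 0 does escape; the kick
      accounts for the term N \<Delta>.\<close>
    have bound: "vnorm d (D k) \<le> N * \<Delta> + B (real k * \<Delta>) \<and>
        \<not> escapes \<kappa> (48 / c) ta (y k) (real k * \<Delta>) \<and> (T \<le> real k * \<Delta> \<longrightarrow> vnorm d (m (y k) (real k * \<Delta>)) = 0)"
      if "1 \<le> k" for k
      using that
    proof (induction k)
      case (Suc k)
      let ?t = "real k * \<Delta>" and ?t' = "real (Suc k) * \<Delta>"
      have t': "?t' = ?t + \<Delta>" by (simp add: algebra_simps)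
      have t: "0 \<le> ?t" using \<Delta> by simp
      have le: "vnorm d (D (Suc k)) \<le> N * \<Delta> + B ?t'"
      proof (cases "k = 0")
        case True
        have "vnorm d (D k) = vnorm d (vzero d)" unfolding True
          by (rule vnorm_cong) (simp add: D_0 vzero_def)
        moreover have "vnorm d (m (y k) ?t) = N" unfolding vnorm_m by (simp add: True escapes_def)
        moreover have "0 \<le> B ?t'" unfolding B_def using c \<Delta> T by (intro add_nonneg_nonneg mult_nonneg_nonneg) auto
        ultimately show ?thesis using D_le[of k] by (simp add: mult.commute)
      next
        case False
        then have IH: "vnorm d (D k) \<le> N * \<Delta> + B ?t" "\<not> escapes \<kappa> (48 / c) ta (y k) ?t"
          "T \<le> ?t \<Longrightarrow> vnorm d (m (y k) ?t) = 0" using Suc by auto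
        have "\<Delta> * vnorm d (m (y k) ?t) \<le> B ?t' - B ?t"
        proof (cases "?t < T")
          case True
          then have B: "B ?t = c / 8 * ?t + max 0 (?t - (1 - c / 8) * ta)"
            "B ?t' = c / 8 * (?t + \<Delta>) + max 0 (?t + \<Delta> - (1 - c / 8) * ta)"
            unfolding B_def t' using \<Delta> by (simp_all add: min_def)
          show ?thesis
          proof (cases "(1 - c / 8) * ta \<le> ?t")
            case True
            have "vnorm d (m (y k) ?t) \<le> 1"
              unfolding vnorm_m using IH(2) m0[of "y k" ?t] t by (simp add: y_def)
            then have "\<Delta> * vnorm d (m (y k) ?t) \<le> \<Delta>" using \<Delta> by (simp add: mult_left_le)
            also have "\<Delta> \<le> B ?t' - B ?t"
              unfolding B using True \<Delta> c by (simp add: algebra_simps)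
            finally show ?thesis .
          next
            case False
            have "vnorm d (m (y k) ?t) \<le> c / 8"
              unfolding vnorm_m using IH(2) False c sum_square_ge_iff[where e = "c / 8" and d = d and v = "m0 (y k) ?t"]
              by (simp add: keeps_def)
            then have "\<Delta> * vnorm d (m (y k) ?t) \<le> \<Delta> * (c / 8)" using \<Delta> by (intro mult_left_mono) auto
            also have "\<dots> \<le> B ?t' - B ?t"
            proof -
              have "max 0 (?t - (1 - c / 8) * ta) \<le> max 0 (?t + \<Delta> - (1 - c / 8) * ta)"
                using \<Delta> by (intro max.mono) auto
              moreover have "c / 8 * (?t + \<Delta>) = c / 8 * ?t + \<Delta> * (c / 8)" by (simp add: distrib_left)
              ultimately show ?thesis unfolding B by linarith
            qed
            finally show ?thesis .
          qed
        next
          case False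
          \<comment> \<open>From T on the drift is zero, so D stands still.\<close>
          then show ?thesis using IH(3) mono_B[of ?t ?t'] \<Delta> t' by simp
        qed
        then show ?thesis using D_le[of k] IH(1) by linarith
      qed
      have no_escape: "\<not> escapes \<kappa> (48 / c) ta (y (Suc k)) ?t'"
      proof
        assume e: "escapes \<kappa> (48 / c) ta (y (Suc k)) ?t'"
        have pos: "0 < ?t'" using \<Delta> by simp
        with e have e: "\<kappa> * ta \<le> ?t'" "48 / c * ?t' \<le> y (Suc k) 0" by (auto simp: escapes_def)
        \<comment> \<open>The region only starts at \<kappa> t_alg, beyond the first grid time
          \<Delta>. An escape would thus need t' \<ge> 2 \<Delta>, where the kick amounts to at most
          (N/2) t'. With 2 t' from the budget and less than (N/4 - 2) t' from the noise,
          \<open>y 0\<close> stays below (3N/4) t'.\<close>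
        then have "k \<noteq> 0" using False by (cases k) auto
        then have "1 * \<Delta> \<le> real k * \<Delta>" using \<Delta> by (intro mult_right_mono) auto
        then have "2 * \<Delta> \<le> ?t'" unfolding t' by simp
        then have "N * (2 * \<Delta>) \<le> N * ?t'" using N by (intro mult_left_mono) auto
        moreover have "B ?t' \<le> 2 * ?t'"
        proof -
          have "c / 8 * min ?t' (T + \<Delta>) \<le> 1 * ?t'"
            using c pos T \<Delta> by (intro mult_mono) auto
          moreover have "max 0 (min ?t' (T + \<Delta>) - (1 - c / 8) * ta) \<le> ?t'"
            using T pos by auto
          ultimately show ?thesis unfolding B_def by linarith
        qed
        moreover have "\<bar>S (Suc k) 0\<bar> < (N / 4 - 2) * ?t'" using fluctuation[OF e(1)] unfolding N .
        moreover have "D (Suc k) 0 \<le> vnorm d (D (Suc k))" using component_le_vnorm[OF d, of "D (Suc k)"] by linarith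
        moreover have "3 * N / 4 * ?t' \<le> D (Suc k) 0 + S (Suc k) 0" using e(2) unfolding N y0 .
        ultimately show False using le by (simp add: left_diff_distrib abs_less_iff)
      qed
      have "vnorm d (m (y (Suc k)) ?t') = 0" if T': "T \<le> ?t'"
      proof -
        have eqs: "(1 - c / 8) * ta = ta - c * ta / 8" "(1 + c / 8) * ta = ta + c * ta / 8"
          "c / 8 * (2 * ta) = c * ta / 4" "c / 4 * ta = c * ta / 4" "c / 256 * ta = c * ta / 256"
          by (simp_all add: algebra_simps)
        have "B ?t' \<le> c / 8 * (T + \<Delta>) + (T + \<Delta> - (1 - c / 8) * ta)"
          unfolding B_def using c T \<Delta> by (intro add_mono mult_left_mono) auto
        moreover have "\<Delta> \<le> c / 256 * ta"
          using False \<kappa>(3) ta by (meson le_less_trans less_imp_le mult_right_mono not_le order_trans)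
        moreover have "N * \<Delta> \<le> c / 4 * ta"
          using False N by (simp add: \<kappa>(1)[symmetric] mult.assoc mult.left_commute mult_left_mono)
        moreover have "c / 8 * (T + \<Delta>) \<le> c / 8 * (2 * ta)"
        proof -
          have "c * ta \<le> 1 * ta" using c ta by (intro mult_right_mono) simp_all
          moreover have "(1 + c / 8) * ta = ta + c * ta / 8" by (simp add: distrib_right)
          ultimately have "T + \<Delta> \<le> 2 * ta" using ta T(2) \<open>\<Delta> \<le> c / 256 * ta\<close> by linarith
          then show ?thesis using c by (intro mult_left_mono) auto
        qed
        moreover have "0 < c * ta" using c ta by simp
        \<comment> \<open>The four contributions are c/4 each from the kick, the truncated drift and
          the window, and c/256 for the overshoot by one step, all times t_alg; the total is less
          than c t_alg.\<close>
        ultimately have "vnorm d (D (Suc k)) \<le> c * ta"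
          using le T(2) unfolding eqs by linarith
        then have "\<phi> (y (Suc k)) ?t' \<noteq> 1" using null[OF T'] by (simp add: D_def)
        moreover have "\<phi> (y (Suc k)) ?t' \<in> {0, 1}" using \<Delta> by (intro \<phi>) (simp_all add: y_def)
        ultimately show ?thesis
          unfolding vnorm_m using no_escape T T' by (simp add: keeps_def T_def)
      qed
      with le no_escape show ?case by blast
    qed simp
    have "1 \<le> k" using k T by (cases k) auto
    with bound k show ?thesis by blast
  qed
qed

section \<open>Gaussian sequences realized along the Brownian path\<close>

context observed_signal
begin

definition increments :: "real \<Rightarrow> 'w \<Rightarrow> nat \<Rightarrow> nat \<Rightarrow> real" where
  "increments \<Delta> \<omega> j = vscale d (1 / sqrt \<Delta>) (vdiff d (W (real (Suc j) * \<Delta>) \<omega>) (W (real j * \<Delta>) \<omega>))"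

text \<open>Normalized increments on the grid are i.i.d. standard Gaussian vectors, so the
  discretized diffusion can be run on the space of the Brownian motion without changing its
  law.\<close>

lemma law_increments:
  assumes \<Delta>: "0 < \<Delta>"
  shows "increments \<Delta> \<in> measurable M (\<Pi>\<^sub>M j\<in>UNIV. gauss d 1)"
    and "distr M (\<Pi>\<^sub>M j\<in>UNIV. gauss d 1) (increments \<Delta>) = (\<Pi>\<^sub>M j\<in>(UNIV::nat set). gauss d 1)"
proof -
  let ?D = "\<lambda>j \<omega>. vdiff d (W (real (Suc j) * \<Delta>) \<omega>) (W (real j * \<Delta>) \<omega>)"
  have D [measurable]: "?D j \<in> measurable M (euc d)" for j
    using \<Delta> by (intro measurable_vdiff measurable_W) auto
  have Z [measurable]: "(\<lambda>\<omega>. increments \<Delta> \<omega> j) \<in> measurable M (euc d)" for j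
    unfolding increments_def by (rule measurable_vscale[OF measurable_const D]) simp
  have mono: "0 \<le> real 0 * \<Delta> \<and> mono (\<lambda>k. real k * \<Delta>)"
    using \<Delta> by (simp add: mono_def mult_right_mono)
  have ind: "indep_vars (\<lambda>_. euc d) ?D {..<n}" for n
  proof -
    have "\<forall>(\<tau>::nat \<Rightarrow> real) n. 0 \<le> \<tau> 0 \<and> mono \<tau> \<longrightarrow>
        indep_vars (\<lambda>_. euc d) (\<lambda>k \<omega>. vdiff d (W (\<tau> (Suc k)) \<omega>) (W (\<tau> k) \<omega>)) {..<n}"
      using process unfolding signal_and_bm_def brownian_motion_def by (elim conjE)
    from this[THEN spec, THEN spec, THEN mp, OF mono] show ?thesis .
  qed
  have "indep_vars (\<lambda>_. euc d) ?D UNIV"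
    unfolding indep_vars_def2
  proof (intro conjI ballI)
    show "random_variable (euc d) (?D j)" for j by (rule D)
    show "indep_sets (\<lambda>i. {?D i -` A \<inter> space M |A. A \<in> sets (euc d)}) UNIV"
    \<comment> \<open>Independence of an infinite family concerns finite subfamilies only, and each
      of them lies in an initial segment, where the definition of Brownian motion applies.\<close>
    proof (subst indep_sets_finite_index_sets, intro allI impI)
      fix J :: "nat set" assume "finite J"
      then obtain n where "J \<subseteq> {..<n}" by (meson finite_nat_iff_bounded)
      then show "indep_sets (\<lambda>i. {?D i -` A \<inter> space M |A. A \<in> sets (euc d)}) J"
        using ind[of n] unfolding indep_vars_def2 by (auto intro: indep_sets_mono_index)
    qed
  qed
  then have "indep_vars (\<lambda>_. euc d) (\<lambda>j. vscale d (1 / sqrt \<Delta>) \<circ> ?D j) UNIV"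
    by (rule indep_vars_compose) measurable
  then have "indep_vars (\<lambda>_. euc d) (\<lambda>j \<omega>. increments \<Delta> \<omega> j) UNIV"
    by (simp add: comp_def increments_def)
  then have "distr M (\<Pi>\<^sub>M j\<in>UNIV. euc d) (\<lambda>\<omega>. \<lambda>j\<in>UNIV. increments \<Delta> \<omega> j) =
      (\<Pi>\<^sub>M j\<in>UNIV. distr M (euc d) (\<lambda>\<omega>. increments \<Delta> \<omega> j))"
    by (subst indep_vars_iff_distr_eq_PiM[symmetric]) auto
  moreover have "distr M (euc d) (\<lambda>\<omega>. increments \<Delta> \<omega> j) = gauss d 1" for j
  proof -
    have [measurable]: "vscale d r \<in> measurable (euc d) (euc d)" "vscale d r \<in> measurable (gauss d 1) (euc d)" for r
      by (rule measurable_vscale, simp_all)+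
    have "distr M (euc d) (\<lambda>\<omega>. increments \<Delta> \<omega> j) = distr (distr M (euc d) (?D j)) (euc d) (vscale d (1 / sqrt \<Delta>))"
      using D[of j] by (subst distr_distr) (simp_all add: comp_def increments_def del: of_nat_Suc)
    also have "distr M (euc d) (?D j) = gauss d \<Delta>"
      using law_increment[of "real j * \<Delta>" "real (Suc j) * \<Delta>"] \<Delta> by (simp add: algebra_simps)
    also have "gauss d \<Delta> = distr (gauss d 1) (euc d) (vscale d (sqrt \<Delta>))"
      by (rule distr_gauss_scale[OF \<Delta>, symmetric])
    also have "distr \<dots> (euc d) (vscale d (1 / sqrt \<Delta>)) =
        distr (gauss d 1) (euc d) (\<lambda>z. vscale d (1 / sqrt \<Delta>) (vscale d (sqrt \<Delta>) z))"
      by (subst distr_distr) (simp_all add: comp_def)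
    also have "\<dots> = distr (gauss d 1) (gauss d 1) (\<lambda>z. z)"
    proof (intro distr_cong refl)
      fix z assume "z \<in> space (gauss d 1)"
      then show "vscale d (1 / sqrt \<Delta>) (vscale d (sqrt \<Delta>) z) = z"
        using \<Delta> by (auto simp: vscale_def space_euc fun_eq_iff PiE_def extensional_def)
    qed simp
    also have "\<dots> = gauss d 1" by (rule distr_id)
    finally show ?thesis .
  qed
  ultimately have *: "distr M (\<Pi>\<^sub>M j\<in>UNIV. euc d) (increments \<Delta>) = (\<Pi>\<^sub>M j\<in>UNIV. gauss d 1)"
    by (simp add: restrict_UNIV)
  have sets_eq: "sets (\<Pi>\<^sub>M j\<in>(UNIV::nat set). gauss d 1) = sets (\<Pi>\<^sub>M j\<in>(UNIV::nat set). euc d)"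
    by (intro sets_PiM_cong) auto
  have "(\<lambda>\<omega>. \<lambda>j\<in>UNIV. increments \<Delta> \<omega> j) \<in> measurable M (\<Pi>\<^sub>M j\<in>UNIV. gauss d 1)"
    by (rule measurable_restrict) simp
  then show "increments \<Delta> \<in> measurable M (\<Pi>\<^sub>M j\<in>UNIV. gauss d 1)" by (simp add: restrict_UNIV)
  show "distr M (\<Pi>\<^sub>M j\<in>UNIV. gauss d 1) (increments \<Delta>) = (\<Pi>\<^sub>M j\<in>UNIV. gauss d 1)"
    using * by (simp cong: distr_cong add: sets_eq)
qed

text \<open>The sums telescope to W at the grid time minus W at time 0; the latter vanishes only
  almost surely, whence the exceptional null set.\<close>

lemma noise_increments:
  assumes \<Delta>: "0 < \<Delta>"
  shows "AE \<omega> in M. \<forall>k. noise d \<Delta> (increments \<Delta> \<omega>) k = W (real k * \<Delta>) \<omega>"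
  using AE_W_0 AE_space
proof eventually_elim
  case (elim \<omega>)
  show ?case
  proof
    fix k
    have sp: "W (real k * \<Delta>) \<omega> \<in> space (euc d)"
      using measurable_space[OF measurable_W] \<Delta> elim by simp
    have "(\<Sum>j<k. sqrt \<Delta> * increments \<Delta> \<omega> j i) = W (real k * \<Delta>) \<omega> i" if i: "i < d" for i
    proof -
      have "(\<Sum>j<k. sqrt \<Delta> * increments \<Delta> \<omega> j i) = (\<Sum>j<k. W (real (Suc j) * \<Delta>) \<omega> i - W (real j * \<Delta>) \<omega> i)"
        using \<Delta> i by (intro sum.cong) (auto simp: increments_def vscale_def vdiff_def)
      also have "\<dots> = W (real k * \<Delta>) \<omega> i - W (real 0 * \<Delta>) \<omega> i"
        by (rule sum_lessThan_telescope)
      finally show ?thesis using elim i by (simp add: vzero_def)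
    qed
    then show "noise d \<Delta> (increments \<Delta> \<omega>) k = W (real k * \<Delta>) \<omega>"
      using sp by (auto simp: noise_def space_euc fun_eq_iff PiE_def extensional_def)
  qed
qed

end

section \<open>Fluctuations and measurability on the canonical noise space\<close>

abbreviation gauss_seq :: "nat \<Rightarrow> (nat \<Rightarrow> nat \<Rightarrow> real) measure" where
  "gauss_seq d \<equiv> \<Pi>\<^sub>M j\<in>(UNIV::nat set). gauss d 1"

lemma measurable_gauss_seq [measurable]: "(\<lambda>z. z j) \<in> measurable (gauss_seq d) (euc d)"
proof -
  have "(\<lambda>z. z j) \<in> measurable (gauss_seq d) (gauss d 1)" by (rule measurable_component_singleton) simp
  then show ?thesis by simp
qed

lemma measurable_gauss_seq_component [measurable]: "i < d \<Longrightarrow> (\<lambda>z. z j i) \<in> borel_measurable (gauss_seq d)"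
  by measurable

lemma measurable_noise [measurable]: "(\<lambda>z. noise d \<Delta> z k) \<in> measurable (gauss_seq d) (euc d)"
  unfolding noise_def by (rule measurable_into_euc) measurable

lemma sequence_space_gauss: "sequence_space (gauss d 1)"
  by (simp add: sequence_space_def product_prob_space_def product_prob_space_axioms_def
      product_sigma_finite_def prob_space_imp_sigma_finite prob_space_gauss)

text \<open>Ville's inequality for the exponential martingale of the random walk with tilt \<beta>;
  \<open>s\<close> is a sign. The linear barrier lets one bound cover all late grid times, and the
  bound does not depend on \<Delta>.\<close>

lemma noise_maximal_inequality:
  assumes d: "0 < d" and \<Delta>: "0 < \<Delta>" and s: "s\<^sup>2 = 1" and \<beta>: "0 \<le> \<beta>"
  shows "emeasure (gauss_seq d) {z \<in> space (gauss_seq d). \<exists>k. a \<le> real k * \<Delta> \<and> \<beta> * (real k * \<Delta>) \<le> s * noise d \<Delta> z k 0}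
    \<le> ennreal (exp (- (\<beta>\<^sup>2 * a / 2)))"
proof -
  interpret sequence_space "gauss d 1" by (rule sequence_space_gauss)
  let ?g = "\<lambda>z. s * \<beta> * sqrt \<Delta> * z 0 - \<beta>\<^sup>2 * \<Delta> / 2"
  have [measurable]: "(\<lambda>z. z 0) \<in> borel_measurable (gauss d 1)"
    using measurable_euc_component[OF d] by (subst measurable_cong_sets[OF sets_gauss refl])
  have g [measurable]: "?g \<in> borel_measurable (gauss d 1)" by measurable
  have mgf: "(\<integral>\<^sup>+z. ennreal (exp (?g z)) \<partial>gauss d 1) \<le> 1"
  proof -
    have "(\<integral>\<^sup>+z. ennreal (exp (?g z)) \<partial>gauss d 1) =
        (\<integral>\<^sup>+z. ennreal (exp (- (\<beta>\<^sup>2 * \<Delta> / 2))) * ennreal (exp (s * \<beta> * sqrt \<Delta> * z 0)) \<partial>gauss d 1)"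
      by (intro nn_integral_cong) (simp flip: ennreal_mult exp_add)
    also have "\<dots> = ennreal (exp (- (\<beta>\<^sup>2 * \<Delta> / 2))) * ennreal (exp ((s * \<beta> * sqrt \<Delta>)\<^sup>2 / 2))"
      by (subst nn_integral_cmult) (simp_all add: nn_integral_exp_gauss[OF d])
    also have "\<dots> = 1" using \<Delta> s by (simp add: power_mult_distrib flip: ennreal_mult exp_add)
    finally show ?thesis by simp
  qed
  have "{z \<in> space (gauss_seq d). \<exists>k. a \<le> real k * \<Delta> \<and> \<beta> * (real k * \<Delta>) \<le> s * noise d \<Delta> z k 0} \<subseteq>
      {z \<in> space (gauss_seq d). \<exists>k. \<beta>\<^sup>2 * a / 2 \<le> (\<Sum>j<k. ?g (z j))}"
  proof clarify
    fix z k assume z: "z \<in> space (gauss_seq d)" and k: "a \<le> real k * \<Delta>" "\<beta> * (real k * \<Delta>) \<le> s * noise d \<Delta> z k 0"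
    \<comment> \<open>With t = k \<Delta>, the event gives a sum of at least \<beta>^2 t - \<beta>^2
      t / 2, hence at least \<beta>^2 a / 2.\<close>
    have "(\<Sum>j<k. ?g (z j)) = \<beta> * (s * noise d \<Delta> z k 0) - \<beta>\<^sup>2 * (real k * \<Delta>) / 2"
      using d by (simp add: noise_def sum_subtractf sum_distrib_left mult_ac)
    moreover have "\<beta> * (\<beta> * (real k * \<Delta>)) \<le> \<beta> * (s * noise d \<Delta> z k 0)"
      using k(2) \<beta> by (rule mult_left_mono)
    moreover have "\<beta>\<^sup>2 * a \<le> \<beta>\<^sup>2 * (real k * \<Delta>)" using k(1) by (intro mult_left_mono) auto
    ultimately have "\<beta>\<^sup>2 * a / 2 \<le> (\<Sum>j<k. ?g (z j))" by (simp add: power2_eq_square mult.assoc)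
    then show "\<exists>k. \<beta>\<^sup>2 * a / 2 \<le> (\<Sum>j<k. ?g (z j))" by blast
  qed
  then have "emeasure (gauss_seq d) {z \<in> space (gauss_seq d). \<exists>k. a \<le> real k * \<Delta> \<and> \<beta> * (real k * \<Delta>) \<le> s * noise d \<Delta> z k 0} \<le>
      emeasure (gauss_seq d) {z \<in> space (gauss_seq d). \<exists>k. \<beta>\<^sup>2 * a / 2 \<le> (\<Sum>j<k. ?g (z j))}"
    by (intro emeasure_mono) measurable
  also have "\<dots> \<le> ennreal (exp (- (\<beta>\<^sup>2 * a / 2)))"
    by (rule maximal_inequality[OF g mgf])
  finally show ?thesis .
qed

lemma noise_fluctuation:
  assumes d: "0 < d" and \<Delta>: "0 < \<Delta>" and \<beta>: "0 \<le> \<beta>"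
  shows "emeasure (gauss_seq d) {z \<in> space (gauss_seq d). \<exists>k. a \<le> real k * \<Delta> \<and> \<beta> * (real k * \<Delta>) \<le> \<bar>noise d \<Delta> z k 0\<bar>}
    \<le> ennreal (2 * exp (- (\<beta>\<^sup>2 * a / 2)))"
proof -
  let ?E = "\<lambda>s. {z \<in> space (gauss_seq d). \<exists>k. a \<le> real k * \<Delta> \<and> \<beta> * (real k * \<Delta>) \<le> s * noise d \<Delta> z k 0}"
  have [measurable]: "(\<lambda>z. noise d \<Delta> z k 0) \<in> borel_measurable (gauss_seq d)" for k
    using measurable_compose[OF measurable_noise measurable_euc_component[OF d]] .
  have E: "?E s \<in> sets (gauss_seq d)" for s by measurable
  have "{z \<in> space (gauss_seq d). \<exists>k. a \<le> real k * \<Delta> \<and> \<beta> * (real k * \<Delta>) \<le> \<bar>noise d \<Delta> z k 0\<bar>} \<subseteq> ?E 1 \<union> ?E (- 1)"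
  proof
    fix z assume "z \<in> {z \<in> space (gauss_seq d). \<exists>k. a \<le> real k * \<Delta> \<and> \<beta> * (real k * \<Delta>) \<le> \<bar>noise d \<Delta> z k 0\<bar>}"
    then obtain k where z: "z \<in> space (gauss_seq d)" and k: "a \<le> real k * \<Delta>" "\<beta> * (real k * \<Delta>) \<le> \<bar>noise d \<Delta> z k 0\<bar>"
      by blast
    from k(2) consider "\<beta> * (real k * \<Delta>) \<le> 1 * noise d \<Delta> z k 0" | "\<beta> * (real k * \<Delta>) \<le> - 1 * noise d \<Delta> z k 0"
      by linarith
    then show "z \<in> ?E 1 \<union> ?E (- 1)"
      by cases (rule UnI1, use z k(1) in blast, rule UnI2, use z k(1) in blast)
  qed
  then have "emeasure (gauss_seq d) {z \<in> space (gauss_seq d). \<exists>k. a \<le> real k * \<Delta> \<and> \<beta> * (real k * \<Delta>) \<le> \<bar>noise d \<Delta> z k 0\<bar>}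
      \<le> emeasure (gauss_seq d) (?E 1 \<union> ?E (- 1))"
    using E by (intro emeasure_mono sets.Un)
  also have "\<dots> \<le> emeasure (gauss_seq d) (?E 1) + emeasure (gauss_seq d) (?E (- 1))"
    by (rule emeasure_subadditive[OF E E])
  also have "\<dots> \<le> ennreal (exp (- (\<beta>\<^sup>2 * a / 2))) + ennreal (exp (- (\<beta>\<^sup>2 * a / 2)))"
    using d \<Delta> \<beta> by (intro add_mono noise_maximal_inequality) auto
  also have "\<dots> = ennreal (2 * exp (- (\<beta>\<^sup>2 * a / 2)))"
    by (simp flip: ennreal_plus)
  finally show ?thesis .
qed

lemma measurable_time: "(\<lambda>q. snd q) \<in> borel_measurable (euc d \<Otimes>\<^sub>M restrict_space borel {0::real..})"
  by (rule measurable_compose[OF measurable_snd measurable_restrict_space1]) simp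

lemma measurable_Pair_time:
  assumes "0 \<le> t"
  shows "(\<lambda>y. (y, t)) \<in> measurable (euc d) (euc d \<Otimes>\<^sub>M restrict_space borel {0::real..})"
  using assms by (intro measurable_Pair) (auto simp: space_restrict_space)

lemma measurable_drift:
  assumes "is_drift d m" "0 \<le> t" and [measurable]: "f \<in> measurable N (euc d)"
  shows "(\<lambda>x. m (f x) t) \<in> measurable N (euc d)"
  using measurable_compose[OF measurable_compose[OF assms(3) measurable_Pair_time[OF assms(2)]]
      assms(1)[unfolded is_drift_def]] by simp

lemma measurable_test:
  assumes "is_test d \<phi>" "0 \<le> t" and [measurable]: "f \<in> measurable N (euc d)"
  shows "(\<lambda>x. \<phi> (f x) t) \<in> borel_measurable N"
  using measurable_compose[OF measurable_compose[OF assms(3) measurable_Pair_time[OF assms(2)]],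
      of "\<lambda>(y, t). \<phi> y t"] assms(1) by (simp add: is_test_def)

lemma measurable_discretized:
  assumes "is_drift d m" "0 \<le> \<Delta>"
  shows "(\<lambda>z. discretized d m \<Delta> z k) \<in> measurable (gauss_seq d) (euc d)"
proof (induction k)
  case (Suc k)
  note [measurable] = Suc measurable_drift[OF assms(1) _ Suc, of "real k * \<Delta>"]
  show ?case using assms(2) by simp
qed simp

lemma is_drift_modified_drift:
  assumes m0: "is_drift d m0" and \<phi>: "is_test d \<phi>"
  shows "is_drift d (modified_drift N L \<kappa> \<gamma> \<epsilon> ta \<delta> m0 \<phi> d)"
proof -
  let ?N = "euc d \<Otimes>\<^sub>M restrict_space borel {0::real..}"
  note [measurable] = measurable_time
  have [measurable]: "(\<lambda>q. m0 (fst q) (snd q)) \<in> measurable ?N (euc d)"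
    using m0 by (simp add: is_drift_def case_prod_unfold)
  have [measurable]: "(\<lambda>q. \<phi> (fst q) (snd q)) \<in> borel_measurable ?N"
    using \<phi> by (simp add: is_test_def case_prod_unfold)
  have "(\<lambda>q. \<lambda>i\<in>{..<d}. if escapes \<kappa> L ta (fst q) (snd q) then (if i = 0 then N else 0)
        else if keeps d \<gamma> \<epsilon> ta \<delta> (m0 (fst q) (snd q)) (\<phi> (fst q) (snd q)) (snd q) then m0 (fst q) (snd q) i else 0)
      \<in> measurable ?N (euc d)"
  proof (rule measurable_into_euc)
    fix i assume i: "i < d"
    then have d: "0 < d" by simp
    have [measurable]: "(\<lambda>q. fst q 0) \<in> borel_measurable ?N"
      using measurable_compose[OF measurable_fst measurable_euc_component[OF d]] .
    have [measurable]: "(\<lambda>q. m0 (fst q) (snd q) j) \<in> borel_measurable ?N" if "j < d" for j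
      using that by measurable
    show "(\<lambda>q. if escapes \<kappa> L ta (fst q) (snd q) then (if i = 0 then N else 0)
        else if keeps d \<gamma> \<epsilon> ta \<delta> (m0 (fst q) (snd q)) (\<phi> (fst q) (snd q)) (snd q) then m0 (fst q) (snd q) i else 0)
      \<in> borel_measurable ?N"
      unfolding escapes_def keeps_def using i by measurable
  qed
  then show ?thesis
    by (simp add: is_drift_def modified_drift_def case_prod_unfold)
qed

context observed_signal
begin

text \<open>While the drift has displaced the process by at most \<open>c t\<^sub>a\<^sub>l\<^sub>g\<close>, the discretized diffusion is a
  member of the family of shifted Brownian motions under which the test has to be silent.\<close>

lemma null_event_transfer:
  assumes m: "is_drift d m" and \<phi>: "is_test d \<phi>" and \<Delta>: "0 < \<Delta>"
  shows "emeasure (gauss_seq d) {z \<in> space (gauss_seq d). \<exists>k. T \<le> real k * \<Delta> \<and>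
      vnorm d (vdiff d (discretized d m \<Delta> z k) (noise d \<Delta> z k)) \<le> r \<and>
      \<phi> (discretized d m \<Delta> z k) (real k * \<Delta>) = 1}
    \<le> outer_measure_of M {\<omega> \<in> space M. \<exists>t\<ge>T. (SUP a\<in>{a \<in> space (euc d). vnorm d a \<le> r}. \<phi> (vadd d a (W t \<omega>)) t) = 1}"
    (is "emeasure _ ?E \<le> outer_measure_of M ?O")
proof -
  have [measurable]: "(\<lambda>z. discretized d m \<Delta> z k) \<in> measurable (gauss_seq d) (euc d)" for k
    using measurable_discretized[OF m] \<Delta> by simp
  have [measurable]: "(\<lambda>z. \<phi> (discretized d m \<Delta> z k) (real k * \<Delta>)) \<in> borel_measurable (gauss_seq d)" for k
    using \<Delta> by (intro measurable_test[OF \<phi>]) auto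
  have E [measurable]: "?E \<in> sets (gauss_seq d)" by measurable
  note inc [measurable] = law_increments(1)[OF \<Delta>]
  have "emeasure (gauss_seq d) ?E = emeasure (distr M (gauss_seq d) (increments \<Delta>)) ?E"
    by (simp only: law_increments(2)[OF \<Delta>])
  also have "\<dots> = emeasure M (increments \<Delta> -` ?E \<inter> space M)"
    by (rule emeasure_distr[OF inc E])
  also have "\<dots> \<le> outer_measure_of M ?O"
    unfolding outer_measure_of_def
  proof (rule INF_greatest)
    fix B assume "B \<in> {B \<in> sets M. ?O \<subseteq> B}"
    then have B: "B \<in> sets M" "?O \<subseteq> B" by auto
    have "AE \<omega> in M. \<omega> \<in> increments \<Delta> -` ?E \<inter> space M \<longrightarrow> \<omega> \<in> B"
      using noise_increments[OF \<Delta>] AE_space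
    proof eventually_elim
      case (elim \<omega>)
      show ?case
      proof
        assume "\<omega> \<in> increments \<Delta> -` ?E \<inter> space M"
        then obtain k where k: "T \<le> real k * \<Delta>"
          "vnorm d (vdiff d (discretized d m \<Delta> (increments \<Delta> \<omega>) k) (noise d \<Delta> (increments \<Delta> \<omega>) k)) \<le> r"
          "\<phi> (discretized d m \<Delta> (increments \<Delta> \<omega>) k) (real k * \<Delta>) = 1" by auto
        let ?y = "discretized d m \<Delta> (increments \<Delta> \<omega>) k"
        let ?t = "real k * \<Delta>"
        \<comment> \<open>The witness is random: the accumulated drift depends on the past of the
          path. This is why the supremum over all shifts stands inside the probability.\<close>
        let ?a = "vdiff d ?y (W ?t \<omega>)" and ?A = "{a \<in> space (euc d). vnorm d a \<le> r}"
        have t: "0 \<le> ?t" using \<Delta> by simp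
        have "vadd d ?a (W ?t \<omega>) = ?y"
          using discretized_space[of d m \<Delta> "increments \<Delta> \<omega>" k]
          by (auto simp: vadd_def vdiff_def space_euc fun_eq_iff PiE_def extensional_def)
        moreover have a: "?a \<in> ?A" using k(2) elim by simp
        moreover have le: "\<phi> (vadd d a (W ?t \<omega>)) ?t \<le> 1" for a
        proof -
          have "\<phi> (vadd d a (W ?t \<omega>)) ?t \<in> {0, 1}" using \<phi> t vadd_space unfolding is_test_def by blast
          then show ?thesis by auto
        qed
        have "\<phi> (vadd d ?a (W ?t \<omega>)) ?t \<le> (SUP a\<in>?A. \<phi> (vadd d a (W ?t \<omega>)) ?t)"
          using a le by (intro cSUP_upper bdd_aboveI2)
        moreover have "(SUP a\<in>?A. \<phi> (vadd d a (W ?t \<omega>)) ?t) \<le> 1"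
          using a le by (intro cSUP_least) blast+
        ultimately have "(SUP a\<in>?A. \<phi> (vadd d a (W ?t \<omega>)) ?t) = 1"
          using k(3) by simp
        with k(1) elim have "\<omega> \<in> ?O" by auto
        with B show "\<omega> \<in> B" by blast
      qed
    qed
    then show "emeasure M (increments \<Delta> -` ?E \<inter> space M) \<le> emeasure M B"
      using B(1) by (rule emeasure_mono_AE)
  qed
  finally show ?thesis .
qed

end

section \<open>Error along the true diffusion\<close>

lemma nn_integral_exp_atLeast:
  assumes a: "0 < a"
  shows "(\<integral>\<^sup>+t\<in>{s..}. ennreal (exp (- (a * t))) \<partial>lborel) = ennreal (exp (- (a * s)) / a)"
proof -
  have "filterlim (\<lambda>t. - (a * t)) at_bot at_top"
    using a by real_asymp
  then have "((\<lambda>t. exp (- (a * t))) \<longlongrightarrow> 0) at_top"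
    by (rule filterlim_compose[OF exp_at_bot])
  then have "((\<lambda>t. - exp (- (a * t)) / a) \<longlongrightarrow> 0) at_top"
    using tendsto_divide[of _ 0 _ "\<lambda>_. - a" "- a"] a by (auto simp: minus_divide_left[symmetric])
  then have "(\<integral>\<^sup>+t\<in>{s..}. ennreal (exp (- (a * t))) \<partial>lborel) = ennreal (0 - - exp (- (a * s)) / a)"
    using a by (intro nn_integral_FTC_atLeast) (auto intro!: derivative_eq_intros)
  then show ?thesis by simp
qed

context observed_signal
begin

lemma prob_W:
  assumes t: "0 < t" and [measurable]: "{w \<in> space (euc d). Q w} \<in> sets (euc d)"
  shows "emeasure M {\<omega> \<in> space M. Q (W t \<omega>)} =
    emeasure (gauss d 1) {z \<in> space (euc d). Q (vscale d (sqrt t) z)}"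
proof -
  let ?B = "{w \<in> space (euc d). Q w}"
  have [measurable]: "vscale d (sqrt t) \<in> measurable (gauss d 1) (euc d)"
    by (rule measurable_vscale[where r = "\<lambda>_. sqrt t"]) (auto intro: measurable_ident_sets)
  have "W t \<omega> \<in> space (euc d)" if "\<omega> \<in> space M" for \<omega>
    using measurable_space[OF measurable_W that] t by simp
  then have "{\<omega> \<in> space M. Q (W t \<omega>)} = W t -` ?B \<inter> space M" by auto
  then have "emeasure M {\<omega> \<in> space M. Q (W t \<omega>)} = emeasure (distr M (euc d) (W t)) ?B"
    using t by (simp add: emeasure_distr)
  also have "distr M (euc d) (W t) = distr (gauss d 1) (euc d) (vscale d (sqrt t))"
    by (simp only: law_W[OF t] distr_gauss_scale[OF t])
  also have "emeasure \<dots> ?B = emeasure (gauss d 1) (vscale d (sqrt t) -` ?B \<inter> space (gauss d 1))"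
    by (rule emeasure_distr) measurable
  also have "vscale d (sqrt t) -` ?B \<inter> space (gauss d 1) = {z \<in> space (euc d). Q (vscale d (sqrt t) z)}"
    by auto
  finally show ?thesis .
qed

text \<open>A signal in the unit ball contributes at most t to the first coordinate, so escape at t
  > 0 forces the Brownian coordinate above (L - 1) t, that is, a standard normal above (L - 1) times
  the square root of t.\<close>

lemma prob_escapes:
  assumes \<mu>: "AE x in \<mu>. vnorm d x \<le> 1" and d: "0 < d" and t: "0 < t" and L: "1 \<le> L"
  shows "emeasure M {\<omega> \<in> space M. escapes \<kappa> L ta (observation d X W t \<omega>) t} \<le> 
    ennreal (exp (- ((L - 1)\<^sup>2 / 2 * t))) * indicator {\<kappa> * ta..} t"
proof (cases "\<kappa> * ta \<le> t")
  case True
  have [measurable]: "(\<lambda>w. w 0) \<in> borel_measurable (euc d)" by (rule measurable_euc_component[OF d])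
  have [measurable]: "(\<lambda>\<omega>. W t \<omega> 0) \<in> borel_measurable M"
    using t by (intro measurable_compose[OF measurable_W measurable_euc_component[OF d]]) simp
  have law: "distr M (euc d) X = \<mu>" using process by (simp add: signal_and_bm_def)
  have "AE x in distr M (euc d) X. vnorm d x \<le> 1" using \<mu> unfolding law .
  then have "AE \<omega> in M. vnorm d (X \<omega>) \<le> 1" by (rule AE_distrD[rotated]) measurable
  then have "emeasure M {\<omega> \<in> space M. escapes \<kappa> L ta (observation d X W t \<omega>) t} \<le>
      emeasure M {\<omega> \<in> space M. (L - 1) * t \<le> W t \<omega> 0}"
  proof (intro emeasure_mono_AE, eventually_elim, safe)
    fix \<omega> assume X: "vnorm d (X \<omega>) \<le> 1" and e: "escapes \<kappa> L ta (observation d X W t \<omega>) t"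
    have "X \<omega> 0 \<le> 1" using component_le_vnorm[OF d, of "X \<omega>"] X by linarith
    then have "t * X \<omega> 0 \<le> t * 1" using t by (intro mult_left_mono) auto
    moreover have "L * t \<le> t * X \<omega> 0 + W t \<omega> 0"
      using e t d by (simp add: escapes_def observation_def vadd_def vscale_def)
    ultimately show "(L - 1) * t \<le> W t \<omega> 0" by (simp add: left_diff_distrib)
  qed measurable
  also have "\<dots> = emeasure (gauss d 1) {z \<in> space (euc d). (L - 1) * t \<le> vscale d (sqrt t) z 0}"
    by (rule prob_W[OF t]) measurable
  also have "{z \<in> space (euc d). (L - 1) * t \<le> vscale d (sqrt t) z 0} = {z \<in> space (euc d). (L - 1) * sqrt t \<le> z 0}"
  proof -
    have "(L - 1) * t = sqrt t * ((L - 1) * sqrt t)" using t by simp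
    then show ?thesis using t d by (simp only: vscale_def) (simp add: mult_le_cancel_left_pos)
  qed
  also have "emeasure (gauss d 1) \<dots> \<le> ennreal (exp (- ((L - 1) * sqrt t)\<^sup>2 / 2))"
    using L t by (intro gauss_tail[OF d]) simp
  also have "- ((L - 1) * sqrt t)\<^sup>2 / 2 = - ((L - 1)\<^sup>2 / 2 * t)"
    using t by (simp add: power_mult_distrib)
  finally show ?thesis using True by simp
next
  case False
  then have empty: "{\<omega> \<in> space M. escapes \<kappa> L ta (observation d X W t \<omega>) t} = {}" using t by (auto simp: escapes_def)
  show ?thesis unfolding empty by simp
qed

text \<open>The drifts differ on three events only: escape, where the error is at most N + 1; a
  large \<open>m0\<close> before the window; and a silent test after the threshold. In the last two
  the drift is replaced by 0, with error at most 1.\<close>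

lemma modification_error:
  fixes N L \<kappa> \<gamma> \<epsilon> ta \<delta> :: real
  assumes m0: "is_drift d m0" and m0_le: "\<And>y t. y \<in> space (euc d) \<Longrightarrow> 0 \<le> t \<Longrightarrow> vnorm d (m0 y t) \<le> 1"
    and \<phi>: "is_test d \<phi>" and \<mu>: "AE x in \<mu>. vnorm d x \<le> 1" and d: "0 < d"
    and L: "1 < L" and N: "0 \<le> N" and \<epsilon>: "0 < \<epsilon>"
  defines "m \<equiv> modified_drift N L \<kappa> \<gamma> \<epsilon> ta \<delta> m0 \<phi> d" and "y \<equiv> observation d X W"
  shows "(\<integral>\<^sup>+t\<in>{0..}. (\<integral>\<^sup>+\<omega>. ennreal ((vnorm d (vdiff d (m (y t \<omega>) t) (m0 (y t \<omega>) t)))\<^sup>2) \<partial>M) \<partial>lborel) \<le>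
    (\<integral>\<^sup>+t\<in>{0..(1 - \<gamma>) * ta}. emeasure M {\<omega> \<in> space M. \<epsilon> \<le> vnorm d (m0 (y t \<omega>) t)} \<partial>lborel) +
    (\<integral>\<^sup>+t\<in>{ta * (1 + \<delta>)..}. emeasure M {\<omega> \<in> space M. \<phi> (y t \<omega>) t = 0} \<partial>lborel) +
    ennreal ((N + 1)\<^sup>2 * (exp (- ((L - 1)\<^sup>2 / 2 * (\<kappa> * ta))) / ((L - 1)\<^sup>2 / 2)))"
proof -
  let ?R = "euc d \<Otimes>\<^sub>M restrict_space borel {0::real..}"
  let ?T = "ta * (1 + \<delta>)" and ?a = "(L - 1)\<^sup>2 / 2"
  let ?P1 = "\<lambda>t. emeasure M {\<omega> \<in> space M. \<epsilon> \<le> vnorm d (m0 (y t \<omega>) t)}"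
  let ?P2 = "\<lambda>t. emeasure M {\<omega> \<in> space M. \<phi> (y t \<omega>) t = 0}"
  let ?P3 = "\<lambda>t. emeasure M {\<omega> \<in> space M. escapes \<kappa> L ta (y t \<omega>) t}"
  have sp: "space ?R = space (euc d) \<times> {0..}" by (simp add: space_pair_measure space_restrict_space)
  have m0': "(\<lambda>q. m0 (fst q) (snd q)) \<in> measurable ?R (euc d)"
    using m0 by (simp add: is_drift_def case_prod_unfold)
  have \<phi>': "(\<lambda>q. \<phi> (fst q) (snd q)) \<in> borel_measurable ?R"
    using \<phi> by (simp add: is_test_def case_prod_unfold)
  have S1: "{q \<in> space ?R. \<epsilon> \<le> vnorm d (m0 (fst q) (snd q))} \<in> sets ?R"
    using measurable_compose[OF m0' measurable_vnorm] by measurable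
  have S2: "{q \<in> space ?R. \<phi> (fst q) (snd q) = 0} \<in> sets ?R"
    using \<phi>' by measurable
  have y_space: "y t \<omega> \<in> space (euc d)" for t \<omega> by (simp add: y_def observation_def)
  \<comment> \<open>These measurable versions make the integral additive; since they agree with the
    probabilities for t > 0 only, the intervals below are cut open at 0.\<close>
  obtain h1 where [measurable]: "h1 \<in> borel_measurable borel" and h1: "\<And>t. 0 < t \<Longrightarrow> ?P1 t = h1 t"
    using prob_observation_measurable[OF S1] y_space unfolding y_def[symmetric] sp by auto
  obtain h2 where [measurable]: "h2 \<in> borel_measurable borel" and h2: "\<And>t. 0 < t \<Longrightarrow> ?P2 t = h2 t"
    using prob_observation_measurable[OF S2] y_space unfolding y_def[symmetric] sp by auto
  have pointwise: "(vnorm d (vdiff d (m y t) (m0 y t)))\<^sup>2 \<le>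
      (N + 1)\<^sup>2 * indicator {y. escapes \<kappa> L ta y t} y + indicator {y. t < (1 - \<gamma>) * ta \<and> \<epsilon> \<le> vnorm d (m0 y t)} y +
      indicator {y. ?T \<le> t \<and> \<phi> y t = 0} y" (is "?l \<le> ?r")
    if y: "y \<in> space (euc d)" and t: "0 \<le> t" for y t
  proof (cases "escapes \<kappa> L ta y t")
    case True
    have "vnorm d (vdiff d (m y t) (m0 y t)) \<le> N + 1"
      using vnorm_vdiff_le[of d "m y t" "m0 y t"] m0_le[OF y t] True vnorm_modified_drift[OF d N] unfolding m_def
      by simp
    then have "?l \<le> (N + 1)\<^sup>2" by (intro power_mono) simp_all
    also have "\<dots> \<le> ?r" using True by simp
    finally show ?thesis .
  next
    case no_escape: False
    show ?thesis
    proof (cases "keeps d \<gamma> \<epsilon> ta \<delta> (m0 y t) (\<phi> y t) t")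
      case True
      have "vnorm d (vdiff d (m y t) (m0 y t)) = vnorm d (vzero d)"
        using True no_escape by (intro vnorm_cong) (simp add: m_def modified_drift_def vdiff_def vzero_def)
      then show ?thesis by simp
    next
      case False
      have "vnorm d (vdiff d (m y t) (m0 y t)) \<le> 1"
        using vnorm_vdiff_le[of d "m y t" "m0 y t"] m0_le[OF y t] False no_escape vnorm_modified_drift[OF d N] unfolding m_def
        by simp
      then have "?l \<le> 1" by (simp add: power_le_one)
      moreover have "\<phi> y t \<in> {0, 1}" using \<phi> y t by (simp add: is_test_def)
      then have "t < (1 - \<gamma>) * ta \<and> \<epsilon> \<le> vnorm d (m0 y t) \<or> ?T \<le> t \<and> \<phi> y t = 0"
        using False sum_square_ge_iff[OF \<epsilon>, where v = "m0 y t" and d = d]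
        by (auto simp: keeps_def not_le not_less split: if_splits)
      then have "1 \<le> ?r" by (auto simp: indicator_def)
      ultimately show ?thesis by linarith
    qed
  qed
  have inner: "(\<integral>\<^sup>+\<omega>. ennreal ((vnorm d (vdiff d (m (y t \<omega>) t) (m0 (y t \<omega>) t)))\<^sup>2) \<partial>M) \<le>
      ennreal ((N + 1)\<^sup>2) * (ennreal (exp (- (?a * t))) * indicator {\<kappa> * ta..} t) + h1 t * indicator {0<..(1 - \<gamma>) * ta} t
       + h2 t * indicator ({?T..} \<inter> {0<..}) t" if t: "0 < t" for t
  proof -
    have [measurable]: "y t \<in> measurable M (euc d)" unfolding y_def using t by (intro measurable_observation) simp
    have [measurable]: "(\<lambda>\<omega>. y t \<omega> 0) \<in> borel_measurable M"
      by (rule measurable_compose[OF _ measurable_euc_component[OF d]]) measurable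
    have [measurable]: "(\<lambda>\<omega>. m0 (y t \<omega>) t) \<in> measurable M (euc d)" "(\<lambda>\<omega>. \<phi> (y t \<omega>) t) \<in> borel_measurable M"
      using t by (auto intro!: measurable_drift[OF m0] measurable_test[OF \<phi>])
    let ?E1 = "{\<omega> \<in> space M. t < (1 - \<gamma>) * ta \<and> \<epsilon> \<le> vnorm d (m0 (y t \<omega>) t)}"
    let ?E2 = "{\<omega> \<in> space M. ?T \<le> t \<and> \<phi> (y t \<omega>) t = 0}"
    let ?E3 = "{\<omega> \<in> space M. escapes \<kappa> L ta (y t \<omega>) t}"
    have E3 [measurable]: "?E3 \<in> sets M" unfolding escapes_def by measurable
    have E1 [measurable]: "?E1 \<in> sets M" by measurable
    have E2 [measurable]: "?E2 \<in> sets M" by measurable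
    have "(\<integral>\<^sup>+\<omega>. ennreal ((vnorm d (vdiff d (m (y t \<omega>) t) (m0 (y t \<omega>) t)))\<^sup>2) \<partial>M) \<le>
        (\<integral>\<^sup>+\<omega>. ennreal ((N + 1)\<^sup>2) * indicator ?E3 \<omega> + indicator ?E1 \<omega> + indicator ?E2 \<omega> \<partial>M)"
    proof (rule nn_integral_mono)
      fix \<omega> assume \<omega>: "\<omega> \<in> space M"
      have "ennreal ((vnorm d (vdiff d (m (y t \<omega>) t) (m0 (y t \<omega>) t)))\<^sup>2) \<le>
        ennreal ((N + 1)\<^sup>2 * indicator ?E3 \<omega> + indicator ?E1 \<omega> + indicator ?E2 \<omega>)"
        using pointwise[OF y_space, of t t \<omega>] t \<omega> by (intro ennreal_leI) (simp add: indicator_def)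
      also have "\<dots> = ennreal ((N + 1)\<^sup>2) * indicator ?E3 \<omega> + indicator ?E1 \<omega> + indicator ?E2 \<omega>"
        by (simp add: ennreal_mult ennreal_indicator)
      finally show "ennreal ((vnorm d (vdiff d (m (y t \<omega>) t) (m0 (y t \<omega>) t)))\<^sup>2) \<le> \<dots>" .
    qed
    also have "\<dots> = ennreal ((N + 1)\<^sup>2) * ?P3 t + emeasure M ?E1 + emeasure M ?E2"
      by (simp add: nn_integral_add nn_integral_cmult)
    also have "\<dots> \<le> ennreal ((N + 1)\<^sup>2) * (ennreal (exp (- (?a * t))) * indicator {\<kappa> * ta..} t) + h1 t * indicator {0<..(1 - \<gamma>) * ta} t
       + h2 t * indicator ({?T..} \<inter> {0<..}) t"
    proof (intro add_mono mult_left_mono)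
      show "?P3 t \<le> ennreal (exp (- (?a * t))) * indicator {\<kappa> * ta..} t"
        unfolding y_def using L by (intro prob_escapes[OF \<mu> d t]) simp
      show "emeasure M ?E1 \<le> h1 t * indicator {0<..(1 - \<gamma>) * ta} t"
        using t by (cases "t < (1 - \<gamma>) * ta") (simp_all flip: h1)
      show "emeasure M ?E2 \<le> h2 t * indicator ({?T..} \<inter> {0<..}) t"
        using t by (cases "?T \<le> t") (simp_all flip: h2)
    qed simp
    finally show ?thesis .
  qed
  have "(\<integral>\<^sup>+t\<in>{0..}. (\<integral>\<^sup>+\<omega>. ennreal ((vnorm d (vdiff d (m (y t \<omega>) t) (m0 (y t \<omega>) t)))\<^sup>2) \<partial>M) \<partial>lborel) \<le>
    (\<integral>\<^sup>+t. ennreal ((N + 1)\<^sup>2) * (ennreal (exp (- (?a * t))) * indicator {\<kappa> * ta..} t) + h1 t * indicator {0<..(1 - \<gamma>) * ta} t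
       + h2 t * indicator ({?T..} \<inter> {0<..}) t \<partial>lborel)"
  proof (rule nn_integral_mono_AE)
    \<comment> \<open>Discarding the single time 0 makes the kick free of charge.\<close>
    have "AE t in lborel. t \<noteq> (0::real)" by (rule AE_lborel_singleton)
    then show "AE t in lborel. (\<integral>\<^sup>+\<omega>. ennreal ((vnorm d (vdiff d (m (y t \<omega>) t) (m0 (y t \<omega>) t)))\<^sup>2) \<partial>M) * indicator {0..} t \<le>
      ennreal ((N + 1)\<^sup>2) * (ennreal (exp (- (?a * t))) * indicator {\<kappa> * ta..} t) + h1 t * indicator {0<..(1 - \<gamma>) * ta} t
       + h2 t * indicator ({?T..} \<inter> {0<..}) t"
    proof eventually_elim
      case (elim t)
      show ?case
      proof (cases "0 < t")
        case True
        then show ?thesis using inner[OF True] by simp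
      qed (use elim in simp)
    qed
  qed
  also have "\<dots> = ennreal ((N + 1)\<^sup>2) * (\<integral>\<^sup>+t\<in>{\<kappa> * ta..}. ennreal (exp (- (?a * t))) \<partial>lborel)
      + (\<integral>\<^sup>+t\<in>{0<..(1 - \<gamma>) * ta}. h1 t \<partial>lborel) + (\<integral>\<^sup>+t\<in>{?T..} \<inter> {0<..}. h2 t \<partial>lborel)"
    by (simp add: nn_integral_add nn_integral_cmult)
  also have "(\<integral>\<^sup>+t\<in>{\<kappa> * ta..}. ennreal (exp (- (?a * t))) \<partial>lborel) = ennreal (exp (- (?a * (\<kappa> * ta))) / ?a)"
    using L by (intro nn_integral_exp_atLeast) simp
  also have "ennreal ((N + 1)\<^sup>2) * \<dots> = ennreal ((N + 1)\<^sup>2 * (exp (- (?a * (\<kappa> * ta))) / ?a))"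
    by (rule ennreal_mult[symmetric]) simp_all
  also have "ennreal ((N + 1)\<^sup>2 * (exp (- (?a * (\<kappa> * ta))) / ?a)) + (\<integral>\<^sup>+t\<in>{0<..(1 - \<gamma>) * ta}. h1 t \<partial>lborel) +
      (\<integral>\<^sup>+t\<in>{?T..} \<inter> {0<..}. h2 t \<partial>lborel) \<le>
    ennreal ((N + 1)\<^sup>2 * (exp (- (?a * (\<kappa> * ta))) / ?a)) + (\<integral>\<^sup>+t\<in>{0..(1 - \<gamma>) * ta}. ?P1 t \<partial>lborel) +
      (\<integral>\<^sup>+t\<in>{?T..}. ?P2 t \<partial>lborel)"
    by (intro add_mono order_refl nn_integral_mono) (auto simp: indicator_def h1 h2)
  finally show ?thesis by (simp only: ac_simps)
qed

text \<open>Conditionally on x, the rescaled observation is standard Gaussian noise shifted by a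
  vector of squared norm at most t. A test that accepts noise with probability at least 1/2 then
  accepts the shifted noise with probability at least exp(- t) / 4.\<close>

lemma test_power_lower_bound:
  assumes \<phi>: "is_test d \<phi>" and \<mu>: "AE x in \<mu>. vnorm d x \<le> 1" and t: "0 < t"
    and null: "emeasure M {\<omega> \<in> space M. \<phi> (W t \<omega>) t = 1} \<le> ennreal (1 / 2)"
  shows "ennreal (exp (- t) / 4) \<le> emeasure M {\<omega> \<in> space M. \<phi> (observation d X W t \<omega>) t = 0}"
proof -
  interpret \<mu>: prob_space \<mu> by (rule prob_\<mu>)
  interpret G: prob_space "gauss d 1" by (rule prob_space_gauss) simp
  have [measurable]: "(\<lambda>x. \<phi> (f x) t) \<in> borel_measurable K" if "f \<in> measurable K (euc d)" for f K
    using measurable_test[OF \<phi> _ that] t by simp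
  have sp: "space \<mu> = space (euc d)" by (rule sets_eq_imp_space_eq[OF sets_\<mu>])
  have vs [measurable]: "vscale d r \<in> measurable (euc d) (euc d)" for r
    by (rule measurable_vscale[where r = "\<lambda>_. r"]) auto
  let ?B = "{z \<in> space (euc d). \<phi> (vscale d (sqrt t) z) t = 0}"
  have B [measurable]: "?B \<in> sets (euc d)" by measurable
  have "emeasure (gauss d 1) (space (gauss d 1) - ?B) = emeasure (gauss d 1) {z \<in> space (euc d). \<phi> (vscale d (sqrt t) z) t = 1}"
  proof -
    have "\<phi> (vscale d (sqrt t) z) t \<in> {0, 1}" for z using \<phi> t by (simp add: is_test_def)
    then show ?thesis by (intro arg_cong[where f = "emeasure _"]) auto
  qed
  also have "\<dots> = emeasure M {\<omega> \<in> space M. \<phi> (W t \<omega>) t = 1}"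
    by (rule prob_W[OF t, symmetric]) measurable
  finally have "ennreal (1 - measure (gauss d 1) ?B) \<le> ennreal (1 / 2)"
    using null by (simp add: G.emeasure_eq_measure G.prob_compl del: space_gauss)
  then have "1 - measure (gauss d 1) ?B \<le> 1 / 2"
    by (subst (asm) ennreal_le_iff) simp_all
  then have half: "ennreal (1 / 2) \<le> emeasure (gauss d 1) ?B"
    unfolding G.emeasure_eq_measure by (intro ennreal_leI) linarith
  have "ennreal (exp (- t) / 4) = (\<integral>\<^sup>+x. ennreal (exp (- t) / 4) \<partial>\<mu>)" by (simp add: \<mu>.emeasure_space_1)
  also have "\<dots> \<le> (\<integral>\<^sup>+x. emeasure (gauss d 1) {z \<in> space (euc d). \<phi> (noisy d (x, z) t) t = 0} \<partial>\<mu>)"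
  proof (rule nn_integral_mono_AE, use \<mu> in eventually_elim)
    fix x assume x: "vnorm d x \<le> 1"
    let ?b = "vscale d (sqrt t) x"
    have "(vnorm d ?b)\<^sup>2 \<le> t"
      using x t by (simp add: vnorm_vscale power_mult_distrib mult_left_le power_le_one)
    then have "ennreal (exp (- t) / 4) \<le> ennreal (exp (- (vnorm d ?b)\<^sup>2) / 4)"
      by (intro ennreal_leI) simp
    also have "\<dots> \<le> emeasure (gauss d 1) {z \<in> space (euc d). vadd d ?b z \<in> ?B}"
      by (rule gauss_shift_lower_bound[OF B half])
    also have "{z \<in> space (euc d). vadd d ?b z \<in> ?B} = {z \<in> space (euc d). \<phi> (noisy d (x, z) t) t = 0}"
    proof -
      have "vscale d (sqrt t) (vadd d ?b z) = noisy d (x, z) t" for z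
        using t by (auto simp: noisy_def vscale_def vadd_def fun_eq_iff distrib_left simp flip: mult.assoc)
      then show ?thesis by simp
    qed
    finally show "ennreal (exp (- t) / 4) \<le> emeasure (gauss d 1) {z \<in> space (euc d). \<phi> (noisy d (x, z) t) t = 0}" .
  qed
  also have "\<dots> = emeasure (\<mu> \<Otimes>\<^sub>M gauss d 1) {p \<in> space (euc d \<Otimes>\<^sub>M euc d). \<phi> (noisy d p t) t = 0}"
  proof (subst G.emeasure_pair_measure_alt)
    have "(\<lambda>p. noisy d p t) \<in> measurable (euc d \<Otimes>\<^sub>M euc d) (euc d)" by measurable
    then have "{p \<in> space (euc d \<Otimes>\<^sub>M euc d). \<phi> (noisy d p t) t = 0} \<in> sets (euc d \<Otimes>\<^sub>M euc d)" by measurable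
    then show "{p \<in> space (euc d \<Otimes>\<^sub>M euc d). \<phi> (noisy d p t) t = 0} \<in> sets (\<mu> \<Otimes>\<^sub>M gauss d 1)"
      by (simp cong: sets_pair_measure_cong add: sets_\<mu>)
  qed (auto intro!: nn_integral_cong arg_cong[where f = "emeasure _"] simp: space_pair_measure sp)
  also have "\<dots> = emeasure M {\<omega> \<in> space M. \<phi> (observation d X W t \<omega>) t = 0}"
    by (rule prob_observation[OF t, symmetric]) measurable
  finally show ?thesis .
qed

end

text \<open>A lower limit controls the sequence from below only, so just the positive part of the
  deficit tends to zero.\<close>

lemma liminf_real_deficit:
  fixes e :: "nat \<Rightarrow> real"
  assumes "liminf (\<lambda>d. ereal (e d)) = ereal \<alpha>"
  shows "(\<lambda>d. max 0 (\<alpha> - e d)) \<longlonglongrightarrow> 0"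
proof (rule order_tendstoI)
  fix a :: real assume "0 < a"
  then have "ereal (\<alpha> - a) < liminf (\<lambda>d. ereal (e d))" unfolding assms by simp
  then have "\<forall>\<^sub>F d in sequentially. ereal (\<alpha> - a) < ereal (e d)" by (rule less_LiminfD)
  then show "\<forall>\<^sub>F d in sequentially. max 0 (\<alpha> - e d) < a"
    by eventually_elim (use \<open>0 < a\<close> in auto)
qed (auto simp: less_max_iff_disj)

context observed_signal
begin

text \<open>Hence \<open>\<eta>2\<close> is at least of order \<open>exp (- 2 t\<^sub>a\<^sub>l\<^sub>g)\<close>, so \<open>t\<^sub>a\<^sub>l\<^sub>g\<close> tends to infinity and the cost of the escape
  region is negligible.\<close>

lemma test_power_integral_lower_bound:
  assumes \<phi>: "is_test d \<phi>" and \<mu>: "AE x in \<mu>. vnorm d x \<le> 1" and T: "0 < T" and r: "0 \<le> r"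
    and null: "outer_measure_of M {\<omega> \<in> space M. \<exists>t\<ge>T. (SUP a\<in>{a \<in> space (euc d). vnorm d a \<le> r}. \<phi> (vadd d a (W t \<omega>)) t) = 1}
      \<le> ennreal (1 / 2)"
  shows "ennreal (exp (- (T + 1)) / 4) \<le>
    (\<integral>\<^sup>+t\<in>{T..}. emeasure M {\<omega> \<in> space M. \<phi> (observation d X W t \<omega>) t = 0} \<partial>lborel)"
proof -
  let ?A = "{a \<in> space (euc d). vnorm d a \<le> r}"
  have le: "ennreal (exp (- (T + 1)) / 4) \<le> emeasure M {\<omega> \<in> space M. \<phi> (observation d X W t \<omega>) t = 0}"
    if t: "T \<le> t" "t \<le> T + 1" for t
  proof -
    have pos: "0 < t" using t T by simp
    have W_space: "W t \<omega> \<in> space (euc d)" if "\<omega> \<in> space M" for \<omega>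
      using measurable_space[OF measurable_W that] pos by simp
    have \<phi>_le: "\<phi> (vadd d a w) t \<le> 1" for a w
    proof -
      have "\<phi> (vadd d a w) t \<in> {0, 1}" using \<phi> pos by (simp add: is_test_def)
      then show ?thesis by auto
    qed
    have zero: "vzero d \<in> ?A" using r by simp
    \<comment> \<open>The shift a = 0 belongs to the family, so an alarm on pure noise is part of
      the null event.\<close>
    have sub: "{\<omega> \<in> space M. \<phi> (W t \<omega>) t = 1} \<subseteq>
        {\<omega> \<in> space M. \<exists>t\<ge>T. (SUP a\<in>?A. \<phi> (vadd d a (W t \<omega>)) t) = 1}"
    proof safe
      fix \<omega> assume \<omega>: "\<omega> \<in> space M" and one: "\<phi> (W t \<omega>) t = 1"
      have "vadd d (vzero d) (W t \<omega>) = W t \<omega>"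
        using W_space[OF \<omega>] by (auto simp: vadd_def vzero_def space_euc fun_eq_iff PiE_def extensional_def)
      moreover have "\<phi> (vadd d (vzero d) (W t \<omega>)) t \<le> (SUP a\<in>?A. \<phi> (vadd d a (W t \<omega>)) t)"
        using zero \<phi>_le by (intro cSUP_upper bdd_aboveI2)
      moreover have "(SUP a\<in>?A. \<phi> (vadd d a (W t \<omega>)) t) \<le> 1"
        using zero \<phi>_le by (intro cSUP_least) blast+
      ultimately show "\<exists>t\<ge>T. (SUP a\<in>?A. \<phi> (vadd d a (W t \<omega>)) t) = 1"
        using one t(1) by (intro exI[of _ t]) simp
    qed
    have "(\<lambda>\<omega>. \<phi> (W t \<omega>) t) \<in> borel_measurable M"
      using pos by (intro measurable_test[OF \<phi>] measurable_W) auto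
    then have "{\<omega> \<in> space M. \<phi> (W t \<omega>) t = 1} \<in> sets M" by measurable
    then have "emeasure M {\<omega> \<in> space M. \<phi> (W t \<omega>) t = 1} =
        outer_measure_of M {\<omega> \<in> space M. \<phi> (W t \<omega>) t = 1}" by (rule outer_measure_of_eq[symmetric])
    also have "\<dots> \<le> ennreal (1 / 2)"
      using outer_measure_of_mono[OF sub] null by (rule order_trans)
    finally have "ennreal (exp (- t) / 4) \<le> emeasure M {\<omega> \<in> space M. \<phi> (observation d X W t \<omega>) t = 0}"
      by (rule test_power_lower_bound[OF \<phi> \<mu> pos])
    moreover have "ennreal (exp (- (T + 1)) / 4) \<le> ennreal (exp (- t) / 4)"
      using t by (intro ennreal_leI) simp
    ultimately show ?thesis by (rule order_trans[rotated])
  qed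
  \<comment> \<open>The unit interval after T already contributes enough; on it exp(- t) is at least
    exp(- (T + 1)).\<close>
  have "ennreal (exp (- (T + 1)) / 4) = (\<integral>\<^sup>+t\<in>{T..T + 1}. ennreal (exp (- (T + 1)) / 4) \<partial>lborel)"
    by (simp add: nn_integral_cmult_indicator)
  also have "\<dots> \<le> (\<integral>\<^sup>+t\<in>{T..}. emeasure M {\<omega> \<in> space M. \<phi> (observation d X W t \<omega>) t = 0} \<partial>lborel)"
    using le by (intro nn_integral_mono) (auto simp: indicator_def)
  finally show ?thesis .
qed

text \<open>Outside two bad events, a large fluctuation of the noise and an alarm of the test on a
  shifted Brownian motion, the pathwise analysis applies. Neither bound depends on \<Delta> or
  \<open>k\<close>.\<close>

lemma discretized_drift_far:
  fixes c ta \<delta> \<Delta> :: real and m0 :: drift and \<phi> :: "(nat \<Rightarrow> real) \<Rightarrow> real \<Rightarrow> real"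
  defines "m \<equiv> modified_drift (64 / c) (48 / c) (c\<^sup>2 / 256) (c / 8) (c / 8) ta \<delta> m0 \<phi> d"
  assumes c: "0 < c" "c < 1" and ta: "0 < ta" and \<delta>: "\<bar>\<delta>\<bar> \<le> c / 8" and \<Delta>: "0 < \<Delta>" and d: "0 < d"
    and m0: "is_drift d m0" "\<And>y t. y \<in> space (euc d) \<Longrightarrow> 0 \<le> t \<Longrightarrow> vnorm d (m0 y t) \<le> 1"
    and \<phi>: "is_test d \<phi>"
    and k: "ta * (1 + \<delta>) \<le> real k * \<Delta>"
  shows "emeasure (discretized_drift_law d m \<Delta> k) {v \<in> space (euc d). vnorm d v \<noteq> 0 \<and> vnorm d v < 2} \<le>
    ennreal (2 * exp (- (ta / 4))) + outer_measure_of M {\<omega> \<in> space M. \<exists>t\<ge>ta * (1 + \<delta>).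
      (SUP a\<in>{a \<in> space (euc d). vnorm d a \<le> c * ta}. \<phi> (vadd d a (W t \<omega>)) t) = 1}"
proof -
  let ?V = "{v \<in> space (euc d). vnorm d v \<noteq> 0 \<and> vnorm d v < 2}"
  let ?y = "\<lambda>z k. discretized d m \<Delta> z k"
  let ?E1 = "{z \<in> space (gauss_seq d). \<exists>k. c\<^sup>2 / 256 * ta \<le> real k * \<Delta> \<and> (16 / c - 2) * (real k * \<Delta>) \<le> \<bar>noise d \<Delta> z k 0\<bar>}"
  let ?E2 = "{z \<in> space (gauss_seq d). \<exists>k. ta * (1 + \<delta>) \<le> real k * \<Delta> \<and>
      vnorm d (vdiff d (?y z k) (noise d \<Delta> z k)) \<le> c * ta \<and> \<phi> (?y z k) (real k * \<Delta>) = 1}"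
  have drift: "is_drift d m" unfolding m_def by (rule is_drift_modified_drift[OF m0(1) \<phi>])
  have y [measurable]: "(\<lambda>z. ?y z k) \<in> measurable (gauss_seq d) (euc d)" for k
    using \<Delta> by (intro measurable_discretized[OF drift]) simp
  have [measurable]: "(\<lambda>z. \<phi> (?y z k) (real k * \<Delta>)) \<in> borel_measurable (gauss_seq d)" for k
    using \<Delta> by (intro measurable_test[OF \<phi>] y) simp
  have m_y: "(\<lambda>z. m (?y z k) (real k * \<Delta>)) \<in> measurable (gauss_seq d) (euc d)"
    using \<Delta> by (intro measurable_drift[OF drift] y) simp
  have [measurable]: "(\<lambda>z. noise d \<Delta> z k 0) \<in> borel_measurable (gauss_seq d)" for k
    using measurable_compose[OF measurable_noise measurable_euc_component[OF d]] .
  have E1: "?E1 \<in> sets (gauss_seq d)" by measurable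
  have E2: "?E2 \<in> sets (gauss_seq d)" by measurable
  have V: "?V \<in> sets (euc d)" by measurable
  have \<phi>01: "\<And>y t. y \<in> space (euc d) \<Longrightarrow> 0 \<le> t \<Longrightarrow> \<phi> y t \<in> {0, 1}"
    using \<phi> by (simp add: is_test_def)
  have "emeasure (discretized_drift_law d m \<Delta> k) ?V =
      emeasure (gauss_seq d) ((\<lambda>z. m (?y z k) (real k * \<Delta>)) -` ?V \<inter> space (gauss_seq d))"
    unfolding discretized_drift_law_def by (rule emeasure_distr[OF m_y V])
  also have "\<dots> \<le> emeasure (gauss_seq d) (?E1 \<union> ?E2)"
  proof (rule emeasure_mono)
    show "(\<lambda>z. m (?y z k) (real k * \<Delta>)) -` ?V \<inter> space (gauss_seq d) \<subseteq> ?E1 \<union> ?E2"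
    proof (rule subsetI, rule ccontr)
      fix z assume z: "z \<in> (\<lambda>z. m (?y z k) (real k * \<Delta>)) -` ?V \<inter> space (gauss_seq d)" and "z \<notin> ?E1 \<union> ?E2"
      then have good: "z \<notin> ?E1" "z \<notin> ?E2" and sp: "z \<in> space (gauss_seq d)" by blast+
      have "vnorm d (m (?y z k) (real k * \<Delta>)) = 0 \<or> 2 \<le> vnorm d (m (?y z k) (real k * \<Delta>))"
        unfolding m_def
      proof (rule modified_drift_dynamics[OF c ta \<delta> \<Delta> d m0(2) \<phi>01 _ _ k])
        show "\<bar>noise d \<Delta> z j 0\<bar> < (16 / c - 2) * (real j * \<Delta>)" if "c\<^sup>2 / 256 * ta \<le> real j * \<Delta>" for j
          using good(1) sp that not_less by blast
        show "\<phi> (discretized d (modified_drift (64 / c) (48 / c) (c\<^sup>2 / 256) (c / 8) (c / 8) ta \<delta> m0 \<phi> d) \<Delta> z j)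
            (real j * \<Delta>) \<noteq> 1"
          if "ta * (1 + \<delta>) \<le> real j * \<Delta>" "vnorm d (vdiff d (discretized d (modified_drift (64 / c) (48 / c) (c\<^sup>2 / 256) (c / 8) (c / 8) ta \<delta> m0 \<phi> d) \<Delta> z j) (noise d \<Delta> z j)) \<le> c * ta" for j
          using good(2) sp that unfolding m_def by blast
      qed assumption+
      then show False using z by auto
    qed
  qed (use E1 E2 in simp)
  also have "\<dots> \<le> emeasure (gauss_seq d) ?E1 + emeasure (gauss_seq d) ?E2"
    by (rule emeasure_subadditive[OF E1 E2])
  also have "\<dots> \<le> ennreal (2 * exp (- (ta / 4))) + outer_measure_of M {\<omega> \<in> space M. \<exists>t\<ge>ta * (1 + \<delta>).
      (SUP a\<in>{a \<in> space (euc d). vnorm d a \<le> c * ta}. \<phi> (vadd d a (W t \<omega>)) t) = 1}"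
  proof (rule add_mono)
    have b: "0 \<le> 16 / c - 2" using c by (simp add: field_simps)
    have "emeasure (gauss_seq d) ?E1 \<le> ennreal (2 * exp (- ((16 / c - 2)\<^sup>2 * (c\<^sup>2 / 256 * ta) / 2)))"
      by (rule noise_fluctuation[OF d \<Delta> b])
    also have "\<dots> \<le> ennreal (2 * exp (- (ta / 4)))"
    proof -
      \<comment> \<open>The exponent is (16 - 2c)^2 t_alg / 512, and 14^2 \<ge> 128 gives t_alg /
        4.\<close>
      have eq: "(16 / c - 2)\<^sup>2 * c\<^sup>2 = (16 - 2 * c)\<^sup>2"
        using c by (simp add: field_simps flip: power_mult_distrib)
      have "14\<^sup>2 \<le> (16 - 2 * c)\<^sup>2" using c by (intro power_mono) auto
      then have "ta * 128 \<le> ta * (16 - 2 * c)\<^sup>2" using ta by (intro mult_left_mono) auto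
      also have "\<dots> = (16 / c - 2)\<^sup>2 * (c\<^sup>2 / 256 * ta) / 2 * 512" unfolding eq[symmetric] by simp
      finally show ?thesis by (intro ennreal_leI) simp
    qed
    finally show "emeasure (gauss_seq d) ?E1 \<le> ennreal (2 * exp (- (ta / 4)))" .
    show "emeasure (gauss_seq d) ?E2 \<le> outer_measure_of M {\<omega> \<in> space M. \<exists>t\<ge>ta * (1 + \<delta>).
      (SUP a\<in>{a \<in> space (euc d). vnorm d a \<le> c * ta}. \<phi> (vadd d a (W t \<omega>)) t) = 1}"
      by (rule null_event_transfer[OF drift \<phi> \<Delta>])
  qed
  finally show ?thesis .
qed

end

theorem theorem1:
  fixes \<mu> :: "nat \<Rightarrow> (nat \<Rightarrow> real) measure"
    and \<alpha> c :: real
    and M :: "nat \<Rightarrow> 'w measure"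
    and X :: "nat \<Rightarrow> 'w \<Rightarrow> nat \<Rightarrow> real"
    and W :: "nat \<Rightarrow> real \<Rightarrow> 'w \<Rightarrow> nat \<Rightarrow> real"
    and t_alg \<eta>1 \<delta> \<eta>2 :: "nat \<Rightarrow> real"
    and m0 :: "nat \<Rightarrow> drift"
    and \<phi> :: "nat \<Rightarrow> (nat \<Rightarrow> real) \<Rightarrow> real \<Rightarrow> real"
  defines "y \<equiv> \<lambda>d. observation d (X d) (W d)"
    and "\<theta> \<equiv> \<lambda>d. [t_alg d, \<delta> d]"
    and "A \<equiv> \<lambda>d. {a \<in> space (euc d). vnorm d a \<le> c * t_alg d}"
  assumes mu: "\<And>d. prob_space (\<mu> d)" "\<And>d. sets (\<mu> d) = sets (euc d)"
      "\<And>d. AE x in \<mu> d. vnorm d x \<le> 1"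
    and alpha: "liminf (\<lambda>d. ereal (\<integral>x. vnorm d x \<partial>\<mu> d)) = ereal \<alpha>" "\<alpha> > 0"
    and process: "\<And>d. signal_and_bm d (\<mu> d) (M d) (X d) (W d)"
    and t_alg: "\<And>d. t_alg d > 0"
    and rates: "\<eta>1 \<longlonglongrightarrow> 0" "\<delta> \<longlonglongrightarrow> 0" "\<eta>2 \<longlonglongrightarrow> 0"
    and m0: "\<And>d. is_drift d (m0 d)" "polytime_drift \<theta> m0"
    and m0_bounded: "\<And>d y t. y \<in> space (euc d) \<Longrightarrow> t \<ge> 0 \<Longrightarrow> vnorm d (m0 d y t) \<le> 1"
    and below_threshold: "\<And>\<epsilon> \<gamma>. \<epsilon> > 0 \<Longrightarrow> \<gamma> > 0 \<Longrightarrow>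
      bigO_ennreal
        (\<lambda>d. \<integral>\<^sup>+t\<in>{0..(1 - \<gamma>) * t_alg d}.
           emeasure (M d) {\<omega> \<in> space (M d). vnorm d (m0 d (y d t \<omega>) t) \<ge> \<epsilon>} \<partial>lborel) \<eta>1"
    and c: "0 < c" "c < 1"
    and test: "\<And>d. is_test d (\<phi> d)" "polytime_test \<theta> \<phi>"
    and test_power:
      "bigO_ennreal
        (\<lambda>d. \<integral>\<^sup>+t\<in>{t_alg d * (1 + \<delta> d)..}.
           emeasure (M d) {\<omega> \<in> space (M d). \<phi> d (y d t \<omega>) t = 0} \<partial>lborel) \<eta>2"
    and test_null:
      "(\<lambda>d. outer_measure_of (M d)
          {\<omega> \<in> space (M d). \<exists>t\<ge>t_alg d * (1 + \<delta> d).
             (SUP a\<in>A d. \<phi> d (vadd d a (W d t \<omega>)) t) = 1}) \<longlonglongrightarrow> 0"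
  shows "\<exists>m. (\<forall>d. is_drift d (m d)) \<and> polytime_drift \<theta> m \<and>
      bigO_ennreal
        (\<lambda>d. \<integral>\<^sup>+t\<in>{0..}. (\<integral>\<^sup>+\<omega>.
             ennreal ((vnorm d (vdiff d (m d (y d t \<omega>) t) (m0 d (y d t \<omega>) t)))\<^sup>2) \<partial>M d) \<partial>lborel)
        (\<lambda>d. max \<bar>\<eta>1 d\<bar> \<bar>\<eta>2 d\<bar>) \<and>
      (\<forall>\<Delta>. (\<forall>d. \<Delta> d > 0) \<longrightarrow>
        (\<exists>r. r \<longlonglongrightarrow> 0 \<and>
          (\<forall>d. ennreal (\<alpha> - r d) \<le>
            (INF k\<in>{k. real k * \<Delta> d \<ge> (1 + \<delta> d) * t_alg d}.
               wasserstein1 d (discretized_drift_law d (m d) (\<Delta> d) k) (\<mu> d)))))"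
proof -
  define m where "m = (\<lambda>d. modified_drift (64 / c) (48 / c) (c\<^sup>2 / 256) (c / 8) (c / 8) (t_alg d) (\<delta> d) (m0 d) (\<phi> d) d)"
  define T where "T d = t_alg d * (1 + \<delta> d)" for d
  define nul where "nul d = outer_measure_of (M d) {\<omega> \<in> space (M d). \<exists>t\<ge>T d. (SUP a\<in>A d. \<phi> d (vadd d a (W d t \<omega>)) t) = 1}" for d
  define I1 where "I1 d = (\<integral>\<^sup>+t\<in>{0..(1 - c / 8) * t_alg d}. emeasure (M d) {\<omega> \<in> space (M d). c / 8 \<le> vnorm d (m0 d (y d t \<omega>) t)} \<partial>lborel)" for d
  define I2 where "I2 d = (\<integral>\<^sup>+t\<in>{T d..}. emeasure (M d) {\<omega> \<in> space (M d). \<phi> d (y d t \<omega>) t = 0} \<partial>lborel)" for d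
  have signal: "observed_signal d (\<mu> d) (M d) (X d) (W d)" for d
    using process mu by (simp add: observed_signal_def)
  have O_lim: "nul \<longlonglongrightarrow> 0" using test_null by (simp add: nul_def[abs_def] T_def)
  have O_le_1: "nul d \<le> 1" for d
  proof -
    interpret observed_signal d "\<mu> d" "M d" "X d" "W d" by (rule signal)
    have "nul d \<le> outer_measure_of (M d) (space (M d))"
      unfolding nul_def by (intro outer_measure_of_mono) auto
    then show ?thesis by (simp add: outer_measure_of_eq emeasure_space_1)
  qed
  have ev_d: "\<forall>\<^sub>F d in sequentially. 0 < (d::nat)" by (rule eventually_gt_at_top)
  have ev_\<delta>: "\<forall>\<^sub>F d in sequentially. \<bar>\<delta> d\<bar> \<le> c / 8"
  proof -
    have "(\<lambda>d. \<bar>\<delta> d\<bar>) \<longlonglongrightarrow> 0" using rates(2) by (rule tendsto_rabs_zero)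
    then have "\<forall>\<^sub>F d in sequentially. \<bar>\<delta> d\<bar> < c / 8" using c by (intro order_tendstoD) auto
    then show ?thesis by eventually_elim simp
  qed
  have ev_O: "\<forall>\<^sub>F d in sequentially. nul d \<le> ennreal (1 / 2)"
  proof -
    have "\<forall>\<^sub>F d in sequentially. nul d < ennreal (1 / 2)" using O_lim by (rule order_tendstoD) (subst ennreal_less_zero_iff, simp)
    then show ?thesis by eventually_elim simp
  qed
  obtain C1 where C1: "0 \<le> C1" "\<forall>\<^sub>F d in sequentially. I1 d \<le> ennreal (C1 * \<bar>\<eta>1 d\<bar>)"
    using below_threshold[of "c / 8" "c / 8"] c unfolding bigO_ennreal_def I1_def by auto
  obtain C2 where C2: "0 \<le> C2" "\<forall>\<^sub>F d in sequentially. I2 d \<le> ennreal (C2 * \<bar>\<eta>2 d\<bar>)"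
    using test_power unfolding bigO_ennreal_def I2_def T_def by auto
  \<comment> \<open>The factor 4 cancels the 1/4 in the power bound, and \<open>exp 1\<close> pays
    for the unit interval: exp(- 2 t_alg) \<le> exp(- T) = e exp(- (T + 1)), as T \<le> 2
    t_alg.\<close>
  define C3 where "C3 = 4 * exp 1 * C2"
  have C3: "0 \<le> C3" using C2 by (simp add: C3_def)
  have t_alg_rate: "\<forall>\<^sub>F d in sequentially. exp (- 2 * t_alg d) \<le> C3 * \<bar>\<eta>2 d\<bar>"
    using ev_\<delta> ev_O C2(2)
  proof eventually_elim
    case (elim d)
    interpret observed_signal d "\<mu> d" "M d" "X d" "W d" by (rule signal)
    have "1 + \<delta> d \<le> 2" "0 < 1 + \<delta> d" using elim(1) c by linarith+
    then have T: "0 < T d" "T d \<le> t_alg d * 2" using t_alg[of d] by (simp_all add: T_def)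
    have "ennreal (exp (- (T d + 1)) / 4) \<le> I2 d"
      unfolding I2_def y_def
      using test_power_integral_lower_bound[OF test(1) mu(3) T(1), of "c * t_alg d"] elim(2) c t_alg[of d]
      by (simp add: nul_def A_def)
    then have "ennreal (exp (- (T d + 1)) / 4) \<le> ennreal (C2 * \<bar>\<eta>2 d\<bar>)" using elim(3) by (rule order_trans)
    then have le: "exp (- (T d + 1)) / 4 \<le> C2 * \<bar>\<eta>2 d\<bar>" using C2(1) by (simp add: ennreal_le_iff)
    have "exp (- 2 * t_alg d) \<le> exp (1 + - (T d + 1))" using T by simp
    also have "\<dots> = exp 1 * exp (- (T d + 1))" by (rule exp_add)
    also have "\<dots> \<le> exp 1 * (4 * (C2 * \<bar>\<eta>2 d\<bar>))"
      using le by (intro mult_left_mono) auto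
    also have "\<dots> = C3 * \<bar>\<eta>2 d\<bar>" by (simp add: C3_def)
    finally show ?case .
  qed
  have exp_lim: "(\<lambda>d. exp (- (t_alg d / 4))) \<longlonglongrightarrow> 0"
  proof -
    have upper: "(\<lambda>d. C3 * \<bar>\<eta>2 d\<bar>) \<longlonglongrightarrow> 0" using tendsto_mult[OF tendsto_const tendsto_rabs_zero[OF rates(3)]] by simp
    have "(\<lambda>d. exp (- 2 * t_alg d)) \<longlonglongrightarrow> 0"
      by (rule tendsto_sandwich[OF _ t_alg_rate tendsto_const upper]) simp
    \<comment> \<open>The noise bound has exponent t_alg / 4, an eighth of the 2 t_alg controlled by
      \<open>\<eta>2\<close>.\<close>
    then have "(\<lambda>d. root 8 (exp (- 2 * t_alg d))) \<longlonglongrightarrow> root 8 0" by (rule tendsto_real_root)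
    moreover have "root 8 (exp (- 2 * t_alg d)) = exp (- (t_alg d / 4))" for d
      by (rule real_root_pos_unique) (simp_all flip: exp_of_nat_mult)
    ultimately show ?thesis by simp
  qed
  have drift: "is_drift d (m d)" for d
    unfolding m_def by (rule is_drift_modified_drift[OF m0(1) test(1)])
  have poly: "polytime_drift \<theta> m"
    unfolding m_def \<theta>_def using m0(2) test(2) unfolding \<theta>_def by (rule polytime_modified_drift)
  define K where "K = (64 / c + 1)\<^sup>2 / ((48 / c - 1)\<^sup>2 / 2)"
  have K: "0 \<le> K" by (simp add: K_def)
  have M2: "bigO_ennreal
        (\<lambda>d. \<integral>\<^sup>+t\<in>{0..}. (\<integral>\<^sup>+\<omega>.
             ennreal ((vnorm d (vdiff d (m d (y d t \<omega>) t) (m0 d (y d t \<omega>) t)))\<^sup>2) \<partial>M d) \<partial>lborel)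
        (\<lambda>d. max \<bar>\<eta>1 d\<bar> \<bar>\<eta>2 d\<bar>)"
    unfolding bigO_ennreal_def
  proof (intro exI[of _ "C1 + C2 + K * C3"] conjI)
    show "\<forall>\<^sub>F d in sequentially. (\<integral>\<^sup>+t\<in>{0..}. (\<integral>\<^sup>+\<omega>.
             ennreal ((vnorm d (vdiff d (m d (y d t \<omega>) t) (m0 d (y d t \<omega>) t)))\<^sup>2) \<partial>M d) \<partial>lborel) \<le>
        ennreal ((C1 + C2 + K * C3) * \<bar>max \<bar>\<eta>1 d\<bar> \<bar>\<eta>2 d\<bar>\<bar>)"
      using ev_d C1(2) C2(2) t_alg_rate
    proof eventually_elim
      case (elim d)
      interpret observed_signal d "\<mu> d" "M d" "X d" "W d" by (rule signal)
      let ?a = "(48 / c - 1)\<^sup>2 / 2" and ?\<eta> = "max \<bar>\<eta>1 d\<bar> \<bar>\<eta>2 d\<bar>"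
      let ?e = "(64 / c + 1)\<^sup>2 * (exp (- (?a * (c\<^sup>2 / 256 * t_alg d))) / ?a)"
      have "(\<integral>\<^sup>+t\<in>{0..}. (\<integral>\<^sup>+\<omega>. ennreal ((vnorm d (vdiff d (m d (y d t \<omega>) t) (m0 d (y d t \<omega>) t)))\<^sup>2) \<partial>M d) \<partial>lborel)
          \<le> I1 d + I2 d + ennreal ?e"
        unfolding m_def I1_def I2_def y_def T_def
      proof (rule modification_error[OF m0(1) m0_bounded test(1) mu(3)])
        show "1 < 48 / c" "0 \<le> 64 / c" "0 < c / 8" using c by (simp_all add: field_simps)
      qed (use elim in simp_all)
      also have "\<dots> \<le> ennreal (C1 * \<bar>\<eta>1 d\<bar>) + ennreal (C2 * \<bar>\<eta>2 d\<bar>) + ennreal (K * (C3 * \<bar>\<eta>2 d\<bar>))"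
      proof (intro add_mono elim ennreal_leI)
        \<comment> \<open>The exponent is (48 - c)^2 t_alg / 512, and 47^2 \<ge> 1024 makes it at
          least 2 t_alg, the rate already compared with \<open>\<eta>2\<close>.\<close>
        have eq: "(48 / c - 1)\<^sup>2 * c\<^sup>2 = (48 - c)\<^sup>2"
          using c by (simp add: field_simps flip: power_mult_distrib)
        have "47\<^sup>2 \<le> (48 - c)\<^sup>2" using c by (intro power_mono) auto
        then have "t_alg d * 1024 \<le> t_alg d * (48 - c)\<^sup>2" using t_alg[of d] by (intro mult_left_mono) auto
        also have "\<dots> = ?a * (c\<^sup>2 / 256 * t_alg d) * 512" unfolding eq[symmetric] by simp
        finally have "exp (- (?a * (c\<^sup>2 / 256 * t_alg d))) \<le> exp (- 2 * t_alg d)" by simp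
        also have "\<dots> \<le> C3 * \<bar>\<eta>2 d\<bar>" by (rule elim)
        finally have "K * exp (- (?a * (c\<^sup>2 / 256 * t_alg d))) \<le> K * (C3 * \<bar>\<eta>2 d\<bar>)"
          using K by (rule mult_left_mono)
        then show "?e \<le> K * (C3 * \<bar>\<eta>2 d\<bar>)"
          unfolding K_def by (simp only: times_divide_eq_left times_divide_eq_right)
      qed
      also have "\<dots> = ennreal (C1 * \<bar>\<eta>1 d\<bar> + C2 * \<bar>\<eta>2 d\<bar> + K * (C3 * \<bar>\<eta>2 d\<bar>))"
        using C1(1) C2(1) C3 K by (simp add: ennreal_plus)
      also have "\<dots> \<le> ennreal ((C1 + C2 + K * C3) * \<bar>?\<eta>\<bar>)"
      proof (rule ennreal_leI)
        have "C1 * \<bar>\<eta>1 d\<bar> \<le> C1 * ?\<eta>" "C2 * \<bar>\<eta>2 d\<bar> \<le> C2 * ?\<eta>" "K * C3 * \<bar>\<eta>2 d\<bar> \<le> K * C3 * ?\<eta>"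
          using C1(1) C2(1) C3 K by (auto intro!: mult_left_mono)
        moreover have "\<bar>?\<eta>\<bar> = ?\<eta>" by (rule abs_of_nonneg) (simp add: le_max_iff_disj)
        ultimately show "C1 * \<bar>\<eta>1 d\<bar> + C2 * \<bar>\<eta>2 d\<bar> + K * (C3 * \<bar>\<eta>2 d\<bar>) \<le> (C1 + C2 + K * C3) * \<bar>?\<eta>\<bar>"
          by (simp add: distrib_right mult.assoc)
      qed
      finally show ?case .
    qed
  qed (use C1 C2 C3 K in simp)
  define p where "p d = 2 * exp (- (t_alg d / 4)) + enn2real (nul d)" for d
  define e where "e d = (\<integral>x. vnorm d x \<partial>\<mu> d)" for d
  \<comment> \<open>In the finitely many exceptional dimensions the value \<alpha> makes the lower
    bound 0. The sequence is fixed before \<Delta>, so the rate is uniform over all step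
    sizes.\<close>
  define r where "r d = (if 0 < d \<and> \<bar>\<delta> d\<bar> \<le> c / 8 then max 0 (\<alpha> - e d) + p d else \<alpha>)" for d
  have r_lim: "r \<longlonglongrightarrow> 0"
  proof -
    have "(\<lambda>d. enn2real (nul d)) \<longlonglongrightarrow> enn2real 0" by (rule tendsto_enn2real) (simp_all add: O_lim)
    then have "p \<longlonglongrightarrow> 0"
      using tendsto_add[OF tendsto_mult[OF tendsto_const[of 2] exp_lim]] by (simp add: p_def[abs_def])
    moreover have "(\<lambda>d. max 0 (\<alpha> - e d)) \<longlonglongrightarrow> 0"
      using alpha(1) unfolding e_def[abs_def] by (rule liminf_real_deficit)
    ultimately have "(\<lambda>d. max 0 (\<alpha> - e d) + p d) \<longlonglongrightarrow> 0" using tendsto_add by fastforce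
    moreover have "\<forall>\<^sub>F d in sequentially. max 0 (\<alpha> - e d) + p d = r d"
      using ev_d ev_\<delta> by eventually_elim (simp add: r_def)
    ultimately show ?thesis by (rule Lim_transform_eventually)
  qed
  have M3: "ennreal (\<alpha> - r d) \<le> (INF k\<in>{k. real k * \<Delta> d \<ge> (1 + \<delta> d) * t_alg d}.
      wasserstein1 d (discretized_drift_law d (m d) (\<Delta> d) k) (\<mu> d))" if \<Delta>: "\<And>d. 0 < \<Delta> d" for \<Delta> d
  proof (cases "0 < d \<and> \<bar>\<delta> d\<bar> \<le> c / 8")
    case True
    interpret observed_signal d "\<mu> d" "M d" "X d" "W d" by (rule signal)
    show ?thesis
    proof (rule INF_greatest)
      fix k assume "k \<in> {k. real k * \<Delta> d \<ge> (1 + \<delta> d) * t_alg d}"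
      then have k: "t_alg d * (1 + \<delta> d) \<le> real k * \<Delta> d" by (simp add: mult.commute)
      have "emeasure (discretized_drift_law d (m d) (\<Delta> d) k) {v \<in> space (euc d). vnorm d v \<noteq> 0 \<and> vnorm d v < 2}
          \<le> ennreal (2 * exp (- (t_alg d / 4))) + nul d"
        unfolding m_def nul_def T_def A_def
        using True by (intro discretized_drift_far[OF c t_alg _ \<Delta> _ m0(1) m0_bounded test(1) k]) auto
      also have "\<dots> = ennreal (p d)"
      proof -
        have "nul d < top" using O_le_1[of d] by (rule le_less_trans) simp
        then show ?thesis by (simp add: p_def ennreal_plus)
      qed
      finally have "ennreal (e d - p d) \<le> wasserstein1 d (discretized_drift_law d (m d) (\<Delta> d) k) (\<mu> d)"
        unfolding e_def by (rule wasserstein1_lower_bound[OF mu]) (simp add: p_def)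
      moreover have "ennreal (\<alpha> - r d) \<le> ennreal (e d - p d)"
        using True by (intro ennreal_leI) (simp add: r_def)
      ultimately show "ennreal (\<alpha> - r d) \<le> wasserstein1 d (discretized_drift_law d (m d) (\<Delta> d) k) (\<mu> d)"
        by (rule order_trans[rotated])
    qed
  qed (auto simp: r_def)
  show ?thesis
    using drift poly M2 r_lim M3 by blast
qed

end
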